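(* Let $(X,\rho,\mu)$ be a space of homogeneous type and let $T$ be an operator defined on bounded functions with bounded support. Suppose that for some exponents $1\le p_0\le q_0<\infty$ and some $\alpha>0$, $$\|Tf\|_{L^{q_0,\infty}(w^{q_0})}\le C[w]_{A_{p_0,q_0}}^\alpha\|f\|_{L^{p_0}(w^{p_0})}$$ for all weights $w\in A_{p_0,q_0}$ and all such $f$. Then for all exponents $1<p\le q<\infty$ with $1/p-1/q=1/p_0-1/q_0$ and all $w\in A_{p,q}$, $$\|Tf\|_{L^{q,\infty}(w^q)}\le C'[w]_{A_{p,q}}^{\alpha\max\{1,\frac{q_0}{p_0'}\frac{p'}{q}\}}\|f\|_{L^p(w^p)},$$ where $C'$ depends only on $C$, $\alpha$, $p_0,q_0,p,q$ and the space.
   Context: $(X,\rho,\mu)$ is a space of homogeneous type: $\rho$ a quasi-metric with $\rho(x,y)\le A_0(\rho(x,z)+\rho(z,y))$, $A_0\ge1$; balls $B(x,r)=\{y:\rho(x,y)<r\}$; $\mu$ a positive Borel measure with $0<\mu(B(x,2r))\le C_\mu\mu(B(x,r))<\infty$. $L^p(v)=L^p(X,v\,d\mu)$; $\|f\|_{L^{q,\infty}(v)}=\sup_{\lambda>0}\lambda\,v(\{|f|>\lambda\})^{1/q}$. $p'$ is the dual exponent ($1'=\infty$, $1/\infty=0$). $Mf(x)=\sup_{B\ni x}\frac1{\mu(B)}\int_B|f|d\mu$. For $1<p\le q<\infty$, $[w]_{A_{p,q}}=\sup_B\big(\frac1{\mu(B)}\int_Bw^qd\mu\big)\big(\frac1{\mu(B)}\int_Bw^{-p'}d\mu\big)^{q/p'}$;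 for $1\le q<\infty$, $[w]_{A_{1,q}}$ is the least $C$ with $M(w^q)\le Cw^q$ a.e. *)

theory Defs
  imports "HOL-Analysis.Analysis"
begin

definition qball :: "('a \<Rightarrow> 'a \<Rightarrow> real) \<Rightarrow> 'a \<Rightarrow> real \<Rightarrow> 'a set" where
  "qball \<rho> x r = {y. \<rho> x y < r}"

definition quasi_metric :: "('a \<Rightarrow> 'a \<Rightarrow> real) \<Rightarrow> real \<Rightarrow> bool" where
  "quasi_metric \<rho> A0 \<longleftrightarrow> A0 \<ge> 1 \<and>
     (\<forall>x y. \<rho> x y \<ge> 0) \<and> (\<forall>x y. \<rho> x y = 0 \<longleftrightarrow> x = y) \<and>
     (\<forall>x y. \<rho> x y = \<rho> y x) \<and>
     (\<forall>x y z. \<rho> x y \<le> A0 * (\<rho> x z + \<rho> z y))"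

definition qopen :: "('a \<Rightarrow> 'a \<Rightarrow> real) \<Rightarrow> 'a set \<Rightarrow> bool" where
  "qopen \<rho> U \<longleftrightarrow> (\<forall>x\<in>U. \<exists>r>0. qball \<rho> x r \<subseteq> U)"

definition homogeneous_type ::
  "('a \<Rightarrow> 'a \<Rightarrow> real) \<Rightarrow> 'a measure \<Rightarrow> real \<Rightarrow> real \<Rightarrow> bool" where
  "homogeneous_type \<rho> \<mu> A0 C\<mu> \<longleftrightarrow> quasi_metric \<rho> A0 \<and> space \<mu> = UNIV \<and>
     (\<forall>U. qopen \<rho> U \<longrightarrow> U \<in> sets \<mu>) \<and>
     (\<forall>x r. qball \<rho> x r \<in> sets \<mu>) \<and>
     (\<forall>x r. r > 0 \<longrightarrow> 0 < emeasure \<mu> (qball \<rho> x (2*r)) \<and>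
        emeasure \<mu> (qball \<rho> x (2*r)) \<le> ennreal C\<mu> * emeasure \<mu> (qball \<rho> x r) \<and>
        emeasure \<mu> (qball \<rho> x r) < \<infinity>)"

definition enn_powr :: "ennreal \<Rightarrow> real \<Rightarrow> ennreal" where
  "enn_powr x a = (if x = \<infinity> then \<infinity> else ennreal (enn2real x powr a))"

definition avg :: "'a measure \<Rightarrow> 'a set \<Rightarrow> ('a \<Rightarrow> real) \<Rightarrow> ennreal" where
  "avg \<mu> B g = (\<integral>\<^sup>+x\<in>B. ennreal \<bar>g x\<bar> \<partial>\<mu>) / emeasure \<mu> B"

definition maximal :: "('a \<Rightarrow> 'a \<Rightarrow> real) \<Rightarrow> 'a measure \<Rightarrow> ('a \<Rightarrow> real) \<Rightarrow> 'a \<Rightarrow> ennreal" where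
  "maximal \<rho> \<mu> f x = (SUP (y, r)\<in>{(y, r). r > 0 \<and> x \<in> qball \<rho> y r}. avg \<mu> (qball \<rho> y r) f)"

text \<open>Characteristic quantity of A_{p,q} on one ball (case p > 1); all averages are finite
  for weights in the class, so real arithmetic is used.\<close>
definition Apq_ball :: "('a \<Rightarrow> 'a \<Rightarrow> real) \<Rightarrow> 'a measure \<Rightarrow> real \<Rightarrow> real \<Rightarrow> ('a \<Rightarrow> real) \<Rightarrow> 'a \<Rightarrow> real \<Rightarrow> real" where
  "Apq_ball \<rho> \<mu> p q w x r =
     enn2real (avg \<mu> (qball \<rho> x r) (\<lambda>y. w y powr q)) *
     enn2real (avg \<mu> (qball \<rho> x r) (\<lambda>y. w y powr (- (p / (p - 1))))) powr (q / (p / (p - 1)))"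

definition is_weight :: "'a measure \<Rightarrow> ('a \<Rightarrow> real) \<Rightarrow> bool" where
  "is_weight \<mu> w \<longleftrightarrow> w \<in> borel_measurable \<mu> \<and> (\<forall>x. w x \<ge> 0) \<and> (AE x in \<mu>. w x > 0)"

definition in_Apq :: "('a \<Rightarrow> 'a \<Rightarrow> real) \<Rightarrow> 'a measure \<Rightarrow> real \<Rightarrow> real \<Rightarrow> ('a \<Rightarrow> real) \<Rightarrow> bool" where
  "in_Apq \<rho> \<mu> p q w \<longleftrightarrow> is_weight \<mu> w \<and>
     (if p = 1 then
        (\<forall>x r. r > 0 \<longrightarrow> avg \<mu> (qball \<rho> x r) (\<lambda>y. w y powr q) < \<infinity>) \<and>
        (\<exists>C::real. AE x in \<mu>. maximal \<rho> \<mu> (\<lambda>y. w y powr q) x \<le> ennreal (C * w x powr q))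
      else
        (\<forall>x r. r > 0 \<longrightarrow> avg \<mu> (qball \<rho> x r) (\<lambda>y. w y powr q) < \<infinity> \<and>
                        avg \<mu> (qball \<rho> x r) (\<lambda>y. w y powr (- (p / (p - 1)))) < \<infinity>) \<and>
        bdd_above {Apq_ball \<rho> \<mu> p q w x r | x r. r > 0})"

definition Apq_const :: "('a \<Rightarrow> 'a \<Rightarrow> real) \<Rightarrow> 'a measure \<Rightarrow> real \<Rightarrow> real \<Rightarrow> ('a \<Rightarrow> real) \<Rightarrow> real" where
  "Apq_const \<rho> \<mu> p q w =
     (if p = 1 then Inf {C. C \<ge> 0 \<and> (AE x in \<mu>. maximal \<rho> \<mu> (\<lambda>y. w y powr q) x \<le> ennreal (C * w x powr q))}
      else Sup {Apq_ball \<rho> \<mu> p q w x r | x r. r > 0})"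

definition Lp_norm :: "'a measure \<Rightarrow> ('a \<Rightarrow> real) \<Rightarrow> real \<Rightarrow> ('a \<Rightarrow> real) \<Rightarrow> ennreal" where
  "Lp_norm \<mu> v p f = enn_powr (\<integral>\<^sup>+x. ennreal (\<bar>f x\<bar> powr p * v x) \<partial>\<mu>) (1 / p)"

definition weak_norm :: "'a measure \<Rightarrow> ('a \<Rightarrow> real) \<Rightarrow> real \<Rightarrow> ('a \<Rightarrow> real) \<Rightarrow> ennreal" where
  "weak_norm \<mu> v q g = (SUP t\<in>{0<..}. ennreal t *
      enn_powr (\<integral>\<^sup>+x. indicator {y. \<bar>g y\<bar> > t} x * ennreal (v x) \<partial>\<mu>) (1 / q))"

definition bdd_bdd_supp :: "('a \<Rightarrow> 'a \<Rightarrow> real) \<Rightarrow> 'a measure \<Rightarrow> ('a \<Rightarrow> real) \<Rightarrow> bool" where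
  "bdd_bdd_supp \<rho> \<mu> f \<longleftrightarrow> f \<in> borel_measurable \<mu> \<and> (\<exists>M. \<forall>x. \<bar>f x\<bar> \<le> M) \<and>
     (\<exists>x0 R. {x. f x \<noteq> 0} \<subseteq> qball \<rho> x0 R)"

end

(*
  Fix w in A_{p,q} and put v = w^q. With K = 1/p' + 1/q = 1/p_0' + 1/q_0, r = K q and r_0 = K q_0,
  w lies in A_{p,q} exactly when v is a Muckenhoupt A_r weight with the same constant, and likewise
  for (p_0,q_0). One looks for u = W^{q_0} in A_{r_0}, adapted to f or to the level set of Tf, so that
  the hypothesis for W and Hoelder's inequality give the bound for w.

  If q < q_0, take u = G^{r-r_0} v, where G >= (|f|^p w^p / v)^{1/r} is an A_1 majorant, bounded
  in L^r(v). If q > q_0, take u = U^theta v^{1-theta} with theta = (r-r_0)/(r-1), where U is an A_1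
  majorant of 1_E v in L^{r'}(v^{-1/(r-1)}) and E is a bounded part of the level set of Tf. The
  majorants come from Rubio de Francia's iteration; their A_1 constants are controlled by Buckley's
  sharp bound for the maximal operator, obtained by Lerner's pointwise domination through
  weighted maximal operators. All maximal operators are taken over a countable family of balls, so
  measurability is free and Vitali's covering lemma is only needed for finite subfamilies.
*)
theory Submission
  imports Defs
begin

section \<open>Powers of extended nonnegative reals\<close>

text \<open>The exponent records how the constant of u depends on A = [v]_{A_r}. Buckley's bound
  makes the norm of the maximal operator on L^r(v), hence the A_1 constant of a majorant built
  there, of order A^{1/(r-1)}. For q < q_0, u costs the power r_0 - r of that constant times A, that
  is A^{(r_0-1)/(r-1)}, and (r_0-1)/(r-1) = (q_0/p_0')(p'/q). For q > q_0 the majorant lives in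
  L^{r'}(sigma) with sigma = v^{-1/(r-1)}, whose A_{r'} constant is A^{1/(r-1)}; as r'-1 = 1/(r-1),
  its A_1 constant is of order A, and u costs A^theta A^{1-theta} = A. Apart from measurability, T
  is known only through the weak type estimates, so f and Tf stay a fixed pair and only the weight
  varies. For q > q_0 the estimate has v(E) on both sides; it can be divided out only if finite,
  which is why E is cut to balls and the level set exhausted. The endpoint p_0 = 1 fits in with r_0
  = 1, theta = 1 and u = U.\<close>

lemma enn_powr_ennreal [simp]: "0 \<le> x \<Longrightarrow> enn_powr (ennreal x) a = ennreal (x powr a)"
  by (simp add: enn_powr_def)

lemma enn_powr_top [simp]: "enn_powr \<infinity> a = \<infinity>" "enn_powr top a = top"
  by (simp_all add: enn_powr_def)

lemma enn_powr_zero [simp]: "enn_powr 0 a = 0"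
  by (simp add: enn_powr_def)

lemma enn_powr_one [simp]: "enn_powr x 1 = x"
  by (cases x) (simp_all)

lemma enn_powr_measurable [measurable]:
  assumes [measurable]: "f \<in> borel_measurable M"
  shows "(\<lambda>x. enn_powr (f x) a) \<in> borel_measurable M"
  unfolding enn_powr_def by measurable

lemma enn_powr_mono: "a \<ge> 0 \<Longrightarrow> x \<le> y \<Longrightarrow> enn_powr x a \<le> enn_powr y a"
  by (cases x; cases y) (auto simp: top_unique intro!: ennreal_leI powr_mono2)

lemma enn_powr_mult:
  assumes "a > 0" shows "enn_powr (x * y) a = enn_powr x a * enn_powr y a"
proof (cases x; cases y)
  fix r s :: real
  assume "0 \<le> r" "x = ennreal r" "0 \<le> s" "y = ennreal s"
  then show ?thesis
    by (simp add: powr_mult flip: ennreal_mult)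
qed (auto simp: ennreal_mult_top ennreal_top_mult)

lemma enn_powr_powr:
  assumes "a > 0" shows "enn_powr (enn_powr x a) b = enn_powr x (a * b)"
  by (cases x) (auto simp: powr_powr)

lemma enn_powr_add:
  assumes "a > 0" "b > 0" shows "enn_powr x (a + b) = enn_powr x a * enn_powr x b"
  using assms by (cases x) (auto simp: powr_add ennreal_mult ennreal_top_mult)

text \<open>Moves a power to the other side of an inequality, so that powers of suprema can be
  bounded term by term without continuity of \<open>enn_powr\<close>.\<close>

lemma enn_powr_le_iff:
  assumes "a > 0" shows "enn_powr x a \<le> y \<longleftrightarrow> x \<le> enn_powr y (1 / a)"
proof
  assume "enn_powr x a \<le> y"
  then have "enn_powr (enn_powr x a) (1 / a) \<le> enn_powr y (1 / a)"
    using assms by (intro enn_powr_mono) auto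
  then show "x \<le> enn_powr y (1 / a)" using assms by (simp add: enn_powr_powr)
next
  assume "x \<le> enn_powr y (1 / a)"
  then have "enn_powr x a \<le> enn_powr (enn_powr y (1 / a)) a"
    using assms by (intro enn_powr_mono) auto
  then show "enn_powr x a \<le> y" using assms by (simp add: enn_powr_powr)
qed

section \<open>Layer-cake formula, Marcinkiewicz interpolation and Hoelder's inequality\<close>

lemma nn_integral_powr_from_0:
  fixes r c :: real
  assumes "r > 0" "c \<ge> 0"
  shows "(\<integral>\<^sup>+t. ennreal (r * t powr (r - 1)) * indicator {t. 0 \<le> t \<and> ennreal t < ennreal c} t \<partial>lborel)
    = ennreal (c powr r)"
proof -
  have I: "((\<lambda>t. r * t powr (r - 1)) has_integral (r * (c powr (r - 1 + 1) / (r - 1 + 1)))) {0..c}"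
    by (intro has_integral_mult_right has_integral_powr_from_0) (use assms in auto)
  have "(\<integral>\<^sup>+t. ennreal (r * t powr (r - 1)) * indicator {t. 0 \<le> t \<and> ennreal t < ennreal c} t \<partial>lborel)
    = (\<integral>\<^sup>+t. ennreal (r * t powr (r - 1)) * indicator {0..c} t \<partial>lborel)"
    by (rule nn_integral_cong_AE, rule AE_mp[OF AE_lborel_singleton[of c]])
      (auto simp: indicator_def ennreal_less_iff)
  also have "\<dots> = ennreal (r * (c powr (r - 1 + 1) / (r - 1 + 1)))"
    by (rule nn_integral_has_integral_lebesgue'[OF _ I]) (use assms in auto)
  finally show ?thesis using assms by simp
qed

text \<open>The guard \<open>0 \<le> t\<close> matters: \<open>ennreal\<close> sends negative reals
  to 0, so without it negative \<open>t\<close> would be counted whenever \<open>x\<close> is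
  positive.\<close>

lemma enn_powr_layer_cake:
  assumes r: "r > 0"
  shows "enn_powr x r =
    (\<integral>\<^sup>+t. ennreal (r * t powr (r - 1)) * indicator {t. 0 \<le> t \<and> ennreal t < x} t \<partial>lborel)"
proof (cases x)
  case (real c)
  then show ?thesis using nn_integral_powr_from_0[OF r, of c] by simp
next
  case top
  define J where "J = (\<integral>\<^sup>+t. ennreal (r * t powr (r - 1)) * indicator {t. 0 \<le> t \<and> ennreal t < x} t \<partial>lborel)"
  have "ennreal (real n) \<le> J" for n
  proof -
    have "ennreal (real n) = ennreal ((real n powr (1 / r)) powr r)"
      using r by (simp add: powr_powr)
    also have "\<dots> = (\<integral>\<^sup>+t. ennreal (r * t powr (r - 1)) *
        indicator {t. 0 \<le> t \<and> ennreal t < ennreal (real n powr (1 / r))} t \<partial>lborel)"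
      by (rule nn_integral_powr_from_0[symmetric]) (use r in auto)
    also have "\<dots> \<le> J"
      unfolding J_def by (intro nn_integral_mono mult_left_mono) (auto simp: indicator_def top)
    finally show ?thesis .
  qed
  then have "J = top"
    by (metis SUP_least ennreal_SUP_of_nat_eq_top ennreal_of_nat_eq_real_of_nat top_unique)
  then show ?thesis unfolding J_def by (simp add: top)
qed

text \<open>The truncation of \<open>f\<close> at height t/2 is already built into the hypothesis.
  Integrating it against r t^(r-1) dt and exchanging the integrals leaves f (2 f)^(r-1) under the
  integral sign, which gives the constant.\<close>

lemma marcinkiewicz_weak_1_infinity:
  assumes "sigma_finite_measure M" and r: "r > 1"
    and [measurable]: "f \<in> borel_measurable M" "g \<in> borel_measurable M"
    and weak: "\<And>t. t > 0 \<Longrightarrow> ennreal t * emeasure M {x \<in> space M. ennreal t < g x}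
      \<le> 2 * (\<integral>\<^sup>+x. f x * indicator {x. ennreal t < 2 * f x} x \<partial>M)"
  shows "(\<integral>\<^sup>+x. enn_powr (g x) r \<partial>M)
    \<le> ennreal (2 powr r * r / (r - 1)) * (\<integral>\<^sup>+x. enn_powr (f x) r \<partial>M)"
proof -
  interpret M: sigma_finite_measure M by fact
  interpret P: pair_sigma_finite M lborel ..
  have [measurable]: "Measurable.pred (M \<Otimes>\<^sub>M borel) (\<lambda>(x, t). 0 \<le> t \<and> ennreal t < g x)"
    "Measurable.pred (M \<Otimes>\<^sub>M borel) (\<lambda>(x, t). 0 \<le> t \<and> ennreal t < 2 * f x)"
    by measurable
  have "(\<integral>\<^sup>+x. enn_powr (g x) r \<partial>M) = (\<integral>\<^sup>+x. (\<integral>\<^sup>+t. ennreal (r * t powr (r - 1)) *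
      indicator {(x, t). 0 \<le> t \<and> ennreal t < g x} (x, t) \<partial>lborel) \<partial>M)"
    by (subst enn_powr_layer_cake) (use r in \<open>auto intro!: nn_integral_cong simp: indicator_def\<close>)
  also have "\<dots> = (\<integral>\<^sup>+t. (\<integral>\<^sup>+x. ennreal (r * t powr (r - 1)) *
      indicator {(x, t). 0 \<le> t \<and> ennreal t < g x} (x, t) \<partial>M) \<partial>lborel)"
    by (rule P.Fubini'[symmetric]) measurable
  also have "\<dots> \<le> (\<integral>\<^sup>+t. (\<integral>\<^sup>+x. ennreal (2 * r / (r - 1)) * f x * (ennreal ((r - 1) * t powr (r - 1 - 1)) *
      indicator {(x, t). 0 \<le> t \<and> ennreal t < 2 * f x} (x, t)) \<partial>M) \<partial>lborel)"
  proof (rule nn_integral_mono_AE, rule AE_mp[OF AE_lborel_singleton[of 0]], rule AE_I2, intro impI)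
    fix t :: real assume t0: "t \<noteq> 0"
    show "(\<integral>\<^sup>+x. ennreal (r * t powr (r - 1)) * indicator {(x, t). 0 \<le> t \<and> ennreal t < g x} (x, t) \<partial>M)
      \<le> (\<integral>\<^sup>+x. ennreal (2 * r / (r - 1)) * f x * (ennreal ((r - 1) * t powr (r - 1 - 1)) *
        indicator {(x, t). 0 \<le> t \<and> ennreal t < 2 * f x} (x, t)) \<partial>M)"
    proof (cases "t < 0")
      case True then show ?thesis by simp
    next
      case False
      then have t: "t > 0" using t0 by simp
      have "(\<integral>\<^sup>+x. ennreal (r * t powr (r - 1)) * indicator {(x, t). 0 \<le> t \<and> ennreal t < g x} (x, t) \<partial>M)
        = (\<integral>\<^sup>+x. ennreal (r * t powr (r - 1)) * indicator {x \<in> space M. ennreal t < g x} x \<partial>M)"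
        using t by (intro nn_integral_cong) (auto simp: indicator_def)
      also have "\<dots> = ennreal (r * t powr (r - 1)) * emeasure M {x \<in> space M. ennreal t < g x}"
        by (rule nn_integral_cmult_indicator) measurable
      \<comment> \<open>One factor t is split off for the weak estimate. What remains, t^(r-2), is
        up to the factor r - 1 the layer-cake density of exponent r - 1, so the inner t-integral
        becomes a power of 2 f.\<close>
      also have "\<dots> = ennreal (r * t powr (r - 2)) * (ennreal t * emeasure M {x \<in> space M. ennreal t < g x})"
      proof -
        have "r * t powr (r - 1) = r * t powr (r - 2) * t"
          using t by (simp add: powr_diff power2_eq_square powr_numeral)
        then show ?thesis using t r by (simp add: ennreal_mult mult.assoc)
      qed
      also have "\<dots> \<le> ennreal (r * t powr (r - 2)) *
          (2 * (\<integral>\<^sup>+x. f x * indicator {x. ennreal t < 2 * f x} x \<partial>M))"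
        by (intro mult_left_mono weak t) simp
      also have "\<dots> = (\<integral>\<^sup>+x. ennreal (r * t powr (r - 2)) * 2 *
          (f x * indicator {x. ennreal t < 2 * f x} x) \<partial>M)"
        by (subst nn_integral_cmult) (auto simp: mult.assoc)
      also have "\<dots> = (\<integral>\<^sup>+x. ennreal (2 * r / (r - 1)) * f x * (ennreal ((r - 1) * t powr (r - 1 - 1)) *
        indicator {(x, t). 0 \<le> t \<and> ennreal t < 2 * f x} (x, t)) \<partial>M)"
      proof (rule nn_integral_cong)
        fix x
        have "ennreal (r * t powr (r - 2)) * 2 = ennreal (r * t powr (r - 2) * 2)"
          using r by (subst ennreal_mult) auto
        also have "r * t powr (r - 2) * 2 = 2 * r / (r - 1) * ((r - 1) * t powr (r - 1 - 1))"
          using r by (simp add: field_simps)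
        also have "ennreal \<dots> = ennreal (2 * r / (r - 1)) * ennreal ((r - 1) * t powr (r - 1 - 1))"
          using r by (intro ennreal_mult) auto
        finally show "ennreal (r * t powr (r - 2)) * 2 * (f x * indicator {x. ennreal t < 2 * f x} x) =
          ennreal (2 * r / (r - 1)) * f x * (ennreal ((r - 1) * t powr (r - 1 - 1)) *
          indicator {(x, t). 0 \<le> t \<and> ennreal t < 2 * f x} (x, t))"
          using t by (simp add: indicator_def mult_ac)
      qed
      finally show ?thesis .
    qed
  qed
  also have "\<dots> = (\<integral>\<^sup>+x. (\<integral>\<^sup>+t. ennreal (2 * r / (r - 1)) * f x * (ennreal ((r - 1) * t powr (r - 1 - 1)) *
      indicator {(x, t). 0 \<le> t \<and> ennreal t < 2 * f x} (x, t)) \<partial>lborel) \<partial>M)"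
    by (rule P.Fubini') measurable
  also have "\<dots> = (\<integral>\<^sup>+x. ennreal (2 powr r * r / (r - 1)) * enn_powr (f x) r \<partial>M)"
  proof (rule nn_integral_cong)
    fix x
    have "(\<integral>\<^sup>+t. ennreal (2 * r / (r - 1)) * f x * (ennreal ((r - 1) * t powr (r - 1 - 1)) *
      indicator {(x, t). 0 \<le> t \<and> ennreal t < 2 * f x} (x, t)) \<partial>lborel)
      = ennreal (2 * r / (r - 1)) * f x * (\<integral>\<^sup>+t. ennreal ((r - 1) * t powr (r - 1 - 1)) *
      indicator {t. 0 \<le> t \<and> ennreal t < 2 * f x} t \<partial>lborel)"
      by (subst nn_integral_cmult[symmetric]) (auto intro!: nn_integral_cong simp: indicator_def)
    also have "\<dots> = ennreal (2 * r / (r - 1)) * f x * enn_powr (2 * f x) (r - 1)"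
      by (subst enn_powr_layer_cake[of "r - 1"]) (use r in auto)
    also have "\<dots> = ennreal (2 * r / (r - 1)) * ennreal (2 powr (r - 1)) * (enn_powr (f x) 1 * enn_powr (f x) (r - 1))"
      using r enn_powr_ennreal[of 2 "r - 1"] by (simp add: enn_powr_mult mult_ac)
    also have "\<dots> = ennreal (2 * r / (r - 1) * 2 powr (r - 1)) * enn_powr (f x) (1 + (r - 1))"
    proof -
      have "ennreal (2 * r / (r - 1) * 2 powr (r - 1)) = ennreal (2 * r / (r - 1)) * ennreal (2 powr (r - 1))"
        using r by (intro ennreal_mult) auto
      then show ?thesis using r by (subst enn_powr_add) simp_all
    qed
    also have "2 * r / (r - 1) * 2 powr (r - 1) = 2 powr r * r / (r - 1)"
      using r by (simp add: powr_diff divide_simps)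
    finally show "(\<integral>\<^sup>+t. ennreal (2 * r / (r - 1)) * f x * (ennreal ((r - 1) * t powr (r - 1 - 1)) *
      indicator {(x, t). 0 \<le> t \<and> ennreal t < 2 * f x} (x, t)) \<partial>lborel)
      = ennreal (2 powr r * r / (r - 1)) * enn_powr (f x) r"
      by simp
  qed
  also have "\<dots> = ennreal (2 powr r * r / (r - 1)) * (\<integral>\<^sup>+x. enn_powr (f x) r \<partial>M)"
    by (rule nn_integral_cmult) measurable
  finally show ?thesis .
qed

text \<open>Weighted AM-GM for f/F and g/G, integrated. Positive upper bounds \<open>F\<close>,
  \<open>G\<close> in place of the norms keep the normalisation free of division by zero or
  infinity.\<close>

lemma nn_integral_Holder_bound:
  fixes f g :: "'a \<Rightarrow> real"
  assumes [measurable]: "f \<in> borel_measurable M" "g \<in> borel_measurable M"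
    and nonneg: "\<And>x. f x \<ge> 0" "\<And>x. g x \<ge> 0"
    and F: "F > 0" "(\<integral>\<^sup>+x. ennreal (f x) \<partial>M) \<le> ennreal F"
    and G: "G > 0" "(\<integral>\<^sup>+x. ennreal (g x) \<partial>M) \<le> ennreal G"
    and ab: "a \<ge> 0" "b \<ge> 0" "a + b = 1"
  shows "(\<integral>\<^sup>+x. ennreal (f x powr a * g x powr b) \<partial>M) \<le> ennreal (F powr a * G powr b)"
proof -
  have young: "f x powr a * g x powr b \<le> F powr a * G powr b * (a / F * f x + b / G * g x)" for x
  proof (cases "f x = 0 \<or> g x = 0")
    case True
    then show ?thesis using nonneg[of x] F(1) G(1) ab by auto
  next
    case False
    then have p: "f x > 0" "g x > 0" using nonneg[of x] by auto
    have "(f x / F) powr a * (g x / G) powr b \<le> a * (f x / F) + b * (g x / G)"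
      using p F G ab by (intro Youngs_inequality_0) auto
    then have "F powr a * G powr b * ((f x / F) powr a * (g x / G) powr b)
      \<le> F powr a * G powr b * (a * (f x / F) + b * (g x / G))"
      by (intro mult_left_mono) auto
    also have "F powr a * G powr b * ((f x / F) powr a * (g x / G) powr b) = f x powr a * g x powr b"
      using p F(1) G(1) by (simp add: powr_divide)
    finally show ?thesis by (simp add: field_simps)
  qed
  have "(\<integral>\<^sup>+x. ennreal (f x powr a * g x powr b) \<partial>M)
    \<le> (\<integral>\<^sup>+x. ennreal (F powr a * G powr b) * (ennreal (a / F) * ennreal (f x) + ennreal (b / G) * ennreal (g x)) \<partial>M)"
  proof (rule nn_integral_mono)
    fix x
    have "ennreal (f x powr a * g x powr b) \<le> ennreal (F powr a * G powr b * (a / F * f x + b / G * g x))"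
      by (rule ennreal_leI[OF young])
    also have "\<dots> = ennreal (F powr a * G powr b) * (ennreal (a / F) * ennreal (f x) + ennreal (b / G) * ennreal (g x))"
      using nonneg[of x] F(1) G(1) ab by (simp flip: ennreal_mult ennreal_plus)
    finally show "ennreal (f x powr a * g x powr b) \<le> \<dots>" .
  qed
  also have "\<dots> = ennreal (F powr a * G powr b) * (ennreal (a / F) * (\<integral>\<^sup>+x. ennreal (f x) \<partial>M)
      + ennreal (b / G) * (\<integral>\<^sup>+x. ennreal (g x) \<partial>M))"
    by (simp add: nn_integral_cmult nn_integral_add)
  also have "\<dots> \<le> ennreal (F powr a * G powr b) * (ennreal (a / F) * ennreal F + ennreal (b / G) * ennreal G)"
    by (intro mult_left_mono add_mono F G) auto
  also have "ennreal (a / F) * ennreal F + ennreal (b / G) * ennreal G = 1"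
    using F(1) G(1) ab by (simp flip: ennreal_mult ennreal_plus)
  finally show ?thesis by simp
qed

section \<open>The weighted maximal operator of a countable family of balls\<close>

lemma ennreal_divide_mult_le: "a / b * b \<le> (a :: ennreal)"
proof (cases "b = 0 \<or> b = top")
  case False
  have "a / b * b = a * b / b" by (simp add: divide_ennreal_def mult_ac)
  then show ?thesis using False by (simp add: mult_divide_eq_ennreal)
qed auto

lemma ennreal_mult_divide_le: "c * b / b \<le> (c :: ennreal)"
  by (cases "b = 0 \<or> b = top") (auto simp: mult_divide_eq_ennreal)

text \<open>Collects what the theory of maximal operators needs, detached from the quasi-metric.
  \<open>Bs i\<close> will be the dilate of the ball \<open>B i\<close> by the factor that Vitali's
  lemma requires.\<close>

locale ball_family =
  fixes \<mu> :: "'a measure" and B Bs :: "nat \<Rightarrow> 'a set" and D :: real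
  assumes sigma_finite: "sigma_finite_measure \<mu>"
    and B_sets [measurable]: "\<And>i. B i \<in> sets \<mu>"
    and Bs_sets [measurable]: "\<And>i. Bs i \<in> sets \<mu>"
    and B_subset_Bs: "\<And>i. B i \<subseteq> Bs i"
    and B_pos: "\<And>i. 0 < emeasure \<mu> (B i)"
    and Bs_finite: "\<And>i. emeasure \<mu> (Bs i) < \<infinity>"
    and D_pos: "D > 0"
    and doubling: "\<And>i. emeasure \<mu> (Bs i) \<le> ennreal D * emeasure \<mu> (B i)"
    and vitali: "\<And>F. finite F \<Longrightarrow> \<exists>G\<subseteq>F. disjoint_family_on B G \<and> (\<Union>i\<in>F. B i) \<subseteq> (\<Union>j\<in>G. Bs j)"
begin

text \<open>Averaging over the ball \<open>B i\<close> but normalising by the enlarged ball \<open>Bs i\<close> makes the operator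
  of weak type (1,1) for every measure, doubling or not.\<close>

definition wmax :: "'a measure \<Rightarrow> ('a \<Rightarrow> ennreal) \<Rightarrow> 'a \<Rightarrow> ennreal" where
  "wmax \<nu> f x = (SUP i. indicator (B i) x * ((\<integral>\<^sup>+y\<in>B i. f y \<partial>\<nu>) / emeasure \<nu> (Bs i)))"

lemma wmax_measurable [measurable]: "sets \<nu> = sets \<mu> \<Longrightarrow> wmax \<nu> f \<in> borel_measurable \<nu>"
proof -
  assume [measurable_cong]: "sets \<nu> = sets \<mu>"
  show ?thesis unfolding wmax_def[abs_def] by measurable
qed

lemma wmax_upper: "x \<in> B i \<Longrightarrow> (\<integral>\<^sup>+y\<in>B i. f y \<partial>\<nu>) / emeasure \<nu> (Bs i) \<le> wmax \<nu> f x"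
  unfolding wmax_def by (rule SUP_upper2[of i]) auto

lemma wmax_least:
  assumes "\<And>i. x \<in> B i \<Longrightarrow> (\<integral>\<^sup>+y\<in>B i. f y \<partial>\<nu>) / emeasure \<nu> (Bs i) \<le> c"
  shows "wmax \<nu> f x \<le> c"
  unfolding wmax_def by (rule SUP_least) (use assms in \<open>auto simp: indicator_def\<close>)

text \<open>The selected balls are disjoint, their enlargements cover, and each satisfies t * nu(Bs
  j) \<le> the integral of \<open>f\<close> over \<open>B j\<close>. The normalisation by
  \<open>Bs j\<close> is exactly what the covering asks for, so the constant is 1.\<close>

lemma wmax_weak_type:
  assumes sets [measurable_cong]: "sets \<nu> = sets \<mu>" and [measurable]: "f \<in> borel_measurable \<mu>"
  shows "ennreal t * emeasure \<nu> {x \<in> space \<nu>. ennreal t < wmax \<nu> f x} \<le> (\<integral>\<^sup>+x. f x \<partial>\<nu>)"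
proof -
  define I where "I = {i. ennreal t < (\<integral>\<^sup>+y\<in>B i. f y \<partial>\<nu>) / emeasure \<nu> (Bs i)}"
  \<comment> \<open>Vitali's selection is available for finite index sets only; the level set is
    exhausted by the balls with index below \<open>n\<close>, and continuity of the measure from
    below gives the rest.\<close>
  define U where "U n = (\<Union>i\<in>I \<inter> {..<n}. B i)" for n :: nat
  have U_sets: "U n \<in> sets \<nu>" for n unfolding U_def sets by (intro sets.finite_UN) auto
  have "{x \<in> space \<nu>. ennreal t < wmax \<nu> f x} \<subseteq> (\<Union>n. U n)"
  proof
    fix x assume "x \<in> {x \<in> space \<nu>. ennreal t < wmax \<nu> f x}"
    then obtain i where "ennreal t < indicator (B i) x * ((\<integral>\<^sup>+y\<in>B i. f y \<partial>\<nu>) / emeasure \<nu> (Bs i))"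
      by (auto simp: wmax_def less_SUP_iff)
    then have "i \<in> I" "x \<in> B i" by (cases "x \<in> B i"; simp add: I_def)+
    then have "x \<in> U (Suc i)" by (auto simp: U_def)
    then show "x \<in> (\<Union>n. U n)" by blast
  qed
  then have "emeasure \<nu> {x \<in> space \<nu>. ennreal t < wmax \<nu> f x} \<le> emeasure \<nu> (\<Union>n. U n)"
    using U_sets by (intro emeasure_mono) auto
  also have "\<dots> = (SUP n. emeasure \<nu> (U n))"
    using U_sets by (intro SUP_emeasure_incseq[symmetric]) (auto simp: U_def incseq_def; fastforce)+
  finally have "ennreal t * emeasure \<nu> {x \<in> space \<nu>. ennreal t < wmax \<nu> f x}
      \<le> ennreal t * (SUP n. emeasure \<nu> (U n))"
    by (rule mult_left_mono) simp
  also have "\<dots> = (SUP n. ennreal t * emeasure \<nu> (U n))"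
    by (rule SUP_mult_left_ennreal)
  also have "\<dots> \<le> (\<integral>\<^sup>+x. f x \<partial>\<nu>)"
  proof (rule SUP_least)
    fix n
    obtain G where G: "G \<subseteq> I \<inter> {..<n}" "disjoint_family_on B G"
      "(\<Union>i\<in>I \<inter> {..<n}. B i) \<subseteq> (\<Union>j\<in>G. Bs j)"
      using vitali[of "I \<inter> {..<n}"] by auto
    have finG: "finite G" using G(1) finite_subset by blast
    have "emeasure \<nu> (U n) \<le> emeasure \<nu> (\<Union>j\<in>G. Bs j)"
      using G(3) finG unfolding U_def by (intro emeasure_mono sets.finite_UN) (auto simp: sets)
    also have "\<dots> \<le> (\<Sum>j\<in>G. emeasure \<nu> (Bs j))"
      using finG by (intro emeasure_subadditive_finite) (auto simp: sets)
    finally have "ennreal t * emeasure \<nu> (U n) \<le> (\<Sum>j\<in>G. ennreal t * emeasure \<nu> (Bs j))"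
      by (auto simp: sum_distrib_left[symmetric] intro: mult_left_mono)
    also have "\<dots> \<le> (\<Sum>j\<in>G. (\<integral>\<^sup>+y\<in>B j. f y \<partial>\<nu>))"
    proof (rule sum_mono)
      fix j assume "j \<in> G"
      then have less: "ennreal t < (\<integral>\<^sup>+y\<in>B j. f y \<partial>\<nu>) / emeasure \<nu> (Bs j)"
        using G(1) by (auto simp: I_def)
      have "ennreal t * emeasure \<nu> (Bs j) \<le> (\<integral>\<^sup>+y\<in>B j. f y \<partial>\<nu>) / emeasure \<nu> (Bs j) * emeasure \<nu> (Bs j)"
        using less by (intro mult_right_mono) auto
      also have "\<dots> \<le> (\<integral>\<^sup>+y\<in>B j. f y \<partial>\<nu>)"
        by (rule ennreal_divide_mult_le)
      finally show "ennreal t * emeasure \<nu> (Bs j) \<le> (\<integral>\<^sup>+y\<in>B j. f y \<partial>\<nu>)" .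
    qed
    also have "\<dots> = (\<integral>\<^sup>+y. (\<Sum>j\<in>G. f y * indicator (B j) y) \<partial>\<nu>)"
      by (subst nn_integral_sum) auto
    also have "\<dots> \<le> (\<integral>\<^sup>+x. f x \<partial>\<nu>)"
    proof (rule nn_integral_mono)
      fix y
      have "(\<Sum>j\<in>G. f y * indicator (B j) y) = f y * indicator (\<Union>j\<in>G. B j) y"
        using finG G(2)
        by (simp add: sum_distrib_left[symmetric] indicator_UN_disjoint)
      also have "\<dots> \<le> f y" by (auto simp: indicator_def)
      finally show "(\<Sum>j\<in>G. f y * indicator (B j) y) \<le> f y" .
    qed
    finally show "ennreal t * emeasure \<nu> (U n) \<le> (\<integral>\<^sup>+x. f x \<partial>\<nu>)" .
  qed
  finally show ?thesis .
qed

lemma wmax_add: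
  assumes [measurable_cong]: "sets \<nu> = sets \<mu>"
    and [measurable]: "f \<in> borel_measurable \<mu>" "g \<in> borel_measurable \<mu>"
  shows "wmax \<nu> (\<lambda>x. f x + g x) x \<le> wmax \<nu> f x + wmax \<nu> g x"
proof (rule wmax_least)
  fix i assume "x \<in> B i"
  then show "(\<integral>\<^sup>+y\<in>B i. (f y + g y) \<partial>\<nu>) / emeasure \<nu> (Bs i) \<le> wmax \<nu> f x + wmax \<nu> g x"
    by (simp add: distrib_right nn_integral_add add_divide_distrib_ennreal add_mono wmax_upper)
qed

lemma wmax_const_le: 
  assumes [measurable_cong]: "sets \<nu> = sets \<mu>" and "\<And>y. f y \<le> ennreal c" 
  shows "wmax \<nu> f x \<le> ennreal c"
proof (rule wmax_least)
  fix i assume "x \<in> B i"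
  have "(\<integral>\<^sup>+y\<in>B i. f y \<partial>\<nu>) \<le> (\<integral>\<^sup>+y. ennreal c * indicator (B i) y \<partial>\<nu>)"
    by (intro nn_integral_mono mult_right_mono assms) auto
  also have "\<dots> = ennreal c * emeasure \<nu> (B i)"
    by (rule nn_integral_cmult_indicator) measurable
  also have "\<dots> \<le> ennreal c * emeasure \<nu> (Bs i)"
    by (intro mult_left_mono emeasure_mono B_subset_Bs) auto
  finally show "(\<integral>\<^sup>+y\<in>B i. f y \<partial>\<nu>) / emeasure \<nu> (Bs i) \<le> ennreal c"
    by (rule order_trans[OF divide_right_mono_ennreal ennreal_mult_divide_le])
qed

text \<open>The part of \<open>f\<close> below t/2 contributes at most t/2 to the maximal function,
  so exceeding t forces the other part to exceed t/2, where the weak type bound applies. The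
  resulting constant depends on \<open>r\<close> alone, not on the measure.\<close>

lemma wmax_strong_type:
  assumes sets [measurable_cong]: "sets \<nu> = sets \<mu>" and "sigma_finite_measure \<nu>"
    and r: "r > 1" and [measurable]: "f \<in> borel_measurable \<mu>"
  shows "(\<integral>\<^sup>+x. enn_powr (wmax \<nu> f x) r \<partial>\<nu>)
    \<le> ennreal (2 powr r * r / (r - 1)) * (\<integral>\<^sup>+x. enn_powr (f x) r \<partial>\<nu>)"
proof (rule marcinkiewicz_weak_1_infinity[OF assms(2) r])
  show "f \<in> borel_measurable \<nu>" by measurable
  show "wmax \<nu> f \<in> borel_measurable \<nu>" using sets by (rule wmax_measurable)
  fix t :: real assume t: "t > 0"
  define h where "h x = f x * indicator {x. ennreal t < 2 * f x} x" for x
  have [measurable]: "h \<in> borel_measurable \<mu>" unfolding h_def by measurable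
  have split: "wmax \<nu> f x \<le> wmax \<nu> h x + ennreal (t / 2)" for x
  proof -
    define k where "k y = f y * indicator {x. \<not> ennreal t < 2 * f x} y" for y
    have [measurable]: "k \<in> borel_measurable \<mu>" unfolding k_def by measurable
    have "wmax \<nu> f x = wmax \<nu> (\<lambda>x. h x + k x) x"
      by (rule arg_cong[of _ _ "\<lambda>g. wmax \<nu> g x"]) (auto simp: h_def k_def indicator_def fun_eq_iff)
    also have "\<dots> \<le> wmax \<nu> h x + wmax \<nu> k x"
      by (rule wmax_add[OF sets]) measurable
    also have "wmax \<nu> k x \<le> ennreal (t / 2)"
    proof (rule wmax_const_le[OF sets])
      fix y
      show "k y \<le> ennreal (t / 2)"
      proof (cases "ennreal t < 2 * f y")
        case False
        then have le: "2 * f y \<le> ennreal t" by simp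
        then obtain c where c: "f y = ennreal c" "c \<ge> 0"
          by (cases "f y") (auto simp: ennreal_mult_top top_unique)
        have "2 * f y = ennreal (2 * c)" using c by (simp add: ennreal_mult)
        then have "2 * c \<le> t" using le t by (simp add: ennreal_le_iff)
        then show ?thesis using c False by (auto simp: k_def intro!: ennreal_leI)
      qed (simp add: k_def)
    qed
    finally show ?thesis by (simp add: add_left_mono)
  qed
  have "{x \<in> space \<nu>. ennreal t < wmax \<nu> f x} \<subseteq> {x \<in> space \<nu>. ennreal (t / 2) < wmax \<nu> h x}"
  proof safe
    fix x assume "ennreal t < wmax \<nu> f x"
    then have *: "ennreal (t / 2) + ennreal (t / 2) < wmax \<nu> h x + ennreal (t / 2)"
      using split[of x] t by (simp flip: ennreal_plus)
    show "ennreal (t / 2) < wmax \<nu> h x"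
    proof (rule ccontr)
      assume "\<not> ?thesis"
      then have "wmax \<nu> h x + ennreal (t / 2) \<le> ennreal (t / 2) + ennreal (t / 2)"
        by (intro add_right_mono) simp
      with * show False by simp
    qed
  qed
  then have "emeasure \<nu> {x \<in> space \<nu>. ennreal t < wmax \<nu> f x} \<le> emeasure \<nu> {x \<in> space \<nu>. ennreal (t / 2) < wmax \<nu> h x}"
    by (intro emeasure_mono) (use wmax_measurable[OF sets, of h] in measurable)
  then have "ennreal t * emeasure \<nu> {x \<in> space \<nu>. ennreal t < wmax \<nu> f x}
    \<le> ennreal (2 * (t / 2)) * emeasure \<nu> {x \<in> space \<nu>. ennreal (t / 2) < wmax \<nu> h x}"
    by (simp add: mult_left_mono)
  also have "\<dots> = 2 * (ennreal (t / 2) * emeasure \<nu> {x \<in> space \<nu>. ennreal (t / 2) < wmax \<nu> h x})"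
    using t by (subst ennreal_mult) (auto simp: mult.assoc)
  also have "\<dots> \<le> 2 * (\<integral>\<^sup>+x. h x \<partial>\<nu>)"
    by (intro mult_left_mono wmax_weak_type sets) auto
  finally show "ennreal t * emeasure \<nu> {x \<in> space \<nu>. ennreal t < wmax \<nu> f x}
      \<le> 2 * (\<integral>\<^sup>+x. f x * indicator {x. ennreal t < 2 * f x} x \<partial>\<nu>)"
    by (simp add: h_def)
qed

end

lemma ennreal_cancel_inverse: "c > 0 \<Longrightarrow> ennreal c * (x * ennreal (1 / c)) = x"
proof -
  assume "c > 0"
  then have "ennreal c * ennreal (1 / c) = 1" by (simp flip: ennreal_mult)
  then show ?thesis by (metis mult.commute mult.left_commute mult_1_right)
qed

lemma set_nn_integral_pos:
  assumes [measurable]: "v \<in> borel_measurable M" "S \<in> sets M" and "\<And>x. v x > (0 :: real)" "emeasure M S > 0"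
  shows "0 < (\<integral>\<^sup>+x\<in>S. ennreal (v x) \<partial>M)"
proof (rule ccontr)
  have nz: "ennreal (v x) \<noteq> 0" for x using assms(3)[of x] by (simp add: ennreal_eq_0_iff)
  assume "\<not> ?thesis"
  then have "AE x in M. ennreal (v x) * indicator S x = 0"
    by (subst nn_integral_0_iff_AE[symmetric]) auto
  then have "AE x in M. x \<notin> S"
    by (rule AE_mp) (use nz in \<open>auto simp: indicator_def\<close>)
  then have "emeasure M S = 0"
    by (subst (asm) AE_iff_measurable[of S]) (use sets.sets_into_space[OF assms(2)] in auto)
  then show False using assms(4) by simp
qed

section \<open>Lerner's domination, Buckley's bound and Rubio de Francia's iteration\<close>

context ball_family
begin

text \<open>Normalised by \<open>B i\<close> itself, unlike \<open>wmax\<close>: these are genuine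
  averages for the underlying measure, and this is the operator that gets iterated.\<close>

definition cmax :: "('a \<Rightarrow> ennreal) \<Rightarrow> 'a \<Rightarrow> ennreal" where
  "cmax f x = (SUP i. indicator (B i) x * ((\<integral>\<^sup>+y\<in>B i. f y \<partial>\<mu>) / emeasure \<mu> (B i)))"

lemma cmax_measurable [measurable]: "cmax f \<in> borel_measurable \<mu>"
  unfolding cmax_def[abs_def] by measurable

lemma cmax_upper: "x \<in> B i \<Longrightarrow> (\<integral>\<^sup>+y\<in>B i. f y \<partial>\<mu>) / emeasure \<mu> (B i) \<le> cmax f x"
  unfolding cmax_def by (rule SUP_upper2[of i]) auto

lemma cmax_least:
  assumes "\<And>i. x \<in> B i \<Longrightarrow> (\<integral>\<^sup>+y\<in>B i. f y \<partial>\<mu>) / emeasure \<mu> (B i) \<le> c"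
  shows "cmax f x \<le> c"
  unfolding cmax_def
proof (rule SUP_least)
  fix i
  show "indicator (B i) x * ((\<integral>\<^sup>+y\<in>B i. f y \<partial>\<mu>) / emeasure \<mu> (B i)) \<le> c"
    using assms[of i] by (cases "x \<in> B i") auto
qed

text \<open>The A_r condition multiplied out by measures, so that no averages occur. It is imposed
  on the enlarged balls because \<open>wmax\<close> normalises by them.\<close>

definition muckenhoupt_bound :: "('a \<Rightarrow> real) \<Rightarrow> real \<Rightarrow> real \<Rightarrow> bool" where
  "muckenhoupt_bound v r A \<longleftrightarrow> v \<in> borel_measurable \<mu> \<and> (\<forall>x. v x > 0) \<and>
     (\<forall>i. (\<integral>\<^sup>+x\<in>Bs i. ennreal (v x) \<partial>\<mu>) < \<infinity> \<and>
        (\<integral>\<^sup>+x\<in>Bs i. ennreal (v x powr (- 1 / (r - 1))) \<partial>\<mu>) < \<infinity> \<and>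
        (\<integral>\<^sup>+x\<in>Bs i. ennreal (v x) \<partial>\<mu>) *
          enn_powr (\<integral>\<^sup>+x\<in>Bs i. ennreal (v x powr (- 1 / (r - 1))) \<partial>\<mu>) (r - 1)
        \<le> ennreal A * enn_powr (emeasure \<mu> (Bs i)) r)"

lemma Bs_pos: "0 < emeasure \<mu> (Bs i)"
  using B_pos[of i] emeasure_mono[OF B_subset_Bs Bs_sets, of i] by (rule less_le_trans)

text \<open>Lerner's domination: since the weighted operators are bounded with constants independent of
  the weight, it carries the whole dependence on \<open>A\<close>.\<close>

lemma cmax_le_wmax_wmax:
  assumes v: "muckenhoupt_bound v r A" and r: "r > 1" and A: "A > 0"
    and [measurable]: "f \<in> borel_measurable \<mu>"
  defines "\<sigma> \<equiv> (\<lambda>x. v x powr (- 1 / (r - 1)))"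
  defines "h \<equiv> (\<lambda>x. enn_powr (wmax (density \<mu> \<sigma>) (\<lambda>y. f y * ennreal (1 / \<sigma> y)) x) (r - 1))"
  shows "enn_powr (cmax f x) (r - 1) \<le>
    ennreal (A * D powr r) * wmax (density \<mu> v) (\<lambda>y. h y * ennreal (1 / v y)) x"
proof -
  have [measurable]: "v \<in> borel_measurable \<mu>" and v_pos: "\<And>x. v x > 0"
    using v by (auto simp: muckenhoupt_bound_def)
  have [measurable]: "\<sigma> \<in> borel_measurable \<mu>" unfolding \<sigma>_def by measurable
  have \<sigma>_pos: "\<sigma> x > 0" for x using v_pos[of x] by (simp add: \<sigma>_def)
  have [measurable]: "h \<in> borel_measurable \<mu>"
    unfolding h_def using wmax_measurable[of "density \<mu> \<sigma>"] by measurable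
  let ?R = "ennreal (A * D powr r) * wmax (density \<mu> v) (\<lambda>y. h y * ennreal (1 / v y)) x"
  have "cmax f x \<le> enn_powr ?R (1 / (r - 1))"
  proof (rule cmax_least)
    fix i assume x: "x \<in> B i"
    define a where "a = (\<integral>\<^sup>+y\<in>B i. f y \<partial>\<mu>)"
    have fin: "(\<integral>\<^sup>+x\<in>Bs i. ennreal (v x) \<partial>\<mu>) < \<infinity>" "(\<integral>\<^sup>+x\<in>Bs i. ennreal (\<sigma> x) \<partial>\<mu>) < \<infinity>"
      and bound: "(\<integral>\<^sup>+x\<in>Bs i. ennreal (v x) \<partial>\<mu>) * enn_powr (\<integral>\<^sup>+x\<in>Bs i. ennreal (\<sigma> x) \<partial>\<mu>) (r - 1)
        \<le> ennreal A * enn_powr (emeasure \<mu> (Bs i)) r"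
      using v unfolding muckenhoupt_bound_def \<sigma>_def by blast+
    obtain V where V: "(\<integral>\<^sup>+x\<in>Bs i. ennreal (v x) \<partial>\<mu>) = ennreal V" "V > 0"
      using fin(1) set_nn_integral_pos[of v \<mu> "Bs i"] v_pos Bs_pos
      by (cases "\<integral>\<^sup>+x\<in>Bs i. ennreal (v x) \<partial>\<mu>") auto
    obtain S where S: "(\<integral>\<^sup>+x\<in>Bs i. ennreal (\<sigma> x) \<partial>\<mu>) = ennreal S" "S > 0"
      using fin(2) set_nn_integral_pos[of \<sigma> \<mu> "Bs i"] \<sigma>_pos Bs_pos
      by (cases "\<integral>\<^sup>+x\<in>Bs i. ennreal (\<sigma> x) \<partial>\<mu>") auto
    obtain ms where ms: "emeasure \<mu> (Bs i) = ennreal ms" "ms > 0"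
      using Bs_pos[of i] Bs_finite[of i] by (cases "emeasure \<mu> (Bs i)") auto
    obtain m where m: "emeasure \<mu> (B i) = ennreal m" "m > 0"
      using B_pos[of i] Bs_finite[of i] emeasure_mono[OF B_subset_Bs Bs_sets, of i]
      by (cases "emeasure \<mu> (B i)") (auto simp: top_unique)
    \<comment> \<open>Here the passage from \<open>Bs i\<close> back to \<open>B i\<close> is paid
      for; it is the source of the factor \<open>D powr r\<close>.\<close>
    have msm: "ms \<le> D * m"
      using doubling[of i] ms m D_pos by (simp flip: ennreal_mult)
    have "ennreal (V * S powr (r - 1)) \<le> ennreal (A * ms powr r)"
      using bound V S ms A by (simp add: ennreal_mult)
    then have VS: "V * S powr (r - 1) \<le> A * ms powr r"
      using A by (subst (asm) ennreal_le_iff) auto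
    also have "\<dots> \<le> A * (D powr r * m powr r)"
      using A msm ms m r D_pos by (simp flip: powr_mult add: powr_mono2)
    finally have VS: "V * S powr (r - 1) \<le> A * (D powr r * m powr r)" .
    have a_eq: "a = (\<integral>\<^sup>+y\<in>B i. (f y * ennreal (1 / \<sigma> y)) \<partial>density \<mu> \<sigma>)"
      unfolding a_def
      by (subst nn_integral_density)
        (simp_all add: mult.assoc[symmetric, of "ennreal _" "_ * ennreal _"] \<sigma>_pos ennreal_cancel_inverse)
    have emS: "emeasure (density \<mu> \<sigma>) (Bs i) = ennreal S" and emV: "emeasure (density \<mu> v) (Bs i) = ennreal V"
      using S V by (simp_all add: emeasure_density)
    \<comment> \<open>On the whole of \<open>B i\<close> the inner maximal function is at least a/S,
      because x and y lie in the same ball. Hence \<open>h\<close> has an explicit lower bound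
      there, and dividing its integral over \<open>B i\<close> by V gives a term of the outer
      maximal function.\<close>
    have h_ge: "enn_powr (a / ennreal S) (r - 1) \<le> h y" if "y \<in> B i" for y
      unfolding h_def using r wmax_upper[OF that, of "density \<mu> \<sigma>" "\<lambda>y. f y * ennreal (1 / \<sigma> y)"]
      by (intro enn_powr_mono) (auto simp: a_eq emS)
    have "enn_powr (a / ennreal S) (r - 1) * ennreal m = (\<integral>\<^sup>+y\<in>B i. enn_powr (a / ennreal S) (r - 1) \<partial>\<mu>)"
      by (simp add: nn_integral_cmult_indicator m)
    also have "\<dots> \<le> (\<integral>\<^sup>+y\<in>B i. h y \<partial>\<mu>)"
      by (intro nn_integral_mono) (auto simp: indicator_def h_ge)
    also have "\<dots> = (\<integral>\<^sup>+y\<in>B i. (h y * ennreal (1 / v y)) \<partial>density \<mu> v)"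
      by (subst nn_integral_density)
        (simp_all add: mult.assoc[symmetric, of "ennreal _" "_ * ennreal _"] v_pos ennreal_cancel_inverse)
    finally have "enn_powr (a / ennreal S) (r - 1) * ennreal m / ennreal V
      \<le> (\<integral>\<^sup>+y\<in>B i. (h y * ennreal (1 / v y)) \<partial>density \<mu> v) / ennreal V"
      by (rule divide_right_mono_ennreal)
    also have "\<dots> \<le> wmax (density \<mu> v) (\<lambda>y. h y * ennreal (1 / v y)) x"
      using wmax_upper[OF x] by (simp add: emV[symmetric])
    finally have le: "ennreal (A * D powr r) * (enn_powr (a / ennreal S) (r - 1) * ennreal m / ennreal V) \<le> ?R"
      by (rule mult_left_mono) simp
    have "enn_powr (a / ennreal m) (r - 1) \<le> ?R"
    proof (cases a)
      case (real a')
      \<comment> \<open>Exchanges the normalisation by the measure for the one by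
        \<open>\<sigma>\<close>; the quotient produced is the A_r quantity bounded in
        \<open>VS\<close>.\<close>
      have "(a' / m) powr (r - 1) = (a' / S) powr (r - 1) * (V * S powr (r - 1)) / (V * m powr (r - 1))"
        using real S V m by (simp add: powr_divide)
      also have "\<dots> \<le> (a' / S) powr (r - 1) * (A * (D powr r * m powr r)) / (V * m powr (r - 1))"
        using V m by (intro divide_right_mono mult_left_mono VS) auto
      also have "\<dots> = A * D powr r * ((a' / S) powr (r - 1) * m / V)"
        using m V by (simp add: powr_diff field_simps)
      finally have "ennreal ((a' / m) powr (r - 1)) \<le> ennreal (A * D powr r * ((a' / S) powr (r - 1) * m / V))"
        by (rule ennreal_leI)
      also have "\<dots> = ennreal (A * D powr r) * (enn_powr (a / ennreal S) (r - 1) * ennreal m / ennreal V)"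
        using real S V m A by (simp add: ennreal_mult divide_ennreal flip: ennreal_mult)
      finally show ?thesis using le real m by (simp add: divide_ennreal)
    next
      case top
      have "ennreal (A * D powr r) * (enn_powr (a / ennreal S) (r - 1) * ennreal m / ennreal V) = top"
        using top A D_pos m by (simp add: ennreal_top_divide ennreal_top_mult ennreal_mult_top)
      then show ?thesis using le by (simp add: top_unique)
    qed
    then show "(\<integral>\<^sup>+y\<in>B i. f y \<partial>\<mu>) / emeasure \<mu> (B i) \<le> enn_powr ?R (1 / (r - 1))"
      using r by (simp add: enn_powr_le_iff a_def m)
  qed
  then show ?thesis using r by (simp add: enn_powr_le_iff)
qed

text \<open>With s = r', the three factors come from doubling in the domination, from the outer
  operator on L^s(v), and from the inner operator on L^r of the dual weight.\<close>

definition buckley_const :: "real \<Rightarrow> real" where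
  "buckley_const r = (let s = r / (r - 1) in
     D powr (r * s) * (2 powr s * s / (s - 1)) * (2 powr r * r / (r - 1)))"

lemma buckley_const_pos: "r > 1 \<Longrightarrow> buckley_const r > 0"
proof -
  assume r: "r > 1"
  then have "r / (r - 1) > 1" by (simp add: field_simps)
  then show ?thesis using r D_pos by (auto simp: buckley_const_def Let_def intro!: mult_pos_pos divide_pos_pos)
qed

text \<open>The domination is raised to the power s = r'. The outer operator is removed in L^s(v);
  since (r - 1) s = r, what is left is the inner operator in L^r of the dual weight. The power
  r/(r-1) of \<open>A\<close> concerns r-th powers of norms, so the operator norm grows like
  A^(1/(r-1)).\<close>

theorem buckley:
  assumes v: "muckenhoupt_bound v r A" and r: "r > 1" and A: "A > 0"
    and [measurable]: "f \<in> borel_measurable \<mu>"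
  shows "(\<integral>\<^sup>+x. enn_powr (cmax f x) r * ennreal (v x) \<partial>\<mu>)
    \<le> ennreal (buckley_const r * A powr (r / (r - 1))) * (\<integral>\<^sup>+x. enn_powr (f x) r * ennreal (v x) \<partial>\<mu>)"
proof -
  interpret sigma_finite_measure \<mu> by (rule sigma_finite)
  define s where "s = r / (r - 1)"
  have s: "s > 1" and rs: "(r - 1) * s = r" "s / r = 1 / (r - 1)" using r by (auto simp: s_def field_simps)
  define \<sigma> where "\<sigma> x = v x powr (- 1 / (r - 1))" for x
  define h where "h x = enn_powr (wmax (density \<mu> \<sigma>) (\<lambda>y. f y * ennreal (1 / \<sigma> y)) x) (r - 1)" for x
  have [measurable]: "v \<in> borel_measurable \<mu>" and v_pos: "\<And>x. v x > 0"
    using v by (auto simp: muckenhoupt_bound_def)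
  have [measurable]: "\<sigma> \<in> borel_measurable \<mu>" unfolding \<sigma>_def by measurable
  have \<sigma>_pos: "\<sigma> x > 0" for x using v_pos[of x] by (simp add: \<sigma>_def)
  have wm [measurable]: "wmax (density \<mu> \<sigma>) g \<in> borel_measurable \<mu>" "wmax (density \<mu> v) g \<in> borel_measurable \<mu>" for g
    using wmax_measurable[of "density \<mu> \<sigma>" g] wmax_measurable[of "density \<mu> v" g] by simp_all
  have [measurable]: "h \<in> borel_measurable \<mu>"
    unfolding h_def by measurable
  have sf: "sigma_finite_measure (density \<mu> \<sigma>)" "sigma_finite_measure (density \<mu> v)"
    by (subst sigma_finite_iff_density_finite; simp)+
  have pw: "enn_powr (cmax f x) r \<le> ennreal ((A * D powr r) powr s) *
      enn_powr (wmax (density \<mu> v) (\<lambda>y. h y * ennreal (1 / v y)) x) s" for x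
  proof -
    have "enn_powr (cmax f x) r = enn_powr (enn_powr (cmax f x) (r - 1)) s"
      using r rs by (subst enn_powr_powr) auto
    also have "\<dots> \<le> enn_powr (ennreal (A * D powr r) * wmax (density \<mu> v) (\<lambda>y. h y * ennreal (1 / v y)) x) s"
      using cmax_le_wmax_wmax[OF v r A, of f x] s
      by (intro enn_powr_mono) (auto simp: h_def[abs_def] \<sigma>_def[abs_def])
    also have "\<dots> = ennreal ((A * D powr r) powr s) *
      enn_powr (wmax (density \<mu> v) (\<lambda>y. h y * ennreal (1 / v y)) x) s"
      using s A by (simp add: enn_powr_mult)
    finally show ?thesis .
  qed
  have "(\<integral>\<^sup>+x. enn_powr (cmax f x) r * ennreal (v x) \<partial>\<mu>)
    \<le> (\<integral>\<^sup>+x. ennreal ((A * D powr r) powr s) * (ennreal (v x) *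
      enn_powr (wmax (density \<mu> v) (\<lambda>y. h y * ennreal (1 / v y)) x) s) \<partial>\<mu>)"
  proof (rule nn_integral_mono)
    fix x
    show "enn_powr (cmax f x) r * ennreal (v x) \<le> ennreal ((A * D powr r) powr s) * (ennreal (v x) *
      enn_powr (wmax (density \<mu> v) (\<lambda>y. h y * ennreal (1 / v y)) x) s)"
      using mult_right_mono[OF pw[of x], of "ennreal (v x)"] by (simp add: mult_ac)
  qed
  also have "\<dots> = ennreal ((A * D powr r) powr s) *
      (\<integral>\<^sup>+x. enn_powr (wmax (density \<mu> v) (\<lambda>y. h y * ennreal (1 / v y)) x) s \<partial>density \<mu> v)"
    by (simp add: nn_integral_cmult nn_integral_density)
  also have "\<dots> \<le> ennreal ((A * D powr r) powr s) * (ennreal (2 powr s * s / (s - 1)) *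
      (\<integral>\<^sup>+x. enn_powr (h x * ennreal (1 / v x)) s \<partial>density \<mu> v))"
    by (intro mult_left_mono wmax_strong_type sf s) auto
  finally have outer: "(\<integral>\<^sup>+x. enn_powr (cmax f x) r * ennreal (v x) \<partial>\<mu>) \<le>
    ennreal ((A * D powr r) powr s) * (ennreal (2 powr s * s / (s - 1)) *
      (\<integral>\<^sup>+x. enn_powr (h x * ennreal (1 / v x)) s \<partial>density \<mu> v))" .
  have "(\<integral>\<^sup>+x. enn_powr (h x * ennreal (1 / v x)) s \<partial>density \<mu> v)
    = (\<integral>\<^sup>+x. enn_powr (wmax (density \<mu> \<sigma>) (\<lambda>y. f y * ennreal (1 / \<sigma> y)) x) r \<partial>density \<mu> \<sigma>)"
  proof -
    \<comment> \<open>Removing the factor 1/v inside the s-th power turns the density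
      \<open>v\<close> into the dual weight; the identity further down turns \<open>\<sigma>\<close>
      back into \<open>v\<close> in the same way.\<close>
    have "v x * (1 / v x) powr s = \<sigma> x" for x
    proof -
      have "v x * (1 / v x) powr s = v x powr 1 * v x powr (- s)"
        using v_pos[of x] by (simp add: powr_divide powr_minus field_simps)
      also have "\<dots> = v x powr (1 + - s)" by (rule powr_add[symmetric])
      also have "1 + - s = - 1 / (r - 1)" using r by (simp add: s_def field_simps)
      finally show ?thesis by (simp add: \<sigma>_def)
    qed
    then have "ennreal (v x) * enn_powr (h x * ennreal (1 / v x)) s
      = ennreal (\<sigma> x) * enn_powr (wmax (density \<mu> \<sigma>) (\<lambda>y. f y * ennreal (1 / \<sigma> y)) x) r" for x
      using s r rs v_pos[of x]
      by (simp add: enn_powr_mult h_def enn_powr_powr mult_ac ennreal_mult[symmetric] less_imp_le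
          flip: mult.assoc[of "ennreal (v x)" "ennreal ((1 / v x) powr s)"])
    then show ?thesis by (simp add: nn_integral_density)
  qed
  also have "\<dots> \<le> ennreal (2 powr r * r / (r - 1)) *
      (\<integral>\<^sup>+x. enn_powr (f x * ennreal (1 / \<sigma> x)) r \<partial>density \<mu> \<sigma>)"
    by (intro wmax_strong_type sf r) auto
  also have "(\<integral>\<^sup>+x. enn_powr (f x * ennreal (1 / \<sigma> x)) r \<partial>density \<mu> \<sigma>) = (\<integral>\<^sup>+x. enn_powr (f x) r * ennreal (v x) \<partial>\<mu>)"
  proof -
    have "\<sigma> x * (1 / \<sigma> x) powr r = v x" for x
    proof -
      have "\<sigma> x * (1 / \<sigma> x) powr r = \<sigma> x powr 1 * \<sigma> x powr (- r)"
        using \<sigma>_pos[of x] by (simp add: powr_divide powr_minus field_simps)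
      also have "\<dots> = \<sigma> x powr (1 + - r)" by (rule powr_add[symmetric])
      also have "\<dots> = v x powr 1" unfolding \<sigma>_def powr_powr 
        by (rule arg_cong[of _ _ "\<lambda>e. v x powr e"]) (use r in \<open>simp add: field_simps\<close>)
      finally show ?thesis using v_pos[of x] by simp
    qed
    then have eq: "ennreal (\<sigma> x) * ennreal ((1 / \<sigma> x) powr r) = ennreal (v x)" for x
      using \<sigma>_pos[of x] by (subst ennreal_mult[symmetric]) auto
    have "ennreal (\<sigma> x) * enn_powr (f x * ennreal (1 / \<sigma> x)) r = enn_powr (f x) r * ennreal (v x)" for x
    proof -
      have "ennreal (\<sigma> x) * enn_powr (f x * ennreal (1 / \<sigma> x)) r
        = enn_powr (f x) r * (ennreal (\<sigma> x) * ennreal ((1 / \<sigma> x) powr r))"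
        using r \<sigma>_pos[of x] by (simp add: enn_powr_mult mult_ac)
      then show ?thesis unfolding eq .
    qed
    then show ?thesis by (simp add: nn_integral_density)
  qed
  finally have "ennreal ((A * D powr r) powr s) * (ennreal (2 powr s * s / (s - 1)) *
      (\<integral>\<^sup>+x. enn_powr (h x * ennreal (1 / v x)) s \<partial>density \<mu> v))
    \<le> ennreal ((A * D powr r) powr s) * (ennreal (2 powr s * s / (s - 1)) *
      (ennreal (2 powr r * r / (r - 1)) * (\<integral>\<^sup>+x. enn_powr (f x) r * ennreal (v x) \<partial>\<mu>)))"
    by (intro mult_left_mono) auto
  also have "ennreal ((A * D powr r) powr s) * (ennreal (2 powr s * s / (s - 1)) *
      (ennreal (2 powr r * r / (r - 1)) * (\<integral>\<^sup>+x. enn_powr (f x) r * ennreal (v x) \<partial>\<mu>)))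
    = ennreal (buckley_const r * A powr s) * (\<integral>\<^sup>+x. enn_powr (f x) r * ennreal (v x) \<partial>\<mu>)"
  proof -
    have "buckley_const r * A powr s = (A * D powr r) powr s * ((2 powr s * s / (s - 1)) * (2 powr r * r / (r - 1)))"
      using A by (simp add: buckley_const_def Let_def s_def[symmetric] powr_mult powr_powr)
    moreover have "ennreal (a * (b * c)) = ennreal a * (ennreal b * ennreal c)" if "a \<ge> 0" "b \<ge> 0" "c \<ge> 0" for a b c
      using that by (simp add: ennreal_mult)
    ultimately show ?thesis using s r by (simp add: mult.assoc del: times_divide_eq_right times_divide_eq_left)
  qed
  finally show ?thesis unfolding s_def by (rule order_trans[OF outer[unfolded s_def]])
qed

text \<open>The Rubio de Francia iteration \<open>\<Sum>\<^sub>k (4N)\<^sup>-\<^sup>k M\<^sup>k h\<close>. Dominating it by twice the supremum of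
  \<open>(2N)\<^sup>-\<^sup>k M\<^sup>k h\<close> bounds its norm without Minkowski's inequality.\<close>

theorem rubio_de_francia:
  assumes [measurable]: "v \<in> borel_measurable \<mu>" "h \<in> borel_measurable \<mu>"
    and r: "r \<ge> 1" and N: "N > 0"
    and bound: "\<And>f. f \<in> borel_measurable \<mu> \<Longrightarrow>
      (\<integral>\<^sup>+x. enn_powr (cmax f x) r * v x \<partial>\<mu>) \<le> ennreal (N powr r) * (\<integral>\<^sup>+x. enn_powr (f x) r * v x \<partial>\<mu>)"
  obtains G where "G \<in> borel_measurable \<mu>" "\<And>x. h x \<le> G x"
    "\<And>x. cmax G x \<le> ennreal (4 * N) * G x"
    "(\<integral>\<^sup>+x. enn_powr (G x) r * v x \<partial>\<mu>) \<le> ennreal (2 powr (r + 1)) * (\<integral>\<^sup>+x. enn_powr (h x) r * v x \<partial>\<mu>)"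
proof -
  define it where "it k = (cmax ^^ k) h" for k
  have it_Suc: "it (Suc k) = cmax (it k)" and it_0: "it 0 = h" for k by (simp_all add: it_def)
  have [measurable]: "it k \<in> borel_measurable \<mu>" for k by (induction k) (simp_all add: it_Suc it_0)
  define H where "H = (\<integral>\<^sup>+x. enn_powr (h x) r * v x \<partial>\<mu>)"
  define G where "G x = (\<Sum>k. ennreal ((1 / (4 * N)) ^ k) * it k x)" for x
  define S where "S x = (SUP k. ennreal ((1 / (2 * N)) ^ k) * it k x)" for x
  have [measurable]: "G \<in> borel_measurable \<mu>" "S \<in> borel_measurable \<mu>"
    unfolding G_def S_def by measurable
  have it_norm: "(\<integral>\<^sup>+x. enn_powr (it k x) r * v x \<partial>\<mu>) \<le> ennreal ((N powr r) ^ k) * H" for k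
  proof (induction k)
    case 0 then show ?case by (simp add: it_0 H_def)
  next
    case (Suc k)
    have "(\<integral>\<^sup>+x. enn_powr (it (Suc k) x) r * v x \<partial>\<mu>) \<le> ennreal (N powr r) * (\<integral>\<^sup>+x. enn_powr (it k x) r * v x \<partial>\<mu>)"
      unfolding it_Suc by (rule bound) measurable
    also have "\<dots> \<le> ennreal (N powr r) * (ennreal ((N powr r) ^ k) * H)"
      by (intro mult_left_mono Suc) simp
    finally show ?case by (simp add: ennreal_mult mult.assoc)
  qed
  have h_le: "h x \<le> G x" for x
  proof -
    have "h x = (\<Sum>k\<in>{0}. ennreal ((1 / (4 * N)) ^ k) * it k x)" by (simp add: it_0)
    also have "\<dots> \<le> G x" unfolding G_def by (rule sum_le_suminf) auto
    finally show ?thesis .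
  qed
  have G_max: "cmax G x \<le> ennreal (4 * N) * G x" for x
  proof (rule cmax_least)
    fix i assume x: "x \<in> B i"
    have "(\<integral>\<^sup>+y\<in>B i. G y \<partial>\<mu>) = (\<integral>\<^sup>+y. (\<Sum>k. ennreal ((1 / (4 * N)) ^ k) * (it k y * indicator (B i) y)) \<partial>\<mu>)"
      unfolding G_def by (subst ennreal_suminf_multc[symmetric]) (simp add: mult.assoc)
    also have "\<dots> = (\<Sum>k. ennreal ((1 / (4 * N)) ^ k) * (\<integral>\<^sup>+y\<in>B i. it k y \<partial>\<mu>))"
      by (subst nn_integral_suminf) (auto simp: nn_integral_cmult)
    finally have "(\<integral>\<^sup>+y\<in>B i. G y \<partial>\<mu>) / emeasure \<mu> (B i) =
      (\<Sum>k. ennreal ((1 / (4 * N)) ^ k) * ((\<integral>\<^sup>+y\<in>B i. it k y \<partial>\<mu>) / emeasure \<mu> (B i)))"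
      by (simp add: divide_ennreal_def mult.assoc flip: ennreal_suminf_multc)
    also have "\<dots> \<le> (\<Sum>k. ennreal (4 * N) * (ennreal ((1 / (4 * N)) ^ Suc k) * it (Suc k) x))"
    proof (intro suminf_le)
      fix k
      \<comment> \<open>Averaging the k-th term yields the iterate of index k + 1; adjusting its
        coefficient costs the factor 4 N, which becomes the A_1 constant.\<close>
      have "(1 / (4 * N)) ^ k = 4 * N * (1 / (4 * N)) ^ Suc k" using N by simp
      then have "ennreal ((1 / (4 * N)) ^ k) = ennreal (4 * N) * ennreal ((1 / (4 * N)) ^ Suc k)"
        using N by (simp flip: ennreal_mult)
      then show "ennreal ((1 / (4 * N)) ^ k) * ((\<integral>\<^sup>+y\<in>B i. it k y \<partial>\<mu>) / emeasure \<mu> (B i))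
        \<le> ennreal (4 * N) * (ennreal ((1 / (4 * N)) ^ Suc k) * it (Suc k) x)"
        using cmax_upper[OF x] by (simp only: it_Suc mult.assoc) (intro mult_left_mono, auto)
    qed auto
    also have "\<dots> = ennreal (4 * N) * (\<Sum>k. ennreal ((1 / (4 * N)) ^ Suc k) * it (Suc k) x)"
      by (rule ennreal_suminf_cmult)
    also have "\<dots> \<le> ennreal (4 * N) * G x"
    proof (rule mult_left_mono)
      have eq: "G x = (\<Sum>k. ennreal ((1 / (4 * N)) ^ (k + 1)) * it (k + 1) x)
          + (\<Sum>k<1. ennreal ((1 / (4 * N)) ^ k) * it k x)"
        unfolding G_def by (rule suminf_offset) (rule summableI)
      show "(\<Sum>k. ennreal ((1 / (4 * N)) ^ Suc k) * it (Suc k) x) \<le> G x"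
        unfolding Suc_eq_plus1 eq by (rule add_increasing2) simp_all
    qed simp
    finally show "(\<integral>\<^sup>+y\<in>B i. G y \<partial>\<mu>) / emeasure \<mu> (B i) \<le> ennreal (4 * N) * G x" .
  qed
  have half: "(\<Sum>k. ennreal ((1 / 2) ^ k)) = 2"
  proof -
    have "(\<lambda>k. (1 / 2 :: real) ^ k) sums (1 / (1 - 1 / 2))" by (rule geometric_sums) simp
    then have "(\<Sum>k. ennreal ((1 / 2) ^ k)) = ennreal (1 / (1 - 1 / 2))"
      by (rule suminf_ennreal_eq[rotated]) simp
    then show ?thesis by simp
  qed
  have G_le: "G x \<le> 2 * S x" for x
  proof -
    have "G x \<le> (\<Sum>k. ennreal ((1 / 2) ^ k) * S x)"
      unfolding G_def
    proof (intro suminf_le)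
      fix k
      \<comment> \<open>Half of the decay is kept as a summable factor 2^(-k), the other half goes
        into the supremum \<open>S\<close>.\<close>
      have "ennreal ((1 / (4 * N)) ^ k) = ennreal ((1 / 2) ^ k) * ennreal ((1 / (2 * N)) ^ k)"
        using N by (subst ennreal_mult[symmetric]) (auto simp flip: power_mult_distrib)
      moreover have "ennreal ((1 / (2 * N)) ^ k) * it k x \<le> S x" unfolding S_def by (rule SUP_upper) simp
      ultimately show "ennreal ((1 / (4 * N)) ^ k) * it k x \<le> ennreal ((1 / 2) ^ k) * S x"
        by (simp add: mult.assoc mult_left_mono)
    qed auto
    then show ?thesis by (simp add: half)
  qed
  \<comment> \<open>For a supremum the r-th power is at most the sum of the r-th powers, so the
    iterates can be integrated one at a time.\<close>
  have S_pw: "enn_powr (S x) r \<le> (\<Sum>k. enn_powr (ennreal ((1 / (2 * N)) ^ k) * it k x) r)" for x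
  proof -
    have "S x \<le> enn_powr (\<Sum>k. enn_powr (ennreal ((1 / (2 * N)) ^ k) * it k x) r) (1 / r)"
      unfolding S_def
    proof (rule SUP_least)
      fix k
      have "(\<Sum>k\<in>{k}. enn_powr (ennreal ((1 / (2 * N)) ^ k) * it k x) r)
        \<le> (\<Sum>k. enn_powr (ennreal ((1 / (2 * N)) ^ k) * it k x) r)"
        by (rule sum_le_suminf) auto
      then show "ennreal ((1 / (2 * N)) ^ k) * it k x \<le>
        enn_powr (\<Sum>k. enn_powr (ennreal ((1 / (2 * N)) ^ k) * it k x) r) (1 / r)"
        using r by (subst enn_powr_le_iff[symmetric]) auto
    qed
    then show ?thesis using r by (subst enn_powr_le_iff) auto
  qed
  have S_norm: "(\<integral>\<^sup>+x. enn_powr (S x) r * v x \<partial>\<mu>) \<le> 2 * H"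
  proof -
    have "(\<integral>\<^sup>+x. enn_powr (S x) r * v x \<partial>\<mu>)
      \<le> (\<integral>\<^sup>+x. (\<Sum>k. enn_powr (ennreal ((1 / (2 * N)) ^ k) * it k x) r * v x) \<partial>\<mu>)"
      by (intro nn_integral_mono) (simp add: mult_right_mono S_pw)
    also have "\<dots> = (\<Sum>k. \<integral>\<^sup>+x. enn_powr (ennreal ((1 / (2 * N)) ^ k) * it k x) r * v x \<partial>\<mu>)"
      by (rule nn_integral_suminf) measurable
    also have "\<dots> \<le> (\<Sum>k. ennreal ((1 / 2) ^ k) * H)"
    proof (intro suminf_le)
      fix k
      have "(\<integral>\<^sup>+x. enn_powr (ennreal ((1 / (2 * N)) ^ k) * it k x) r * v x \<partial>\<mu>)
        = ennreal (((1 / (2 * N)) ^ k) powr r) * (\<integral>\<^sup>+x. enn_powr (it k x) r * v x \<partial>\<mu>)"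
        using r N by (subst nn_integral_cmult[symmetric]) (auto simp: enn_powr_mult mult.assoc)
      also have "\<dots> \<le> ennreal (((1 / (2 * N)) ^ k) powr r) * (ennreal ((N powr r) ^ k) * H)"
        by (intro mult_left_mono it_norm) simp
      also have "\<dots> = ennreal (((1 / (2 * N)) ^ k) powr r * (N powr r) ^ k) * H"
        by (simp add: ennreal_mult mult.assoc)
      \<comment> \<open>The norm N^k of the k-th iterate cancels, leaving 2^(-k r), which is at most
        2^(-k) because r is at least 1.\<close>
      also have "((1 / (2 * N)) ^ k) powr r * (N powr r) ^ k = ((1 / 2) ^ k) powr r"
      proof -
        have "(N powr r) ^ k = (N ^ k) powr r"
          using N by (simp add: powr_powr mult.commute flip: powr_realpow)
        then have "((1 / (2 * N)) ^ k) powr r * (N powr r) ^ k = ((1 / (2 * N)) ^ k * N ^ k) powr r"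
          using N by (simp only: powr_mult)
        also have "(1 / (2 * N)) ^ k * N ^ k = (1 / 2) ^ k"
          using N by (simp flip: power_mult_distrib)
        finally show ?thesis .
      qed
      also have "ennreal \<dots> * H \<le> ennreal ((1 / 2) ^ k) * H"
      proof (intro mult_right_mono ennreal_leI)
        have "((1 / 2 :: real) ^ k) powr r \<le> ((1 / 2) ^ k) powr 1"
          using r by (intro powr_mono') (auto simp: power_le_one)
        then show "((1 / 2 :: real) ^ k) powr r \<le> (1 / 2) ^ k" by simp
      qed simp
      finally show "(\<integral>\<^sup>+x. enn_powr (ennreal ((1 / (2 * N)) ^ k) * it k x) r * v x \<partial>\<mu>) \<le> ennreal ((1 / 2) ^ k) * H" .
    qed auto
    finally show ?thesis by (simp add: half)
  qed
  have "(\<integral>\<^sup>+x. enn_powr (G x) r * v x \<partial>\<mu>) \<le> (\<integral>\<^sup>+x. ennreal (2 powr r) * (enn_powr (S x) r * v x) \<partial>\<mu>)"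
  proof (rule nn_integral_mono)
    fix x
    have "enn_powr (G x) r \<le> enn_powr (2 * S x) r" using r by (intro enn_powr_mono G_le) auto
    also have "\<dots> = ennreal (2 powr r) * enn_powr (S x) r"
      using r enn_powr_ennreal[of 2 r] by (simp add: enn_powr_mult)
    finally show "enn_powr (G x) r * v x \<le> ennreal (2 powr r) * (enn_powr (S x) r * v x)"
      by (simp add: mult_right_mono flip: mult.assoc)
  qed
  also have "\<dots> = ennreal (2 powr r) * (\<integral>\<^sup>+x. enn_powr (S x) r * v x \<partial>\<mu>)"
    by (rule nn_integral_cmult) measurable
  also have "\<dots> \<le> ennreal (2 powr r) * (2 * H)"
    by (intro mult_left_mono S_norm) simp
  also have "\<dots> = ennreal (2 powr (r + 1)) * H"
    by (simp add: powr_add ennreal_mult mult.assoc)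
  finally show ?thesis using that[of G] h_le G_max by (auto simp: H_def)
qed

end

section \<open>Spaces of homogeneous type\<close>

locale homogeneous_space =
  fixes \<rho> :: "'a \<Rightarrow> 'a \<Rightarrow> real" and \<mu> :: "'a measure" and A0 C\<mu> :: real
  assumes homogeneous: "homogeneous_type \<rho> \<mu> A0 C\<mu>"
begin

lemma A0_ge_1: "A0 \<ge> 1"
  and \<rho>_nonneg: "\<rho> x y \<ge> 0"
  and \<rho>_refl [simp]: "\<rho> x x = 0"
  and \<rho>_commute: "\<rho> x y = \<rho> y x"
  and \<rho>_triangle: "\<rho> x y \<le> A0 * (\<rho> x z + \<rho> z y)"
  using homogeneous by (auto simp: homogeneous_type_def quasi_metric_def)

lemma space_eq [simp]: "space \<mu> = UNIV"
  and qball_sets [measurable]: "qball \<rho> x r \<in> sets \<mu>"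
  using homogeneous by (auto simp: homogeneous_type_def)

lemma mem_qball: "y \<in> qball \<rho> x r \<longleftrightarrow> \<rho> x y < r"
  by (simp add: qball_def)

lemma \<rho>_triangle_less: "\<rho> x z < r \<Longrightarrow> \<rho> z y < s \<Longrightarrow> \<rho> x y < A0 * (r + s)"
  using \<rho>_triangle[of x y z] A0_ge_1 by (smt (verit) mult_less_cancel_left_pos)

lemma qball_mono: "r \<le> s \<Longrightarrow> qball \<rho> x r \<subseteq> qball \<rho> x s"
  by (auto simp: mem_qball)

lemma qball_subset_qball: "\<rho> x y < s \<Longrightarrow> A0 * (s + r) \<le> t \<Longrightarrow> qball \<rho> y r \<subseteq> qball \<rho> x t"
  using \<rho>_triangle_less by (fastforce simp: mem_qball)

lemma qball_empty: "r \<le> 0 \<Longrightarrow> qball \<rho> x r = {}"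
  by (simp add: set_eq_iff mem_qball not_less order_trans[OF _ \<rho>_nonneg])

lemma emeasure_qball_pos: "r > 0 \<Longrightarrow> 0 < emeasure \<mu> (qball \<rho> x r)"
  using homogeneous unfolding homogeneous_type_def
  by (metis half_gt_zero mult_2 field_sum_of_halves)

lemma emeasure_qball_finite: "emeasure \<mu> (qball \<rho> x r) < \<infinity>"
proof (cases "r > 0")
  case True
  then show ?thesis using homogeneous unfolding homogeneous_type_def by blast
next
  case False
  then have "qball \<rho> x r = {}" by (simp add: qball_empty)
  then show ?thesis by simp
qed

text \<open>Taking \<open>max 1 C\<mu>\<close> spares a separate proof that \<open>C\<mu>\<close> is
  positive.\<close>

lemma emeasure_qball_double: "r > 0 \<Longrightarrow> emeasure \<mu> (qball \<rho> x (2 * r)) \<le> ennreal (max 1 C\<mu>) * emeasure \<mu> (qball \<rho> x r)"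
  using homogeneous unfolding homogeneous_type_def
  by (meson order_trans mult_right_mono ennreal_leI max.cobounded2 zero_le)

lemma emeasure_qball_power: 
  "r > 0 \<Longrightarrow> emeasure \<mu> (qball \<rho> x (2 ^ n * r)) \<le> ennreal (max 1 C\<mu> ^ n) * emeasure \<mu> (qball \<rho> x r)"
proof (induction n)
  case (Suc n)
  have "emeasure \<mu> (qball \<rho> x (2 * (2 ^ n * r))) \<le> ennreal (max 1 C\<mu>) * emeasure \<mu> (qball \<rho> x (2 ^ n * r))"
    using Suc by (intro emeasure_qball_double) auto
  also have "\<dots> \<le> ennreal (max 1 C\<mu>) * (ennreal (max 1 C\<mu> ^ n) * emeasure \<mu> (qball \<rho> x r))"
    using Suc by (intro mult_left_mono) auto
  finally show ?case by (simp add: ennreal_mult mult.assoc)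
qed simp

text \<open>One constant serves all balls: doubling is iterated until \<open>2 ^ n\<close> exceeds
  the dilation factor \<open>c\<close>.\<close>

lemma emeasure_qball_dilate:
  obtains K where "K > 0" "\<And>x r. r > 0 \<Longrightarrow> emeasure \<mu> (qball \<rho> x (c * r)) \<le> ennreal K * emeasure \<mu> (qball \<rho> x r)"
proof -
  obtain n where n: "c < 2 ^ n" using real_arch_pow[of 2 c] by auto
  show thesis
  proof (rule that[of "max 1 C\<mu> ^ n"])
    fix x and r :: real assume r: "r > 0"
    have "emeasure \<mu> (qball \<rho> x (c * r)) \<le> emeasure \<mu> (qball \<rho> x (2 ^ n * r))"
      using n r by (intro emeasure_mono qball_mono) auto
    then show "emeasure \<mu> (qball \<rho> x (c * r)) \<le> ennreal (max 1 C\<mu> ^ n) * emeasure \<mu> (qball \<rho> x r)"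
      using emeasure_qball_power[OF r] order_trans by blast
  qed simp
qed

lemma UN_qball: "(\<Union>n. qball \<rho> x (real n)) = UNIV"
  using reals_Archimedean2 by (auto simp: mem_qball)

sublocale sigma_finite_measure \<mu>
proof (rule sigma_finite_measure.intro, intro exI conjI)
  show "countable (range (\<lambda>n. qball \<rho> undefined (real n)))" by simp
  show "\<Union> (range (\<lambda>n. qball \<rho> undefined (real n))) = space \<mu>" using UN_qball by simp
qed (use emeasure_qball_finite in \<open>auto simp: less_top[symmetric]\<close>)

section \<open>Separability, Vitali's covering lemma and the countable family of balls\<close>

text \<open>A packing argument. Small balls around separated points are disjoint and lie in one
  fixed ball, while doubling makes the mass of each comparable to that of
  \<open>qball \<rho> x0 R\<close>; so there is room for boundedly many.\<close>

lemma separated_card_bound: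
  assumes e: "e > 0" and R: "R > 0"
  obtains N :: nat where "\<And>F. finite F \<Longrightarrow> F \<subseteq> qball \<rho> x0 R \<Longrightarrow> pairwise (\<lambda>x y. e \<le> \<rho> x y) F \<Longrightarrow> card F \<le> N"
proof -
  \<comment> \<open>Chosen so that A0 (d + d) = e: two overlapping \<open>d\<close>-balls would have
    centres closer than \<open>e\<close>.\<close>
  define d where "d = e / (2 * A0)"
  have d: "d > 0" using e A0_ge_1 by (simp add: d_def)
  define S where "S = qball \<rho> x0 (A0 * (R + d))"
  obtain K where K: "K > 0" "\<And>x r. r > 0 \<Longrightarrow> emeasure \<mu> (qball \<rho> x (2 * A0 * R / d * r)) \<le> ennreal K * emeasure \<mu> (qball \<rho> x r)"
    using emeasure_qball_dilate by blast
  obtain m where m: "emeasure \<mu> (qball \<rho> x0 R) = ennreal m" "m > 0"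
    using emeasure_qball_pos[OF R, of x0] emeasure_qball_finite[of x0 R] by (cases "emeasure \<mu> (qball \<rho> x0 R)") auto
  obtain M where M: "emeasure \<mu> S = ennreal M" "M \<ge> 0"
    using emeasure_qball_finite[of x0 "A0 * (R + d)"] by (cases "emeasure \<mu> S") (auto simp: S_def)
  show thesis
  proof (rule that[of "nat \<lceil>K * M / m\<rceil>"])
    fix F assume F: "finite F" "F \<subseteq> qball \<rho> x0 R" "pairwise (\<lambda>x y. e \<le> \<rho> x y) F"
    have disj: "disjoint_family_on (\<lambda>x. qball \<rho> x d) F"
      unfolding disjoint_family_on_def
    proof (intro ballI impI)
      fix x y assume xy: "x \<in> F" "y \<in> F" "x \<noteq> y"
      show "qball \<rho> x d \<inter> qball \<rho> y d = {}"
      proof (rule ccontr)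
        assume "\<not> ?thesis"
        then obtain z where "\<rho> x z < d" "\<rho> z y < d" by (auto simp: mem_qball \<rho>_commute)
        then have "\<rho> x y < A0 * (d + d)" by (rule \<rho>_triangle_less)
        also have "\<dots> = e" using A0_ge_1 by (simp add: d_def field_simps)
        finally show False using F(3) xy by (meson leD pairwiseD)
      qed
    qed
    have sub: "(\<Union>x\<in>F. qball \<rho> x d) \<subseteq> S"
      using F(2) unfolding S_def by (intro UN_least qball_subset_qball[of _ _ R]) (auto simp: mem_qball)
    have "of_nat (card F) * emeasure \<mu> (qball \<rho> x0 R) = (\<Sum>x\<in>F. emeasure \<mu> (qball \<rho> x0 R))" by simp
    also have "\<dots> \<le> (\<Sum>x\<in>F. ennreal K * emeasure \<mu> (qball \<rho> x d))"
    proof (rule sum_mono)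
      fix x assume "x \<in> F"
      then have "qball \<rho> x0 R \<subseteq> qball \<rho> x (2 * A0 * R / d * d)"
        using F(2) d by (intro qball_subset_qball[of _ _ R]) (auto simp: mem_qball \<rho>_commute)
      then have "emeasure \<mu> (qball \<rho> x0 R) \<le> emeasure \<mu> (qball \<rho> x (2 * A0 * R / d * d))"
        by (rule emeasure_mono) measurable
      also have "\<dots> \<le> ennreal K * emeasure \<mu> (qball \<rho> x d)" by (rule K(2)[OF d])
      finally show "emeasure \<mu> (qball \<rho> x0 R) \<le> ennreal K * emeasure \<mu> (qball \<rho> x d)" .
    qed
    also have "\<dots> = ennreal K * emeasure \<mu> (\<Union>x\<in>F. qball \<rho> x d)"
      using F(1) disj by (subst sum_emeasure[symmetric]) (auto simp: sum_distrib_left)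
    also have "\<dots> \<le> ennreal K * ennreal M"
      using sub unfolding M(1)[symmetric] by (intro mult_left_mono emeasure_mono) (auto simp: S_def)
    finally have "ennreal (real (card F) * m) \<le> ennreal (K * M)"
      using m M K by (simp add: ennreal_mult ennreal_of_nat_eq_real_of_nat)
    then have "real (card F) * m \<le> K * M" using K M by (subst (asm) ennreal_le_iff) auto
    then have "real (card F) \<le> K * M / m" using m by (simp add: field_simps)
    then show "card F \<le> nat \<lceil>K * M / m\<rceil>" by linarith
  qed
qed

text \<open>A separated set of maximal cardinality is a net, since a point far from all its members
  could be added.\<close>

lemma finite_net:
  assumes e: "e > 0"
  obtains F where "finite F" "\<And>y. y \<in> qball \<rho> x0 R \<Longrightarrow> \<exists>d\<in>F. \<rho> y d < e"
proof (cases "R > 0")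
  case True
  define P where "P F \<longleftrightarrow> finite F \<and> F \<subseteq> qball \<rho> x0 R \<and> pairwise (\<lambda>x y. e \<le> \<rho> x y) F" for F
  obtain N :: nat where N: "\<And>F. P F \<Longrightarrow> card F \<le> N"
    using separated_card_bound[OF e True] unfolding P_def by metis
  have "P {}" by (simp add: P_def)
  then obtain F where F: "P F" "\<And>F'. P F' \<Longrightarrow> card F' \<le> card F"
    using ex_has_greatest_nat[of P "{}" card "Suc N"] N le_imp_less_Suc by blast
  have "\<exists>d\<in>F. \<rho> y d < e" if y: "y \<in> qball \<rho> x0 R" for y
  proof (rule ccontr)
    assume far: "\<not> ?thesis"
    then have "y \<notin> F" using e by force
    moreover have "P (insert y F)"
      using F(1) y far by (auto simp: P_def pairwise_insert \<rho>_commute not_less)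
    ultimately show False using F(2)[of "insert y F"] F(1) by (auto simp: P_def)
  qed
  then show thesis using that F(1) by (auto simp: P_def)
next
  case False
  then have "qball \<rho> x0 R = {}" by (simp add: qball_empty)
  then show thesis using that[of "{}"] by simp
qed

lemma countable_dense:
  obtains D where "countable D" "D \<noteq> {}" "\<And>y e. e > 0 \<Longrightarrow> \<exists>d\<in>D. \<rho> y d < e"
proof -
  have "\<exists>F. finite F \<and> (\<forall>y\<in>qball \<rho> undefined (real n). \<exists>d\<in>F. \<rho> y d < inverse (Suc m))" for n m
    using finite_net[of "inverse (Suc m)" undefined "real n"] by (metis inverse_positive_iff_positive of_nat_0_less_iff zero_less_Suc)
  then obtain F where F: "\<And>n m. finite (F n m)"
    "\<And>n m y. y \<in> qball \<rho> undefined (real n) \<Longrightarrow> \<exists>d\<in>F n m. \<rho> y d < inverse (Suc m)"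
    by metis
  define D where "D = (\<Union>n. \<Union>m. F n m)"
  have dense: "\<exists>d\<in>D. \<rho> y d < e" if "e > 0" for y e
  proof -
    obtain n where "y \<in> qball \<rho> undefined (real n)" using UN_qball by blast
    moreover obtain m where "inverse (Suc m) < e" using reals_Archimedean[OF \<open>e > 0\<close>] by blast
    ultimately show ?thesis using F(2)[of y n m] unfolding D_def by (metis UN_I UNIV_I order_less_trans)
  qed
  show thesis
  proof (rule that)
    show "countable D" unfolding D_def by (intro countable_UN) (auto intro: countable_finite F)
    show "D \<noteq> {}" using dense[of 1 undefined] by auto
  qed (rule dense)
qed

text \<open>Greedy choice of the largest radius. A ball meeting the chosen one and not larger than
  it lies within distance A0 (r + A0 (r + r)) \<le> 3 A0^2 r of its centre; the balls disjoint from
  it are treated by induction.\<close>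

lemma vitali_finite:
  fixes c :: "nat \<Rightarrow> 'a" and r :: "nat \<Rightarrow> real"
  assumes "finite F" "\<And>i. r i > 0"
  shows "\<exists>G\<subseteq>F. disjoint_family_on (\<lambda>i. qball \<rho> (c i) (r i)) G \<and>
    (\<Union>i\<in>F. qball \<rho> (c i) (r i)) \<subseteq> (\<Union>j\<in>G. qball \<rho> (c j) (3 * A0\<^sup>2 * r j))"
  using assms(1)
proof (induction F rule: finite_psubset_induct)
  case (psubset F)
  show ?case
  proof (cases "F = {}")
    case True then show ?thesis by (auto simp: disjoint_family_on_def)
  next
    case False
    define i where "i = arg_max_on r F"
    have i: "i \<in> F" "\<And>j. j \<in> F \<Longrightarrow> r j \<le> r i"
    proof -
      have "Max (r ` F) \<in> r ` F" using psubset.hyps False by (intro Max_in) auto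
      then obtain k where k: "k \<in> F" "r k = Max (r ` F)" by auto
      have "is_arg_max r (\<lambda>x. x \<in> F) k"
        using k psubset.hyps by (simp add: is_arg_max_linorder)
      then have "is_arg_max r (\<lambda>x. x \<in> F) i"
        unfolding i_def arg_max_on_def arg_max_def by (rule someI)
      then show "i \<in> F" "\<And>j. j \<in> F \<Longrightarrow> r j \<le> r i" by (auto simp: is_arg_max_linorder)
    qed
    define F' where "F' = {j \<in> F. qball \<rho> (c j) (r j) \<inter> qball \<rho> (c i) (r i) = {}}"
    have "c i \<in> qball \<rho> (c i) (r i)" using assms(2) by (simp add: mem_qball)
    then have "F' \<subset> F" using i(1) by (auto simp: F'_def)
    then obtain G where G: "G \<subseteq> F'" "disjoint_family_on (\<lambda>i. qball \<rho> (c i) (r i)) G"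
      "(\<Union>i\<in>F'. qball \<rho> (c i) (r i)) \<subseteq> (\<Union>j\<in>G. qball \<rho> (c j) (3 * A0\<^sup>2 * r j))"
      using psubset.IH[of F'] by blast
    have near: "qball \<rho> (c j) (r j) \<subseteq> qball \<rho> (c i) (3 * A0\<^sup>2 * r i)" if j: "j \<in> F" "j \<notin> F'" for j
    proof
      fix z assume z: "z \<in> qball \<rho> (c j) (r j)"
      obtain u where u: "\<rho> (c j) u < r j" "\<rho> (c i) u < r i" using j by (auto simp: F'_def mem_qball)
      have "\<rho> u z < A0 * (r j + r j)"
        using z u by (intro \<rho>_triangle_less[of _ "c j"]) (auto simp: mem_qball \<rho>_commute)
      with u(2) have "\<rho> (c i) z < A0 * (r i + A0 * (r j + r j))" by (rule \<rho>_triangle_less)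
      also have "\<dots> \<le> A0 * (A0 * r i + A0 * (r i + r i))"
        using A0_ge_1 i(2)[OF j(1)] assms(2)[of i]
        by (intro mult_left_mono add_mono) (auto simp: mult_ge1_I mult_le_cancel_right1)
      finally show "z \<in> qball \<rho> (c i) (3 * A0\<^sup>2 * r i)" by (simp add: mem_qball power2_eq_square algebra_simps)
    qed
    have "disjoint_family_on (\<lambda>i. qball \<rho> (c i) (r i)) (insert i G)"
      using G(1,2) unfolding disjoint_family_on_def F'_def by (auto simp: Int_commute; blast)
    moreover have "(\<Union>j\<in>F. qball \<rho> (c j) (r j)) \<subseteq> (\<Union>j\<in>insert i G. qball \<rho> (c j) (3 * A0\<^sup>2 * r j))"
    proof
      fix z assume "z \<in> (\<Union>j\<in>F. qball \<rho> (c j) (r j))"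
      then obtain j where j: "j \<in> F" "z \<in> qball \<rho> (c j) (r j)" by auto
      show "z \<in> (\<Union>j\<in>insert i G. qball \<rho> (c j) (3 * A0\<^sup>2 * r j))"
      proof (cases "j \<in> F'")
        case True then show ?thesis using G(3) j by auto
      next
        case False then show ?thesis using near[OF j(1)] j(2) by auto
      qed
    qed
    ultimately show ?thesis using G(1) i(1) by (intro exI[of _ "insert i G"]) (auto simp: F'_def)
  qed
qed

text \<open>Dense centres and rational radii. Every ball sits inside a member of the family of
  comparable measure, so averages over all balls are controlled by the countable family up to the
  factor \<open>E\<close>.\<close>

theorem ball_family_exists:
  obtains B Bs D E where "ball_family \<mu> B Bs D" "E > 0"
    "\<And>i. \<exists>x r. r > 0 \<and> Bs i = qball \<rho> x r"
    "\<And>y r. r > 0 \<Longrightarrow> \<exists>i. qball \<rho> y r \<subseteq> B i \<and> emeasure \<mu> (B i) \<le> ennreal E * emeasure \<mu> (qball \<rho> y r)"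
proof -
  obtain S where S: "countable S" "S \<noteq> {}" "\<And>y e. e > 0 \<Longrightarrow> \<exists>d\<in>S. \<rho> y d < e"
    using countable_dense by blast
  define I where "I = S \<times> {q \<in> \<rat>. q > (0 :: real)}"
  have I: "countable I" "I \<noteq> {}"
    using S unfolding I_def by (auto intro!: countable_SIGMA exI[of _ 1] intro: countable_subset[OF _ countable_rat])
  define c r where "c n = fst (from_nat_into I n)" and "r n = snd (from_nat_into I n)" for n
  have r_pos: "r n > 0" for n
    using from_nat_into[OF I(2), of n] by (auto simp: I_def r_def)
  have surj: "\<exists>n. c n = d \<and> r n = q" if "d \<in> S" "q \<in> \<rat>" "q > 0" for d q
  proof -
    have "(d, q) \<in> I" using that by (simp add: I_def)
    then obtain n where "from_nat_into I n = (d, q)" using from_nat_into_surj[OF I(1)] by blast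
    then show ?thesis by (intro exI[of _ n]) (simp add: c_def r_def)
  qed
  obtain D where D: "D > 0" "\<And>x r. r > 0 \<Longrightarrow> emeasure \<mu> (qball \<rho> x (3 * A0\<^sup>2 * r)) \<le> ennreal D * emeasure \<mu> (qball \<rho> x r)"
    using emeasure_qball_dilate by blast
  \<comment> \<open>The dilation factor bounds the radius of a ball about \<open>y\<close> that
    contains the family ball chosen below, whose centre is within s and whose radius is below 4 A0
    s.\<close>
  obtain E where E: "E > 0" "\<And>x r. r > 0 \<Longrightarrow> emeasure \<mu> (qball \<rho> x (A0 * (1 + 4 * A0) * r)) \<le> ennreal E * emeasure \<mu> (qball \<rho> x r)"
    using emeasure_qball_dilate by blast
  have big: "3 * A0\<^sup>2 \<ge> 1" using one_le_power[OF A0_ge_1, of 2] by linarith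
  show thesis
  proof (rule that[of "\<lambda>n. qball \<rho> (c n) (r n)" "\<lambda>n. qball \<rho> (c n) (3 * A0\<^sup>2 * r n)" D E])
    show "ball_family \<mu> (\<lambda>n. qball \<rho> (c n) (r n)) (\<lambda>n. qball \<rho> (c n) (3 * A0\<^sup>2 * r n)) D"
    proof
      fix n
      show "qball \<rho> (c n) (r n) \<subseteq> qball \<rho> (c n) (3 * A0\<^sup>2 * r n)"
        using big r_pos[of n] by (intro qball_mono) auto
    qed (use D r_pos emeasure_qball_pos emeasure_qball_finite vitali_finite sigma_finite_countable in auto)
    show "\<exists>x s. s > 0 \<and> qball \<rho> (c i) (3 * A0\<^sup>2 * r i) = qball \<rho> x s" for i
    proof -
      have "3 * A0\<^sup>2 * r i > 0" using r_pos[of i] big by (intro mult_pos_pos) linarith+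
      then show ?thesis by blast
    qed
    fix y and s :: real assume s: "s > 0"
    obtain d where d: "d \<in> S" "\<rho> y d < s" using S(3)[OF s] by blast
    \<comment> \<open>Above 2 A0 s, so that the ball around \<open>d\<close> swallows the given one;
      below 4 A0 s, so that its measure stays comparable.\<close>
    obtain q where q: "q \<in> \<rat>" "2 * A0 * s < q" "q < 4 * A0 * s"
      using Rats_dense_in_real[of "2 * A0 * s" "4 * A0 * s"] s A0_ge_1 by auto
    moreover have "0 < 2 * A0 * s" using s A0_ge_1 by auto
    ultimately obtain n where n: "c n = d" "r n = q" using surj[OF d(1) q(1)] by fastforce
    have "qball \<rho> y s \<subseteq> qball \<rho> d q"
      using d q s by (intro qball_subset_qball[of _ _ s]) (auto simp: \<rho>_commute)
    moreover have "emeasure \<mu> (qball \<rho> d q) \<le> emeasure \<mu> (qball \<rho> y (A0 * (1 + 4 * A0) * s))"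
      using d q A0_ge_1 by (intro emeasure_mono qball_subset_qball[of _ _ s]) (auto simp: algebra_simps)
    ultimately show "\<exists>i. qball \<rho> y s \<subseteq> qball \<rho> (c i) (r i) \<and>
        emeasure \<mu> (qball \<rho> (c i) (r i)) \<le> ennreal E * emeasure \<mu> (qball \<rho> y s)"
      using n E(2)[OF s, of y] by (intro exI[of _ n]) auto
  qed (use E in auto)
qed

end

section \<open>Muckenhoupt weights and A1 majorants\<close>

context homogeneous_space
begin

text \<open>Rewrites averages as integrals against a probability measure, the form in which
  Hoelder's inequality and almost everywhere bounds on a ball are applied.\<close>

lemma avg_eq_uniform:
  assumes "s > 0" and [measurable]: "g \<in> borel_measurable \<mu>" and "\<And>y. g y \<ge> 0"
  shows "avg \<mu> (qball \<rho> x s) g = (\<integral>\<^sup>+y. ennreal (g y) \<partial>uniform_measure \<mu> (qball \<rho> x s))"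
  using assms by (subst nn_integral_uniform_measure) (auto simp: avg_def)

lemma AE_uniform_qball:
  assumes "AE y in \<mu>. y \<in> qball \<rho> x s \<longrightarrow> P y" "s > 0"
  shows "AE y in uniform_measure \<mu> (qball \<rho> x s). P y"
  using assms emeasure_qball_pos[of s x] emeasure_qball_finite[of x s]
  by (intro AE_uniform_measureI) auto

lemma avg_pos:
  assumes "s > 0" and [measurable]: "g \<in> borel_measurable \<mu>" and "\<And>y. g y > 0"
  shows "avg \<mu> (qball \<rho> x s) g > 0"
proof -
  have "(\<integral>\<^sup>+y\<in>qball \<rho> x s. ennreal \<bar>g y\<bar> \<partial>\<mu>) > 0"
    using set_nn_integral_pos[of g \<mu> "qball \<rho> x s"] assms emeasure_qball_pos[of s x] by (simp add: less_imp_le)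
  then show ?thesis
    using emeasure_qball_finite[of x s] by (simp add: avg_def ennreal_zero_less_divide)
qed

text \<open>The bounds \<open>V\<close>, \<open>S\<close> on the averages are real, so finiteness of the averages is part of the definition.\<close>

definition Ar_weight :: "('a \<Rightarrow> real) \<Rightarrow> real \<Rightarrow> real \<Rightarrow> bool" where
  "Ar_weight v r A \<longleftrightarrow> v \<in> borel_measurable \<mu> \<and> (\<forall>x. v x > 0) \<and>
     (\<forall>x s. s > 0 \<longrightarrow> (\<exists>V S. V > 0 \<and> S > 0 \<and> avg \<mu> (qball \<rho> x s) v \<le> ennreal V \<and>
        avg \<mu> (qball \<rho> x s) (\<lambda>y. v y powr (- 1 / (r - 1))) \<le> ennreal S \<and> V * S powr (r - 1) \<le> A))"

text \<open>An A_1 weight with constant \<open>K\<close>. The exceptional null set is fixed before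
  the ball is chosen: there are uncountably many balls, so null sets depending on the ball could not
  simply be united.\<close>

definition A1_majorant :: "('a \<Rightarrow> real) \<Rightarrow> real \<Rightarrow> bool" where
  "A1_majorant G K \<longleftrightarrow> G \<in> borel_measurable \<mu> \<and> (\<forall>x. G x > 0) \<and>
     (AE x in \<mu>. \<forall>y s. x \<in> qball \<rho> y s \<longrightarrow> avg \<mu> (qball \<rho> y s) G \<le> ennreal (K * G x))"

lemma Ar_weight_const_pos: "Ar_weight v r A \<Longrightarrow> A > 0"
proof -
  assume "Ar_weight v r A"
  then obtain V S where "V > 0" "S > (0 :: real)" "V * S powr (r - 1) \<le> A"
    unfolding Ar_weight_def using zero_less_one by blast
  moreover from this have "V * S powr (r - 1) > 0" by simp
  ultimately show ?thesis by linarith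
qed

text \<open>The two averages exchange roles, and the A_r inequality is raised to the power
  1/(r-1).\<close>

lemma Ar_weight_dual:
  assumes v: "Ar_weight v r A" and r: "r > 1"
  shows "Ar_weight (\<lambda>x. v x powr (- 1 / (r - 1))) (r / (r - 1)) (A powr (1 / (r - 1)))"
proof -
  have [measurable]: "v \<in> borel_measurable \<mu>" and v_pos: "\<And>x. v x > 0"
    using v by (auto simp: Ar_weight_def)
  have e: "r / (r - 1) - 1 = 1 / (r - 1)" using r by (simp add: field_simps)
  have inv: "(v x powr (- 1 / (r - 1))) powr (- 1 / (r / (r - 1) - 1)) = v x" for x
  proof -
    have "- 1 / (r - 1) * (- 1 / (1 / (r - 1))) = 1" using r by (simp add: divide_simps)
    then show ?thesis unfolding e powr_powr using v_pos[of x] by simp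
  qed
  show ?thesis
    unfolding Ar_weight_def inv
  proof (intro conjI allI impI)
    fix x and s :: real assume "s > 0"
    then obtain V S where VS: "V > 0" "S > 0" "avg \<mu> (qball \<rho> x s) v \<le> ennreal V"
      "avg \<mu> (qball \<rho> x s) (\<lambda>y. v y powr (- 1 / (r - 1))) \<le> ennreal S" "V * S powr (r - 1) \<le> A"
      using v unfolding Ar_weight_def by blast
    have "S * V powr (1 / (r - 1)) = (V * S powr (r - 1)) powr (1 / (r - 1))"
      using VS r by (simp add: powr_mult powr_powr mult.commute)
    also have "\<dots> \<le> A powr (1 / (r - 1))" using VS r by (intro powr_mono2) auto
    finally show "\<exists>V S. V > 0 \<and> S > 0 \<and> avg \<mu> (qball \<rho> x s) (\<lambda>y. v y powr (- 1 / (r - 1))) \<le> ennreal V \<and>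
        avg \<mu> (qball \<rho> x s) v \<le> ennreal S \<and> V * S powr (r / (r - 1) - 1) \<le> A powr (1 / (r - 1))"
      using VS unfolding e by blast
  qed (simp_all add: v_pos less_imp_neq[OF v_pos, symmetric])
qed

lemma set_nn_integral_eq_avg:
  assumes "s > 0" "\<And>y. g y \<ge> 0"
  shows "(\<integral>\<^sup>+y\<in>qball \<rho> x s. ennreal (g y) \<partial>\<mu>) = avg \<mu> (qball \<rho> x s) g * emeasure \<mu> (qball \<rho> x s)"
proof -
  let ?I = "\<integral>\<^sup>+y\<in>qball \<rho> x s. ennreal (g y) \<partial>\<mu>" and ?m = "emeasure \<mu> (qball \<rho> x s)"
  have "avg \<mu> (qball \<rho> x s) g * ?m = ?I * ?m / ?m"
    using assms(2) by (simp add: avg_def divide_ennreal_def mult_ac)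
  also have "\<dots> = ?I"
    using emeasure_qball_pos[OF assms(1), of x] emeasure_qball_finite[of x s]
    by (intro mult_divide_eq_ennreal) auto
  finally show ?thesis by simp
qed

lemma Ar_weight_muckenhoupt_bound:
  assumes B: "ball_family \<mu> B Bs D" and Bs: "\<And>i. \<exists>x s. s > 0 \<and> Bs i = qball \<rho> x s"
    and v: "Ar_weight v r A" and r: "r > 1"
  shows "ball_family.muckenhoupt_bound \<mu> Bs v r A"
  unfolding ball_family.muckenhoupt_bound_def[OF B]
proof (intro conjI allI)
  fix i
  obtain x s where s: "s > 0" and Bsi: "Bs i = qball \<rho> x s" using Bs by blast
  obtain m where m: "emeasure \<mu> (qball \<rho> x s) = ennreal m" "m > 0"
    using emeasure_qball_pos[OF s, of x] emeasure_qball_finite[of x s] by (cases "emeasure \<mu> (qball \<rho> x s)") auto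
  obtain V S where VS: "V > 0" "S > 0" "avg \<mu> (qball \<rho> x s) v \<le> ennreal V"
      "avg \<mu> (qball \<rho> x s) (\<lambda>y. v y powr (- 1 / (r - 1))) \<le> ennreal S" "V * S powr (r - 1) \<le> A"
    using v s unfolding Ar_weight_def by blast
  have v_nonneg: "v y \<ge> 0" for y using v by (simp add: Ar_weight_def less_imp_le)
  have IV: "(\<integral>\<^sup>+x\<in>Bs i. ennreal (v x) \<partial>\<mu>) \<le> ennreal (V * m)"
    unfolding Bsi set_nn_integral_eq_avg[OF s v_nonneg] m using VS m by (simp add: ennreal_mult mult_right_mono)
  have IS: "(\<integral>\<^sup>+x\<in>Bs i. ennreal (v x powr (- 1 / (r - 1))) \<partial>\<mu>) \<le> ennreal (S * m)"
    unfolding Bsi set_nn_integral_eq_avg[OF s powr_ge_zero] m using VS m by (simp add: ennreal_mult mult_right_mono)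
  show "(\<integral>\<^sup>+x\<in>Bs i. ennreal (v x) \<partial>\<mu>) < \<infinity>" using IV by (auto intro: le_less_trans)
  show "(\<integral>\<^sup>+x\<in>Bs i. ennreal (v x powr (- 1 / (r - 1))) \<partial>\<mu>) < \<infinity>" using IS by (auto intro: le_less_trans)
  have "(\<integral>\<^sup>+x\<in>Bs i. ennreal (v x) \<partial>\<mu>) * enn_powr (\<integral>\<^sup>+x\<in>Bs i. ennreal (v x powr (- 1 / (r - 1))) \<partial>\<mu>) (r - 1)
    \<le> ennreal (V * m) * enn_powr (ennreal (S * m)) (r - 1)"
    using r by (intro mult_mono IV IS enn_powr_mono) auto
  also have "\<dots> = ennreal (V * S powr (r - 1) * m powr r)"
    using VS m by (simp add: powr_mult powr_diff flip: ennreal_mult)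
  also have "\<dots> \<le> ennreal (A * m powr r)"
    using VS by (intro ennreal_leI mult_right_mono) auto
  also have "\<dots> = ennreal A * enn_powr (emeasure \<mu> (Bs i)) r"
    using m by (simp add: Bsi ennreal_mult'')
  finally show "(\<integral>\<^sup>+x\<in>Bs i. ennreal (v x) \<partial>\<mu>) * enn_powr (\<integral>\<^sup>+x\<in>Bs i. ennreal (v x powr (- 1 / (r - 1))) \<partial>\<mu>) (r - 1)
    \<le> ennreal A * enn_powr (emeasure \<mu> (Bs i)) r" .
qed (use v in \<open>auto simp: Ar_weight_def\<close>)

text \<open>Rubio de Francia's iteration fed with Buckley's norm. The iteration only sees the
  countable family, and \<open>E\<close> pays for arbitrary balls. Positivity of the integral of
  \<open>h\<close> is what makes the majorant positive everywhere. The constant \<open>c\<close> is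
  fixed before the weight.\<close>

theorem A1_majorant_exists:
  assumes r: "r > 1"
  obtains c where "c > 0"
    "\<And>v A h H. Ar_weight v r A \<Longrightarrow> h \<in> borel_measurable \<mu> \<Longrightarrow> (\<And>x. h x \<ge> 0) \<Longrightarrow>
      0 < (\<integral>\<^sup>+x. ennreal (h x powr r * v x) \<partial>\<mu>) \<Longrightarrow> (\<integral>\<^sup>+x. ennreal (h x powr r * v x) \<partial>\<mu>) \<le> ennreal H \<Longrightarrow>
      \<exists>G. A1_majorant G (c * A powr (1 / (r - 1))) \<and> (AE x in \<mu>. h x \<le> G x) \<and>
        (\<integral>\<^sup>+x. ennreal (G x powr r * v x) \<partial>\<mu>) \<le> ennreal (2 powr (r + 1) * H)"
proof -
  obtain B Bs D E where fam: "ball_family \<mu> B Bs D" and E: "E > 0"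
    and Bs: "\<And>i. \<exists>x r. r > 0 \<and> Bs i = qball \<rho> x r"
    and cover: "\<And>y r. r > 0 \<Longrightarrow> \<exists>i. qball \<rho> y r \<subseteq> B i \<and> emeasure \<mu> (B i) \<le> ennreal E * emeasure \<mu> (qball \<rho> y r)"
    using ball_family_exists by blast
  interpret ball_family \<mu> B Bs D by (rule fam)
  define b where "b = buckley_const r powr (1 / r)"
  have b: "b > 0" using buckley_const_pos[OF r] by (simp add: b_def)
  show thesis
  proof (rule that[of "4 * b * E"])
    show "4 * b * E > 0" using b E by simp
    fix v A h H
    assume v: "Ar_weight v r A" and [measurable]: "h \<in> borel_measurable \<mu>" and h: "\<And>x. h x \<ge> (0 :: real)"
      and Hpos: "0 < (\<integral>\<^sup>+x. ennreal (h x powr r * v x) \<partial>\<mu>)" and H: "(\<integral>\<^sup>+x. ennreal (h x powr r * v x) \<partial>\<mu>) \<le> ennreal H"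
    have [measurable]: "v \<in> borel_measurable \<mu>" and v_pos: "\<And>x. v x > 0"
      using v by (auto simp: Ar_weight_def)
    have A: "A > 0" by (rule Ar_weight_const_pos[OF v])
    \<comment> \<open>The r-th root of the constant in \<open>buckley\<close>.\<close>
    define N where "N = b * A powr (1 / (r - 1))"
    have N: "N > 0" using b A by (simp add: N_def)
    have N_powr: "N powr r = buckley_const r * A powr (r / (r - 1))"
      using buckley_const_pos[OF r] A r by (simp add: N_def b_def powr_mult powr_powr)
    have mb: "muckenhoupt_bound v r A" by (rule Ar_weight_muckenhoupt_bound[OF fam Bs v r])
    obtain g where [measurable]: "g \<in> borel_measurable \<mu>" and hg: "\<And>x. ennreal (h x) \<le> g x"
      and g_max: "\<And>x. cmax g x \<le> ennreal (4 * N) * g x"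
      and g_norm: "(\<integral>\<^sup>+x. enn_powr (g x) r * ennreal (v x) \<partial>\<mu>) \<le>
        ennreal (2 powr (r + 1)) * (\<integral>\<^sup>+x. enn_powr (ennreal (h x)) r * ennreal (v x) \<partial>\<mu>)"
    proof (rule rubio_de_francia[of "\<lambda>x. ennreal (v x)" "\<lambda>x. ennreal (h x)" r N])
      fix f :: "'a \<Rightarrow> ennreal" assume "f \<in> borel_measurable \<mu>"
      from buckley[OF mb r A this] show "(\<integral>\<^sup>+x. enn_powr (cmax f x) r * ennreal (v x) \<partial>\<mu>)
        \<le> ennreal (N powr r) * (\<integral>\<^sup>+x. enn_powr (f x) r * ennreal (v x) \<partial>\<mu>)"
        by (simp add: N_powr)
    qed (use r N in auto)
    have "(\<integral>\<^sup>+x. enn_powr (ennreal (h x)) r * ennreal (v x) \<partial>\<mu>) = (\<integral>\<^sup>+x. ennreal (h x powr r * v x) \<partial>\<mu>)"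
      using h by (simp add: ennreal_mult v_pos less_imp_le)
    with g_norm have "(\<integral>\<^sup>+x. enn_powr (g x) r * ennreal (v x) \<partial>\<mu>) \<le> ennreal (2 powr (r + 1)) * (\<integral>\<^sup>+x. ennreal (h x powr r * v x) \<partial>\<mu>)"
      by simp
    also have "\<dots> \<le> ennreal (2 powr (r + 1)) * ennreal H" by (intro mult_left_mono H) simp
    also have "\<dots> = ennreal (2 powr (r + 1) * H)" by (simp add: ennreal_mult')
    finally have g_norm': "(\<integral>\<^sup>+x. enn_powr (g x) r * ennreal (v x) \<partial>\<mu>) \<le> ennreal (2 powr (r + 1) * H)" .
    then have "AE x in \<mu>. enn_powr (g x) r * ennreal (v x) \<noteq> \<infinity>"
      by (intro nn_integral_PInf_AE) (auto simp: top_unique)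
    then have g_fin: "AE x in \<mu>. g x \<noteq> \<infinity>"
    proof (rule AE_mp, intro AE_I2 impI notI)
      fix x assume "enn_powr (g x) r * ennreal (v x) \<noteq> \<infinity>" "g x = \<infinity>"
      then show False using v_pos[of x] by (simp add: ennreal_top_mult)
    qed
    \<comment> \<open>An arbitrary ball is enclosed in a member of the family of comparable measure,
      to which \<open>g_max\<close> applies.\<close>
    have ball_le: "(\<integral>\<^sup>+z\<in>qball \<rho> y s. g z \<partial>\<mu>) \<le> ennreal (4 * N) * g x * (ennreal E * emeasure \<mu> (qball \<rho> y s))"
      if x: "x \<in> qball \<rho> y s" for x y s
    proof -
      have "s > 0" using x qball_empty[of s y] by force
      then obtain i where i: "qball \<rho> y s \<subseteq> B i" "emeasure \<mu> (B i) \<le> ennreal E * emeasure \<mu> (qball \<rho> y s)"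
        using cover by blast
      have "(\<integral>\<^sup>+z\<in>qball \<rho> y s. g z \<partial>\<mu>) \<le> (\<integral>\<^sup>+z\<in>B i. g z \<partial>\<mu>)"
        using i(1) by (intro nn_integral_mono) (auto simp: indicator_def)
      also have "\<dots> = (\<integral>\<^sup>+z\<in>B i. g z \<partial>\<mu>) / emeasure \<mu> (B i) * emeasure \<mu> (B i)"
      proof -
        have "emeasure \<mu> (B i) \<noteq> \<infinity>"
          using Bs_finite[of i] emeasure_mono[OF B_subset_Bs Bs_sets, of i] by (auto simp: top_unique)
        then have "(\<integral>\<^sup>+z\<in>B i. g z \<partial>\<mu>) * emeasure \<mu> (B i) / emeasure \<mu> (B i) = (\<integral>\<^sup>+z\<in>B i. g z \<partial>\<mu>)"
          using B_pos[of i] by (intro mult_divide_eq_ennreal) auto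
        then show ?thesis by (simp add: divide_ennreal_def mult_ac)
      qed
      also have "\<dots> \<le> ennreal (4 * N) * g x * (ennreal E * emeasure \<mu> (qball \<rho> y s))"
        using cmax_upper[of x i g] g_max[of x] x i by (intro mult_mono) (auto intro: order_trans)
      finally show ?thesis .
    qed
    \<comment> \<open>A single zero of \<open>g\<close> would propagate: \<open>ball_le\<close> on
      all balls around it forces g = 0, hence h = 0, almost everywhere, against
      \<open>Hpos\<close>.\<close>
    have g_pos: "g x \<noteq> 0" for x
    proof
      assume x: "g x = 0"
      have "AE y in \<mu>. y \<in> qball \<rho> x (real n) \<longrightarrow> g y = 0" for n
      proof (cases "n = 0")
        case True then show ?thesis by (simp add: qball_empty)
      next
        case False
        then have "(\<integral>\<^sup>+z\<in>qball \<rho> x (real n). g z \<partial>\<mu>) = 0"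
          using ball_le[of x x "real n"] x by (simp add: mem_qball)
        then show ?thesis by (subst (asm) nn_integral_0_iff_AE) (auto simp: indicator_def)
      qed
      then have "AE y in \<mu>. \<forall>n. y \<in> qball \<rho> x (real n) \<longrightarrow> g y = 0"
        unfolding AE_all_countable by blast
      then have "AE y in \<mu>. ennreal (h y powr r * v y) = 0"
      proof (rule AE_mp, intro AE_I2 impI)
        fix y assume "\<forall>n. y \<in> qball \<rho> x (real n) \<longrightarrow> g y = 0"
        then have "g y = 0" using UN_qball[of x] by blast
        then have "h y = 0" using hg[of y] h[of y] by (simp add: ennreal_eq_0_iff)
        then show "ennreal (h y powr r * v y) = 0" by simp
      qed
      then have "(\<integral>\<^sup>+x. ennreal (h x powr r * v x) \<partial>\<mu>) = 0" by (subst nn_integral_0_iff_AE) auto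
      with Hpos show False by simp
    qed
    \<comment> \<open>The value 1 on the null set where \<open>g\<close> is infinite keeps
      \<open>G\<close> real and positive everywhere.\<close>
    define G where "G x = (if g x = \<infinity> then 1 else enn2real (g x))" for x
    have [measurable]: "G \<in> borel_measurable \<mu>" unfolding G_def by measurable
    have G_pos: "G x > 0" for x
      using g_pos[of x] by (auto simp: G_def enn2real_positive_iff less_top zero_less_iff_neq_zero)
    have G_eq: "AE x in \<mu>. g x = ennreal (G x)"
      using g_fin by eventually_elim (auto simp: G_def less_top)
    have "AE x in \<mu>. h x \<le> G x"
      using G_eq
    proof eventually_elim
      case (elim x)
      then show ?case using hg[of x] G_pos[of x] by simp
    qed
    moreover have "AE x in \<mu>. \<forall>y s. x \<in> qball \<rho> y s \<longrightarrow> avg \<mu> (qball \<rho> y s) G \<le> ennreal (4 * b * E * A powr (1 / (r - 1)) * G x)"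
      using G_eq
    proof (eventually_elim, intro allI impI)
      fix x y s assume x: "g x = ennreal (G x)" and xs: "x \<in> qball \<rho> y s"
      have s: "s > 0" using xs qball_empty[of s y] by force
      let ?m = "emeasure \<mu> (qball \<rho> y s)"
      have "(\<integral>\<^sup>+z\<in>qball \<rho> y s. ennreal \<bar>G z\<bar> \<partial>\<mu>) = (\<integral>\<^sup>+z\<in>qball \<rho> y s. g z \<partial>\<mu>)"
        using G_eq by (intro nn_integral_cong_AE) (auto simp: G_pos less_imp_le)
      also have "\<dots> \<le> ennreal (4 * N) * ennreal (G x) * (ennreal E * ?m)"
        using ball_le[OF xs] by (simp add: x)
      also have "\<dots> = ennreal (4 * b * E * A powr (1 / (r - 1)) * G x) * ?m"
      proof -
        have "ennreal (4 * N) * ennreal (G x) * ennreal E = ennreal (4 * b * E * A powr (1 / (r - 1)) * G x)"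
        proof -
          have "ennreal (4 * N) * ennreal (G x) * ennreal E = ennreal (4 * N * G x * E)"
            using N E G_pos[of x] by (simp add: ennreal_mult less_imp_le)
          then show ?thesis by (simp add: N_def mult_ac)
        qed
        then show ?thesis by (simp only: mult.assoc[symmetric])
      qed
      finally have "avg \<mu> (qball \<rho> y s) G \<le> ennreal (4 * b * E * A powr (1 / (r - 1)) * G x) * ?m / ?m"
        unfolding avg_def by (rule divide_right_mono_ennreal)
      then show "avg \<mu> (qball \<rho> y s) G \<le> ennreal (4 * b * E * A powr (1 / (r - 1)) * G x)"
        using ennreal_mult_divide_le order_trans by blast
    qed
    moreover have "(\<integral>\<^sup>+x. ennreal (G x powr r * v x) \<partial>\<mu>) = (\<integral>\<^sup>+x. enn_powr (g x) r * ennreal (v x) \<partial>\<mu>)"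
    proof (rule nn_integral_cong_AE, use G_eq in eventually_elim)
      case (elim x)
      then show ?case using G_pos[of x] v_pos[of x] by (simp add: ennreal_mult less_imp_le)
    qed
    ultimately show "\<exists>G. A1_majorant G (4 * b * E * A powr (1 / (r - 1))) \<and> (AE x in \<mu>. h x \<le> G x) \<and>
        (\<integral>\<^sup>+x. ennreal (G x powr r * v x) \<partial>\<mu>) \<le> ennreal (2 powr (r + 1) * H)"
      using G_pos g_norm' by (intro exI[of _ G]) (auto simp: A1_majorant_def)
  qed
qed


section \<open>Products of powers of A_r and A_1 weights\<close>

text \<open>Reads the A_1 condition as an essential lower bound g/K for \<open>G\<close> on the
  ball, where g is its average; this is how negative powers of \<open>G\<close> get
  controlled.\<close>

lemma A1_majorant_ball:
  assumes G: "A1_majorant G K" and s: "s > 0"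
  obtains g where "g > 0" "avg \<mu> (qball \<rho> x s) G = ennreal g"
    "AE y in uniform_measure \<mu> (qball \<rho> x s). g \<le> K * G y"
proof -
  have [measurable]: "G \<in> borel_measurable \<mu>" and G_pos: "\<And>x. G x > 0"
    and AE: "AE z in \<mu>. \<forall>y s. z \<in> qball \<rho> y s \<longrightarrow> avg \<mu> (qball \<rho> y s) G \<le> ennreal (K * G z)"
    using G by (auto simp: A1_majorant_def)
  let ?U = "uniform_measure \<mu> (qball \<rho> x s)"
  \<comment> \<open>The ball has positive mass, so the almost everywhere bound holds at some point,
    and one point is enough to make the average finite.\<close>
  have "emeasure ?U (space ?U) \<noteq> 0"
    using emeasure_qball_pos[OF s, of x] emeasure_qball_finite[of x s]
    by (subst emeasure_uniform_measure) (use sets.top[of \<mu>] in \<open>auto simp: ennreal_divide_self less_top[symmetric]\<close>)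
  then have U: "ae_filter ?U \<noteq> bot" by (simp add: ae_filter_eq_bot_iff)
  have AEU: "AE z in ?U. avg \<mu> (qball \<rho> x s) G \<le> ennreal (K * G z)"
    using AE by (intro AE_uniform_qball s) (auto elim: AE_mp)
  then obtain z where "avg \<mu> (qball \<rho> x s) G \<le> ennreal (K * G z)"
    using eventually_happens'[OF U] by blast
  then have "avg \<mu> (qball \<rho> x s) G < top" by (rule le_less_trans) simp
  moreover have "avg \<mu> (qball \<rho> x s) G > 0" using G_pos by (intro avg_pos s) auto
  ultimately obtain g where g: "g > 0" "avg \<mu> (qball \<rho> x s) G = ennreal g"
    by (cases "avg \<mu> (qball \<rho> x s) G") auto
  have "AE y in ?U. g \<le> K * G y"
    using AEU by (rule AE_mp) (use g in \<open>auto simp: ennreal_le_iff2\<close>)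
  with g show thesis by (rule that)
qed

text \<open>In the first average \<open>G\<close> has the negative exponent r - r0 and is bounded
  pointwise through its lower bound g/K. In the dual average it has the positive exponent t < 1, and
  Hoelder's inequality separates it from the dual weight of \<open>v\<close>.\<close>

lemma Ar_weight_mult_A1_down:
  assumes v: "Ar_weight v r A" and G: "A1_majorant G K" and K: "K > 0" and r: "1 < r" "r < r0"
  shows "Ar_weight (\<lambda>x. G x powr (r - r0) * v x) r0 (K powr (r0 - r) * A)"
proof -
  have [measurable]: "v \<in> borel_measurable \<mu>" "G \<in> borel_measurable \<mu>"
    and v_pos: "\<And>x. v x > 0" and G_pos: "\<And>x. G x > 0"
    using v G by (auto simp: Ar_weight_def A1_majorant_def)
  show ?thesis
    unfolding Ar_weight_def
  proof (intro conjI allI impI)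
    show "(\<lambda>x. G x powr (r - r0) * v x) \<in> borel_measurable \<mu>" by measurable
    show "G x powr (r - r0) * v x > 0" for x using G_pos[of x] v_pos[of x] by simp
    fix x and s :: real assume s: "s > 0"
    define M where "M = uniform_measure \<mu> (qball \<rho> x s)"
    have [measurable_cong]: "sets M = sets \<mu>" by (simp add: M_def)
    obtain V S where VS: "V > 0" "S > 0" "avg \<mu> (qball \<rho> x s) v \<le> ennreal V"
      "avg \<mu> (qball \<rho> x s) (\<lambda>y. v y powr (- 1 / (r - 1))) \<le> ennreal S" "V * S powr (r - 1) \<le> A"
      using v s unfolding Ar_weight_def by blast
    obtain g where g: "g > 0" "avg \<mu> (qball \<rho> x s) G = ennreal g" "AE y in M. g \<le> K * G y"
      using A1_majorant_ball[OF G s, of x] unfolding M_def by blast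
    define t where "t = (r0 - r) / (r0 - 1)"
    have t: "t \<ge> 0" "1 - t \<ge> 0" and t1: "1 - t = (r - 1) / (r0 - 1)"
      using r by (auto simp: t_def divide_simps)
    have avg1: "avg \<mu> (qball \<rho> x s) (\<lambda>x. G x powr (r - r0) * v x) \<le> ennreal ((g / K) powr (r - r0) * V)"
    proof -
      have "avg \<mu> (qball \<rho> x s) (\<lambda>x. G x powr (r - r0) * v x) = (\<integral>\<^sup>+y. ennreal (G y powr (r - r0) * v y) \<partial>M)"
        unfolding M_def using G_pos v_pos by (intro avg_eq_uniform s) (auto simp: less_imp_le)
      also have "\<dots> \<le> (\<integral>\<^sup>+y. ennreal ((g / K) powr (r - r0)) * ennreal (v y) \<partial>M)"
      proof (rule nn_integral_mono_AE, use g(3) in eventually_elim)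
        case (elim y)
        then have "G y powr (r - r0) \<le> (g / K) powr (r - r0)"
          using K g(1) r by (intro powr_mono2') (auto simp: field_simps)
        then show ?case
          using v_pos[of y] by (auto simp flip: ennreal_mult' intro!: ennreal_leI)
      qed
      also have "\<dots> = ennreal ((g / K) powr (r - r0)) * avg \<mu> (qball \<rho> x s) v"
        unfolding M_def by (subst avg_eq_uniform[OF s]) (auto simp: nn_integral_cmult v_pos less_imp_le)
      also have "\<dots> \<le> ennreal ((g / K) powr (r - r0)) * ennreal V"
        by (intro mult_left_mono VS) simp
      finally show ?thesis using VS by (simp add: ennreal_mult)
    qed
    have avg2: "avg \<mu> (qball \<rho> x s) (\<lambda>y. (G y powr (r - r0) * v y) powr (- 1 / (r0 - 1))) \<le> ennreal (g powr t * S powr (1 - t))"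
    proof -
      have eq: "(G y powr (r - r0) * v y) powr (- 1 / (r0 - 1)) = G y powr t * (v y powr (- 1 / (r - 1))) powr (1 - t)" for y
      proof -
        have "(r - r0) * (- 1 / (r0 - 1)) = t" unfolding t_def using r by (simp add: field_simps)
        moreover have "- 1 / (r - 1) * (1 - t) = - 1 / (r0 - 1)" unfolding t1 using r by (simp add: field_simps)
        ultimately show ?thesis using G_pos[of y] v_pos[of y] by (simp only: powr_mult powr_powr)
      qed
      have "avg \<mu> (qball \<rho> x s) (\<lambda>y. (G y powr (r - r0) * v y) powr (- 1 / (r0 - 1)))
        = (\<integral>\<^sup>+y. ennreal (G y powr t * (v y powr (- 1 / (r - 1))) powr (1 - t)) \<partial>M)"
        unfolding M_def eq by (intro avg_eq_uniform s) auto
      also have "\<dots> \<le> ennreal (g powr t * S powr (1 - t))"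
      proof (rule nn_integral_Holder_bound)
        show "(\<integral>\<^sup>+y. ennreal (G y) \<partial>M) \<le> ennreal g"
          using g(2) unfolding M_def by (subst avg_eq_uniform[symmetric]) (auto simp: s G_pos less_imp_le)
        show "(\<integral>\<^sup>+y. ennreal (v y powr (- 1 / (r - 1))) \<partial>M) \<le> ennreal S"
          using VS(4) unfolding M_def by (subst avg_eq_uniform[symmetric]) (auto simp: s)
      qed (use G_pos g VS t in \<open>auto simp: less_imp_le\<close>)
      finally show ?thesis .
    qed
    \<comment> \<open>The average g of \<open>G\<close>, which depends on the ball, cancels; only
      the power r0 - r of \<open>K\<close> survives.\<close>
    have "(g / K) powr (r - r0) * V * (g powr t * S powr (1 - t)) powr (r0 - 1) = K powr (r0 - r) * (V * S powr (r - 1))"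
    proof -
      have "(g powr t * S powr (1 - t)) powr (r0 - 1) = g powr (r0 - r) * S powr (r - 1)"
      proof -
        have "t * (r0 - 1) = r0 - r" "(1 - t) * (r0 - 1) = r - 1" unfolding t1 using r by (simp_all add: t_def)
        then show ?thesis by (simp only: powr_mult powr_powr powr_ge_zero)
      qed
      moreover have "(g / K) powr (r - r0) * g powr (r0 - r) = K powr (r0 - r)"
      proof -
        have "(g / K) powr (r - r0) = (K / g) powr (r0 - r)"
          using g(1) K by (simp add: powr_divide powr_minus_divide[of _ "r0 - r", simplified] field_simps)
        then show ?thesis using g(1) K by (simp add: powr_divide)
      qed
      ultimately show ?thesis by (simp add: mult_ac)
    qed
    also have "\<dots> \<le> K powr (r0 - r) * A"
      by (intro mult_left_mono VS) simp
    finally show "\<exists>V S. V > 0 \<and> S > 0 \<and> avg \<mu> (qball \<rho> x s) (\<lambda>x. G x powr (r - r0) * v x) \<le> ennreal V \<and>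
        avg \<mu> (qball \<rho> x s) (\<lambda>y. (G y powr (r - r0) * v y) powr (- 1 / (r0 - 1))) \<le> ennreal S \<and>
        V * S powr (r0 - 1) \<le> K powr (r0 - r) * A"
      using avg1 avg2 g(1) K VS by (intro exI[of _ "(g / K) powr (r - r0) * V"] exI[of _ "g powr t * S powr (1 - t)"]) auto
  qed
qed

text \<open>The mirror image of the previous argument: Hoelder's inequality with exponents theta and
  1 - theta for the first average, the pointwise lower bound of \<open>U\<close> for the dual one,
  where \<open>U\<close> has a negative exponent.\<close>

lemma Ar_weight_mult_A1_up:
  assumes v: "Ar_weight v r A" and U: "A1_majorant U K" and K: "K > 0" and r: "1 < r0" "r0 < r"
  defines "\<theta> \<equiv> (r - r0) / (r - 1)"
  shows "Ar_weight (\<lambda>x. U x powr \<theta> * v x powr (1 - \<theta>)) r0 (K powr \<theta> * A powr (1 - \<theta>))"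
proof -
  have [measurable]: "v \<in> borel_measurable \<mu>" "U \<in> borel_measurable \<mu>"
    and v_pos: "\<And>x. v x > 0" and U_pos: "\<And>x. U x > 0"
    using v U by (auto simp: Ar_weight_def A1_majorant_def)
  have \<theta>: "\<theta> \<ge> 0" "1 - \<theta> \<ge> 0" and \<theta>1: "1 - \<theta> = (r0 - 1) / (r - 1)"
    using r by (auto simp: \<theta>_def divide_simps)
  show ?thesis
    unfolding Ar_weight_def
  proof (intro conjI allI impI)
    show "(\<lambda>x. U x powr \<theta> * v x powr (1 - \<theta>)) \<in> borel_measurable \<mu>" by measurable
    show "U x powr \<theta> * v x powr (1 - \<theta>) > 0" for x using U_pos[of x] v_pos[of x] by simp
    fix x and s :: real assume s: "s > 0"
    define M where "M = uniform_measure \<mu> (qball \<rho> x s)"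
    have [measurable_cong]: "sets M = sets \<mu>" by (simp add: M_def)
    obtain V S where VS: "V > 0" "S > 0" "avg \<mu> (qball \<rho> x s) v \<le> ennreal V"
      "avg \<mu> (qball \<rho> x s) (\<lambda>y. v y powr (- 1 / (r - 1))) \<le> ennreal S" "V * S powr (r - 1) \<le> A"
      using v s unfolding Ar_weight_def by blast
    obtain g where g: "g > 0" "avg \<mu> (qball \<rho> x s) U = ennreal g" "AE y in M. g \<le> K * U y"
      using A1_majorant_ball[OF U s, of x] unfolding M_def by blast
    define t where "t = - \<theta> / (r0 - 1)"
    have t: "t \<le> 0" using \<theta> r by (simp add: t_def)
    have avg1: "avg \<mu> (qball \<rho> x s) (\<lambda>x. U x powr \<theta> * v x powr (1 - \<theta>)) \<le> ennreal (g powr \<theta> * V powr (1 - \<theta>))"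
    proof -
      have "avg \<mu> (qball \<rho> x s) (\<lambda>x. U x powr \<theta> * v x powr (1 - \<theta>)) = (\<integral>\<^sup>+y. ennreal (U y powr \<theta> * v y powr (1 - \<theta>)) \<partial>M)"
        unfolding M_def by (intro avg_eq_uniform s) auto
      also have "\<dots> \<le> ennreal (g powr \<theta> * V powr (1 - \<theta>))"
      proof (rule nn_integral_Holder_bound)
        show "(\<integral>\<^sup>+y. ennreal (U y) \<partial>M) \<le> ennreal g"
          using g(2) unfolding M_def by (subst avg_eq_uniform[symmetric]) (auto simp: s U_pos less_imp_le)
        show "(\<integral>\<^sup>+y. ennreal (v y) \<partial>M) \<le> ennreal V"
          using VS(3) unfolding M_def by (subst avg_eq_uniform[symmetric]) (auto simp: s v_pos less_imp_le)
      qed (use U_pos v_pos g VS \<theta> in \<open>auto simp: less_imp_le\<close>)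
      finally show ?thesis .
    qed
    have avg2: "avg \<mu> (qball \<rho> x s) (\<lambda>y. (U y powr \<theta> * v y powr (1 - \<theta>)) powr (- 1 / (r0 - 1))) \<le> ennreal ((g / K) powr t * S)"
    proof -
      have eq: "(U y powr \<theta> * v y powr (1 - \<theta>)) powr (- 1 / (r0 - 1)) = U y powr t * v y powr (- 1 / (r - 1))" for y
      proof -
        have "\<theta> * (- 1 / (r0 - 1)) = t" unfolding t_def by simp
        moreover have "(1 - \<theta>) * (- 1 / (r0 - 1)) = - 1 / (r - 1)" unfolding \<theta>1 using r by (simp add: field_simps)
        ultimately show ?thesis using U_pos[of y] v_pos[of y] by (simp only: powr_mult powr_powr powr_ge_zero)
      qed
      have "avg \<mu> (qball \<rho> x s) (\<lambda>y. (U y powr \<theta> * v y powr (1 - \<theta>)) powr (- 1 / (r0 - 1)))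
        = (\<integral>\<^sup>+y. ennreal (U y powr t * v y powr (- 1 / (r - 1))) \<partial>M)"
        unfolding M_def eq by (intro avg_eq_uniform s) auto
      also have "\<dots> \<le> (\<integral>\<^sup>+y. ennreal ((g / K) powr t) * ennreal (v y powr (- 1 / (r - 1))) \<partial>M)"
      proof (rule nn_integral_mono_AE, use g(3) in eventually_elim)
        case (elim y)
        then have "U y powr t \<le> (g / K) powr t"
          using K g(1) t by (intro powr_mono2') (auto simp: field_simps)
        then show ?case
          by (auto simp flip: ennreal_mult' intro!: ennreal_leI mult_right_mono)
      qed
      also have "\<dots> = ennreal ((g / K) powr t) * avg \<mu> (qball \<rho> x s) (\<lambda>y. v y powr (- 1 / (r - 1)))"
        unfolding M_def by (subst avg_eq_uniform[OF s]) (auto simp: nn_integral_cmult)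
      also have "\<dots> \<le> ennreal ((g / K) powr t) * ennreal S"
        by (intro mult_left_mono VS) simp
      finally show ?thesis using VS by (simp add: ennreal_mult)
    qed
    have "g powr \<theta> * V powr (1 - \<theta>) * ((g / K) powr t * S) powr (r0 - 1) = K powr \<theta> * (V * S powr (r - 1)) powr (1 - \<theta>)"
    proof -
      have e: "t * (r0 - 1) = - \<theta>" "(r - 1) * (1 - \<theta>) = r0 - 1" using r unfolding \<theta>1 by (simp_all add: t_def)
      have "((g / K) powr t * S) powr (r0 - 1) = (g / K) powr (- \<theta>) * S powr (r0 - 1)"
        using VS by (simp only: powr_mult powr_powr e powr_ge_zero)
      moreover have "g powr \<theta> * (g / K) powr (- \<theta>) = K powr \<theta>"
        using g(1) K by (simp add: powr_divide powr_minus_divide)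
      moreover have "(V * S powr (r - 1)) powr (1 - \<theta>) = V powr (1 - \<theta>) * S powr (r0 - 1)"
        using VS by (simp only: powr_mult powr_powr e powr_ge_zero)
      ultimately show ?thesis by (simp add: mult_ac)
    qed
    also have "\<dots> \<le> K powr \<theta> * A powr (1 - \<theta>)"
      using VS \<theta> by (intro mult_left_mono powr_mono2) auto
    finally show "\<exists>V S. V > 0 \<and> S > 0 \<and> avg \<mu> (qball \<rho> x s) (\<lambda>x. U x powr \<theta> * v x powr (1 - \<theta>)) \<le> ennreal V \<and>
        avg \<mu> (qball \<rho> x s) (\<lambda>y. (U y powr \<theta> * v y powr (1 - \<theta>)) powr (- 1 / (r0 - 1))) \<le> ennreal S \<and>
        V * S powr (r0 - 1) \<le> K powr \<theta> * A powr (1 - \<theta>)"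
      using avg1 avg2 g(1) K VS by (intro exI[of _ "g powr \<theta> * V powr (1 - \<theta>)"] exI[of _ "(g / K) powr t * S"]) auto
  qed
qed

section \<open>Dictionary between A_{p,q} and A_r weights\<close>

text \<open>Here r - 1 = q/p'. For W = u^(1/q) the powers W^q and W^(-p') are \<open>u\<close> and
  its dual weight, so the two characteristic quantities agree ball by ball.\<close>

lemma in_Apq_of_Ar_weight:
  assumes u: "Ar_weight u (1 + q / (p / (p - 1))) A" and p: "p > 1" and q: "q > 0"
  shows "in_Apq \<rho> \<mu> p q (\<lambda>x. u x powr (1 / q))" "Apq_const \<rho> \<mu> p q (\<lambda>x. u x powr (1 / q)) \<le> A"
proof -
  define k where "k = q / (p / (p - 1))"
  have [measurable]: "u \<in> borel_measurable \<mu>" and u_pos: "\<And>x. u x > 0"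
    using u by (auto simp: Ar_weight_def)
  have k: "k > 0" "1 / q * - (p / (p - 1)) = - 1 / (1 + k - 1)" using p q by (auto simp: k_def field_simps)
  have W: "(\<lambda>y. (u y powr (1 / q)) powr q) = u"
    "(\<lambda>y. (u y powr (1 / q)) powr - (p / (p - 1))) = (\<lambda>y. u y powr (- 1 / (1 + k - 1)))"
    using u_pos q k by (auto simp: powr_powr less_imp_le)
  have ball: "avg \<mu> (qball \<rho> x s) u < \<infinity> \<and> avg \<mu> (qball \<rho> x s) (\<lambda>y. u y powr (- 1 / (1 + k - 1))) < \<infinity> \<and>
    Apq_ball \<rho> \<mu> p q (\<lambda>x. u x powr (1 / q)) x s \<le> A" if s: "s > 0" for x s
  proof -
    obtain V S where VS: "V > 0" "S > 0" "avg \<mu> (qball \<rho> x s) u \<le> ennreal V"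
      "avg \<mu> (qball \<rho> x s) (\<lambda>y. u y powr (- 1 / (1 + k - 1))) \<le> ennreal S" "V * S powr (1 + k - 1) \<le> A"
      using u s unfolding Ar_weight_def k_def[symmetric] by blast
    have "Apq_ball \<rho> \<mu> p q (\<lambda>x. u x powr (1 / q)) x s \<le> V * S powr k"
      unfolding Apq_ball_def W k_def[symmetric] using VS k
      by (intro mult_mono powr_mono2 enn2real_leI) auto
    with VS show ?thesis by (auto intro: le_less_trans)
  qed
  have "is_weight \<mu> (\<lambda>x. u x powr (1 / q))" unfolding is_weight_def using u_pos by (auto simp: less_imp_neq[symmetric])
  then show "in_Apq \<rho> \<mu> p q (\<lambda>x. u x powr (1 / q))"
    unfolding in_Apq_def W using p ball by (auto intro!: bdd_aboveI[of _ A])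
  show "Apq_const \<rho> \<mu> p q (\<lambda>x. u x powr (1 / q)) \<le> A"
  proof -
    have ne: "{Apq_ball \<rho> \<mu> p q (\<lambda>x. u x powr (1 / q)) x s | x s. s > 0} \<noteq> {}" using zero_less_one by blast
    show ?thesis unfolding Apq_const_def using p ball by (auto intro!: cSup_least[OF ne])
  qed
qed

text \<open>The endpoint of the dictionary. That one null set serves all balls is what the pointwise
  supremum in \<open>maximal\<close> requires.\<close>

lemma in_Apq_of_A1_majorant:
  assumes u: "A1_majorant u K" and q: "q > 0" and K: "K > 0"
  shows "in_Apq \<rho> \<mu> 1 q (\<lambda>x. u x powr (1 / q))" "Apq_const \<rho> \<mu> 1 q (\<lambda>x. u x powr (1 / q)) \<le> K"
proof -
  have [measurable]: "u \<in> borel_measurable \<mu>" and u_pos: "\<And>x. u x > 0"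
    and AE: "AE x in \<mu>. \<forall>y s. x \<in> qball \<rho> y s \<longrightarrow> avg \<mu> (qball \<rho> y s) u \<le> ennreal (K * u x)"
    using u by (auto simp: A1_majorant_def)
  have W: "(u y powr (1 / q)) powr q = u y" for y
    using u_pos q by (auto simp: powr_powr less_imp_le)
  have max: "AE x in \<mu>. maximal \<rho> \<mu> u x \<le> ennreal (K * u x)"
    using AE by eventually_elim (auto simp: maximal_def intro!: SUP_least)
  have fin: "avg \<mu> (qball \<rho> x s) u < \<infinity>" if "s > 0" for x s
    using A1_majorant_ball[OF u that, of x "avg \<mu> (qball \<rho> x s) u < \<infinity>"] by simp
  have "is_weight \<mu> (\<lambda>x. u x powr (1 / q))" unfolding is_weight_def using u_pos by (auto simp: less_imp_neq[symmetric])
  then show "in_Apq \<rho> \<mu> 1 q (\<lambda>x. u x powr (1 / q))"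
    unfolding in_Apq_def W using max fin by auto
  show "Apq_const \<rho> \<mu> 1 q (\<lambda>x. u x powr (1 / q)) \<le> K"
    unfolding Apq_const_def W using max K by (auto intro!: cInf_lower bdd_belowI[of _ 0])
qed

text \<open>Since \<open>w\<close> is positive everywhere, both averages are strictly positive and
  can themselves serve as the bounds V and S.\<close>

lemma Ar_weight_of_in_Apq:
  assumes w: "in_Apq \<rho> \<mu> p q w" and p: "p > 1" and q: "q > 0" and w_pos: "\<And>x. w x > 0"
  shows "Ar_weight (\<lambda>x. w x powr q) (1 + q / (p / (p - 1))) (Apq_const \<rho> \<mu> p q w)"
proof -
  have [measurable]: "w \<in> borel_measurable \<mu>" using w by (simp add: in_Apq_def is_weight_def)
  have e: "q * (- 1 / (1 + q / (p / (p - 1)) - 1)) = - (p / (p - 1))" using p q by (simp add: field_simps)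
  show ?thesis
    unfolding Ar_weight_def powr_powr e
  proof (intro conjI allI impI)
    show "(\<lambda>x. w x powr q) \<in> borel_measurable \<mu>" by measurable
    show "w x powr q > 0" for x using w_pos[of x] by simp
    fix x and s :: real assume s: "s > 0"
    define V where "V = enn2real (avg \<mu> (qball \<rho> x s) (\<lambda>y. w y powr q))"
    define S where "S = enn2real (avg \<mu> (qball \<rho> x s) (\<lambda>y. w y powr - (p / (p - 1))))"
    have pos: "avg \<mu> (qball \<rho> x s) (\<lambda>y. w y powr t) > 0" for t
      using w_pos by (intro avg_pos s) (auto simp: less_imp_neq[symmetric])
    have fin: "avg \<mu> (qball \<rho> x s) (\<lambda>y. w y powr q) < top" "avg \<mu> (qball \<rho> x s) (\<lambda>y. w y powr - (p / (p - 1))) < top"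
      using w p s by (auto simp: in_Apq_def)
    have "Apq_ball \<rho> \<mu> p q w x s \<le> Apq_const \<rho> \<mu> p q w"
      unfolding Apq_const_def using p w s by (auto simp: in_Apq_def intro!: cSup_upper)
    then show "\<exists>V S. V > 0 \<and> S > 0 \<and> avg \<mu> (qball \<rho> x s) (\<lambda>x. w x powr q) \<le> ennreal V \<and>
        avg \<mu> (qball \<rho> x s) (\<lambda>y. w y powr - (p / (p - 1))) \<le> ennreal S \<and>
        V * S powr (1 + q / (p / (p - 1)) - 1) \<le> Apq_const \<rho> \<mu> p q w"
      using pos fin
      by (intro exI[of _ V] exI[of _ S]) (simp add: V_def S_def Apq_ball_def enn2real_positive_iff)
  qed
qed

end

text \<open>Reduces weak norm estimates to the weighted mass of one level set at a time.\<close>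

lemma weak_norm_le_iff:
  assumes "q > 0" "Y \<ge> 0"
  shows "weak_norm \<mu> v q g \<le> ennreal Y \<longleftrightarrow>
    (\<forall>t>0. (\<integral>\<^sup>+x. indicator {y. \<bar>g y\<bar> > t} x * ennreal (v x) \<partial>\<mu>) \<le> ennreal ((Y / t) powr q))"
proof -
  have "ennreal t * X \<le> ennreal Y \<longleftrightarrow> X \<le> ennreal (Y / t)" if "t > 0" for t X
  proof (cases X)
    case (real x)
    have "ennreal t * X = ennreal (t * x)" using real that by (simp add: ennreal_mult)
    then show ?thesis using real assms that by (simp add: ennreal_le_iff field_simps)
  next
    case top
    then show ?thesis using that by (simp add: ennreal_mult_top top_unique)
  qed
  then show ?thesis
    using assms by (auto simp: weak_norm_def SUP_le_iff enn_powr_le_iff)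
qed

section \<open>Extrapolation\<close>

text \<open>With x = |f|, the surplus |f|^(p0-p) is paid for by a power of the majorant through
  \<open>le\<close>, and the weight G^(r-r0) absorbs exactly that power. Thus the norm of
  \<open>f\<close> for the new weight does not exceed the old one.\<close>

lemma down_pointwise:
  fixes x v G :: real
  assumes x: "x \<ge> 0" and v: "v > 0" and G: "G > 0" and p: "0 < p" "p < p0" and q: "0 < q" "0 < q0"
    and eq: "1 / p - 1 / q = 1 / p0 - 1 / q0" and r: "r = q * K" "r0 = q0 * K"
    and le: "x powr p * v powr (p / q) \<le> G powr r * v"
  shows "x powr p0 * (G powr (r - r0) * v) powr (p0 / q0) \<le> x powr p * v powr (p / q)"
proof (cases "x = 0")
  case True then show ?thesis by simp
next
  case False
  \<comment> \<open>The power of \<open>le\<close> that supplies the missing factor: p a + p =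
    p0.\<close>
  define a where "a = (p0 - p) / p"
  have a: "a \<ge> 0" using p by (simp add: a_def)
  have "(x powr p * v powr (p / q)) powr a \<le> (G powr r * v) powr a"
    using le v a by (intro powr_mono2) auto
  then have "(x powr p * v powr (p / q)) powr a * (x powr p * (G powr (r - r0) * v) powr (p0 / q0))
    \<le> (G powr r * v) powr a * (x powr p * (G powr (r - r0) * v) powr (p0 / q0))"
    by (intro mult_right_mono) auto
  also have "\<dots> = x powr p * (G powr (r * a + (r - r0) * (p0 / q0)) * v powr (a + p0 / q0))"
    using v G by (simp add: powr_mult powr_powr powr_add)
  \<comment> \<open>The reason for the exponent r - r0 in the new weight: the powers of
    \<open>G\<close> cancel, as K times a multiple of the exponent relation.\<close>
  also have "r * a + (r - r0) * (p0 / q0) = 0"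
  proof -
    have "q * a + (q - q0) * (p0 / q0) = p0 * q * ((1 / p - 1 / q) - (1 / p0 - 1 / q0))"
      using p q by (simp add: a_def field_simps)
    then have "q * a + (q - q0) * (p0 / q0) = 0" using eq by simp
    moreover have "r * a + (r - r0) * (p0 / q0) = K * (q * a + (q - q0) * (p0 / q0))"
    proof -
      have "q * K * a + (q * K - q0 * K) * b = K * (q * a + (q - q0) * b)" for b
        by (simp add: algebra_simps)
      then show ?thesis unfolding r .
    qed
    ultimately show ?thesis by simp
  qed
  finally have le': "(x powr p * v powr (p / q)) powr a * (x powr p * (G powr (r - r0) * v) powr (p0 / q0))
    \<le> x powr p * v powr (a + p0 / q0)" using G by simp
  have "a + p0 / q0 = p / q + p / q * a"
  proof -
    have "a + p0 / q0 - (p / q + p / q * a) = p0 * ((1 / p - 1 / q) - (1 / p0 - 1 / q0))"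
      using p q by (simp add: a_def field_simps)
    then show ?thesis using eq by simp
  qed
  then have "(x powr p * v powr (p / q)) powr a * (x powr p * (G powr (r - r0) * v) powr (p0 / q0))
    \<le> x powr p * v powr (p / q + p / q * a)" using le' by simp
  moreover have "x powr (p * a) * x powr p = x powr p0"
  proof -
    have "p * a + p = p0" using p by (simp add: a_def)
    then show ?thesis by (simp flip: powr_add)
  qed
  moreover have "(x powr p * v powr (p / q)) powr a = x powr (p * a) * v powr (p / q * a)"
    by (simp only: powr_mult powr_powr)
  ultimately have "v powr (p / q * a) * (x powr p0 * (G powr (r - r0) * v) powr (p0 / q0)) \<le> v powr (p / q * a) * (x powr p * v powr (p / q))"
    by (simp only: powr_add mult_ac) (metis mult.assoc mult.commute)
  then show ?thesis using v by simp
qed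

context homogeneous_space
begin

text \<open>The weak type hypothesis for the pair \<open>f\<close>, \<open>g = T f\<close>, expressed through \<open>u = W\<^sup>q\<^sup>0\<close>.\<close>

definition weak_bound where
  "weak_bound p0 q0 \<alpha> D f g \<longleftrightarrow> (\<forall>u A P t. u \<in> borel_measurable \<mu> \<longrightarrow> (\<forall>x. u x > 0) \<longrightarrow>
     in_Apq \<rho> \<mu> p0 q0 (\<lambda>x. u x powr (1 / q0)) \<longrightarrow> Apq_const \<rho> \<mu> p0 q0 (\<lambda>x. u x powr (1 / q0)) \<le> A \<longrightarrow>
     P > 0 \<longrightarrow> (\<integral>\<^sup>+x. ennreal (\<bar>f x\<bar> powr p0 * u x powr (p0 / q0)) \<partial>\<mu>) \<le> ennreal P \<longrightarrow> t > 0 \<longrightarrow>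
     (\<integral>\<^sup>+x. indicator {y. \<bar>g y\<bar> > t} x * ennreal (u x) \<partial>\<mu>) \<le> ennreal ((D * A powr \<alpha> * P powr (1 / p0) / t) powr q0))"

text \<open>Needed for monotonicity of the power \<alpha>. For p = 1 a nonnegative admissible
  constant has to be exhibited, since the infimum of an empty set carries no information.\<close>

lemma Apq_const_nonneg:
  assumes w: "in_Apq \<rho> \<mu> p q w" shows "Apq_const \<rho> \<mu> p q w \<ge> 0"
proof (cases "p = 1")
  case True
  obtain C where C: "AE x in \<mu>. maximal \<rho> \<mu> (\<lambda>y. w y powr q) x \<le> ennreal (C * w x powr q)"
    using w True by (auto simp: in_Apq_def)
  have "AE x in \<mu>. maximal \<rho> \<mu> (\<lambda>y. w y powr q) x \<le> ennreal (max C 0 * w x powr q)"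
    using C by (rule AE_mp) (auto elim!: order_trans intro!: AE_I2 ennreal_leI mult_right_mono)
  then have "max C 0 \<in> {C. C \<ge> 0 \<and> (AE x in \<mu>. maximal \<rho> \<mu> (\<lambda>y. w y powr q) x \<le> ennreal (C * w x powr q))}"
    by simp
  then have "Inf {C. C \<ge> 0 \<and> (AE x in \<mu>. maximal \<rho> \<mu> (\<lambda>y. w y powr q) x \<le> ennreal (C * w x powr q))} \<ge> 0"
    by (intro cInf_greatest; blast)
  then show ?thesis unfolding Apq_const_def using True by simp
next
  case False
  have "0 \<le> Apq_ball \<rho> \<mu> p q w undefined 1" by (simp add: Apq_ball_def)
  also have "\<dots> \<le> Sup {Apq_ball \<rho> \<mu> p q w x r | x r. r > 0}"
    using w False zero_less_one by (intro cSup_upper) (auto simp: in_Apq_def simp del: zero_less_one)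
  finally show ?thesis using False by (simp add: Apq_const_def)
qed

text \<open>The given \<open>C\<close> may have any sign; \<bar>C\<bar> + 1 replaces it by a
  strictly positive constant.\<close>

lemma weak_boundI:
  assumes hyp: "\<And>w. in_Apq \<rho> \<mu> p0 q0 w \<Longrightarrow> weak_norm \<mu> (\<lambda>x. w x powr q0) q0 g
      \<le> ennreal (C * Apq_const \<rho> \<mu> p0 q0 w powr \<alpha>) * Lp_norm \<mu> (\<lambda>x. w x powr p0) p0 f"
    and p0: "p0 > 0" and q0: "q0 > 0" and \<alpha>: "\<alpha> > 0"
  shows "weak_bound p0 q0 \<alpha> (\<bar>C\<bar> + 1) f g"
  unfolding weak_bound_def
proof (intro allI impI)
  fix u A P t
  assume u_pos: "\<forall>x. u x > (0 :: real)" and inA: "in_Apq \<rho> \<mu> p0 q0 (\<lambda>x. u x powr (1 / q0))"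
    and A: "Apq_const \<rho> \<mu> p0 q0 (\<lambda>x. u x powr (1 / q0)) \<le> A" and P: "P > (0 :: real)"
    and int: "(\<integral>\<^sup>+x. ennreal (\<bar>f x\<bar> powr p0 * u x powr (p0 / q0)) \<partial>\<mu>) \<le> ennreal P" and t: "t > (0 :: real)"
  have W: "(\<lambda>x. (u x powr (1 / q0)) powr q0) = u" "(\<lambda>x. (u x powr (1 / q0)) powr p0) = (\<lambda>x. u x powr (p0 / q0))"
    using u_pos q0 by (auto simp: powr_powr less_imp_le)
  let ?X = "Apq_const \<rho> \<mu> p0 q0 (\<lambda>x. u x powr (1 / q0))"
  have X: "?X \<ge> 0" by (rule Apq_const_nonneg[OF inA])
  have "weak_norm \<mu> u q0 g \<le> ennreal (C * ?X powr \<alpha>) * Lp_norm \<mu> (\<lambda>x. u x powr (p0 / q0)) p0 f"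
    using hyp[OF inA] by (simp only: W)
  also have "\<dots> \<le> ennreal ((\<bar>C\<bar> + 1) * A powr \<alpha>) * ennreal (P powr (1 / p0))"
  proof (rule mult_mono)
    show "ennreal (C * ?X powr \<alpha>) \<le> ennreal ((\<bar>C\<bar> + 1) * A powr \<alpha>)"
      using X A \<alpha> by (intro ennreal_leI mult_mono powr_mono2) auto
    have "Lp_norm \<mu> (\<lambda>x. u x powr (p0 / q0)) p0 f \<le> enn_powr (ennreal P) (1 / p0)"
      unfolding Lp_norm_def using p0 int by (intro enn_powr_mono) auto
    then show "Lp_norm \<mu> (\<lambda>x. u x powr (p0 / q0)) p0 f \<le> ennreal (P powr (1 / p0))" using P by simp
  qed auto
  also have "\<dots> = ennreal ((\<bar>C\<bar> + 1) * A powr \<alpha> * P powr (1 / p0))"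
    by (simp add: ennreal_mult)
  finally show "(\<integral>\<^sup>+x. indicator {y. \<bar>g y\<bar> > t} x * ennreal (u x) \<partial>\<mu>) \<le>
      ennreal (((\<bar>C\<bar> + 1) * A powr \<alpha> * P powr (1 / p0) / t) powr q0)"
    using t by (subst (asm) weak_norm_le_iff) (auto simp: q0)
qed

lemma Ar_weight_integrable_ball:
  assumes "Ar_weight v r A" "s > 0"
  shows "(\<integral>\<^sup>+x\<in>qball \<rho> y s. ennreal (v x) \<partial>\<mu>) < \<infinity>"
proof -
  obtain V where "avg \<mu> (qball \<rho> y s) v \<le> ennreal V"
    using assms unfolding Ar_weight_def by blast
  then have "avg \<mu> (qball \<rho> y s) v < \<infinity>" by (rule le_less_trans) simp
  moreover have "v x \<ge> 0" for x using assms(1) by (simp add: Ar_weight_def less_imp_le)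
  ultimately show ?thesis
    using emeasure_qball_finite[of y s]
    by (subst set_nn_integral_eq_avg[OF assms(2)]) (auto simp: ennreal_mult_less_top)
qed

section \<open>Extrapolation to smaller, larger and equal exponents\<close>

text \<open>The \<open>v\<close>-mass of the level set is split by Hoelder's inequality into its
  \<open>u\<close>-mass, controlled by the hypothesis, and the norm of the majorant \<open>G\<close>
  in L^r(v), controlled by that of \<open>f\<close>.\<close>

lemma extrapolate_down:
  assumes p: "1 < p" "1 < p0" and q: "0 < q" "q < q0" and eq: "1 / p - 1 / q = 1 / p0 - 1 / q0"
    and K: "K = 1 - 1 / p + 1 / q" and r: "r = q * K" "r0 = q0 * K" and \<alpha>: "\<alpha> > 0"
  obtains c where "c > 0"
    "\<And>D v A f g F t. Ar_weight v r A \<Longrightarrow> f \<in> borel_measurable \<mu> \<Longrightarrow> g \<in> borel_measurable \<mu> \<Longrightarrow> D > 0 \<Longrightarrow>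
      (\<integral>\<^sup>+x. ennreal (\<bar>f x\<bar> powr p * v x powr (p / q)) \<partial>\<mu>) < ennreal F \<Longrightarrow> weak_bound p0 q0 \<alpha> D f g \<Longrightarrow> t > 0 \<Longrightarrow>
      (\<integral>\<^sup>+x. indicator {y. \<bar>g y\<bar> > t} x * ennreal (v x) \<partial>\<mu>)
        \<le> ennreal ((D * c * A powr (\<alpha> * ((r0 - 1) / (r - 1))) * F powr (1 / p) / t) powr q)"
proof -
  have p_less: "p < p0"
  proof -
    have "1 / q0 < 1 / q" using q by (simp add: field_simps)
    then have "1 / p0 < 1 / p" using eq by linarith
    then show ?thesis using p by (simp add: field_simps)
  qed
  have r1: "r = 1 + q / (p / (p - 1))" using p q by (simp add: r K field_simps)
  have r01: "r0 = 1 + q0 / (p0 / (p0 - 1))"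
  proof -
    have "K = 1 - 1 / p0 + 1 / q0" using K eq by simp
    then show ?thesis using p q by (simp add: r field_simps)
  qed
  have rr: "1 < r" "r < r0"
  proof -
    show "1 < r" using p q by (simp add: r1)
    then have "K > 0" using q by (auto simp: r zero_less_mult_iff dest: less_trans[OF zero_less_one])
    then show "r < r0" using q by (simp add: r)
  qed
  obtain c1 where c1: "c1 > 0" and maj: "\<And>v A h H. Ar_weight v r A \<Longrightarrow> h \<in> borel_measurable \<mu> \<Longrightarrow> (\<And>x. h x \<ge> 0) \<Longrightarrow>
      0 < (\<integral>\<^sup>+x. ennreal (h x powr r * v x) \<partial>\<mu>) \<Longrightarrow> (\<integral>\<^sup>+x. ennreal (h x powr r * v x) \<partial>\<mu>) \<le> ennreal H \<Longrightarrow>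
      \<exists>G. A1_majorant G (c1 * A powr (1 / (r - 1))) \<and> (AE x in \<mu>. h x \<le> G x) \<and>
        (\<integral>\<^sup>+x. ennreal (G x powr r * v x) \<partial>\<mu>) \<le> ennreal (2 powr (r + 1) * H)"
    using A1_majorant_exists[OF rr(1)] by blast
  \<comment> \<open>Equal to 1/p - 1/p0 by the exponent relation: it completes F^(1/p0) to
    F^(1/p).\<close>
  define d where "d = 1 / q - 1 / q0"
  define c where "c = c1 powr ((r0 - r) * \<alpha>) * (2 powr (r + 1)) powr d"
  show thesis
  proof (rule that[of c])
    show "c > 0" using c1 by (simp add: c_def)
    fix D v A f g F t
    assume v: "Ar_weight v r A" and [measurable]: "f \<in> borel_measurable \<mu>" "g \<in> borel_measurable \<mu>" and D: "D > (0 :: real)"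
      and F: "(\<integral>\<^sup>+x. ennreal (\<bar>f x\<bar> powr p * v x powr (p / q)) \<partial>\<mu>) < ennreal F"
      and wb: "weak_bound p0 q0 \<alpha> D f g" and t: "t > (0 :: real)"
    have [measurable]: "v \<in> borel_measurable \<mu>" and v_pos: "\<And>x. v x > 0"
      using v by (auto simp: Ar_weight_def)
    have A: "A > 0" by (rule Ar_weight_const_pos[OF v])
    obtain F0 where F0: "(\<integral>\<^sup>+x. ennreal (\<bar>f x\<bar> powr p * v x powr (p / q)) \<partial>\<mu>) = ennreal F0" "F0 \<ge> 0"
      using F by (cases "\<integral>\<^sup>+x. ennreal (\<bar>f x\<bar> powr p * v x powr (p / q)) \<partial>\<mu>") auto
    have FF: "F0 < F" "F > 0" using F F0 by (auto simp: ennreal_less_iff)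
    define B where "B = qball \<rho> undefined 1"
    have [measurable]: "B \<in> sets \<mu>" by (simp add: B_def)
    obtain V0 where V0: "(\<integral>\<^sup>+x\<in>B. ennreal (v x) \<partial>\<mu>) = ennreal V0" "V0 > 0"
      using Ar_weight_integrable_ball[OF v, of 1 undefined] set_nn_integral_pos[of v \<mu> B] v_pos emeasure_qball_pos[of 1 undefined]
      by (cases "\<integral>\<^sup>+x\<in>B. ennreal (v x) \<partial>\<mu>") (auto simp: B_def)
    \<comment> \<open>The slack F - F0 is spent on a multiple of \<open>v\<close> over a unit ball,
      so that \<open>k\<close> has integral exactly \<open>F\<close>, positive even when
      \<open>f\<close> vanishes.\<close>
    define \<delta> where "\<delta> = (F - F0) / V0"
    have \<delta>: "\<delta> > 0" using FF V0 by (simp add: \<delta>_def)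
    define k where "k x = \<bar>f x\<bar> powr p * v x powr (p / q) + \<delta> * (v x * indicator B x)" for x
    have k_nonneg: "k x \<ge> 0" for x using \<delta> v_pos[of x] by (simp add: k_def)
    have [measurable]: "k \<in> borel_measurable \<mu>" unfolding k_def by measurable
    define h where "h x = (k x / v x) powr (1 / r)" for x
    have [measurable]: "h \<in> borel_measurable \<mu>" unfolding h_def by measurable
    have h_powr: "h x powr r * v x = k x" for x
      using rr k_nonneg[of x] v_pos[of x] by (simp add: h_def powr_powr)
    have "(\<integral>\<^sup>+x. ennreal (k x) \<partial>\<mu>) = (\<integral>\<^sup>+x. ennreal (\<bar>f x\<bar> powr p * v x powr (p / q)) + ennreal \<delta> * (ennreal (v x) * indicator B x) \<partial>\<mu>)"
    proof (rule nn_integral_cong)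
      fix x
      show "ennreal (k x) = ennreal (\<bar>f x\<bar> powr p * v x powr (p / q)) + ennreal \<delta> * (ennreal (v x) * indicator B x)"
        using \<delta> v_pos[of x] by (cases "x \<in> B") (auto simp: k_def ennreal_plus ennreal_mult less_imp_le)
    qed
    also have "\<dots> = ennreal F0 + ennreal \<delta> * ennreal V0"
      by (simp add: nn_integral_add nn_integral_cmult F0 V0)
    also have "\<dots> = ennreal F"
      using F0 V0 FF \<delta> by (simp add: \<delta>_def flip: ennreal_mult ennreal_plus)
    finally have kF: "(\<integral>\<^sup>+x. ennreal (h x powr r * v x) \<partial>\<mu>) = ennreal F" by (simp add: h_powr)
    have "\<exists>G. A1_majorant G (c1 * A powr (1 / (r - 1))) \<and> (AE x in \<mu>. h x \<le> G x) \<and>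
        (\<integral>\<^sup>+x. ennreal (G x powr r * v x) \<partial>\<mu>) \<le> ennreal (2 powr (r + 1) * F)"
      by (rule maj[OF v]) (use FF in \<open>simp_all add: kF, simp add: h_def\<close>)
    then obtain G where G: "A1_majorant G (c1 * A powr (1 / (r - 1)))" and hG: "AE x in \<mu>. h x \<le> G x"
      and G_norm: "(\<integral>\<^sup>+x. ennreal (G x powr r * v x) \<partial>\<mu>) \<le> ennreal (2 powr (r + 1) * F)"
      by blast
    have [measurable]: "G \<in> borel_measurable \<mu>" and G_pos: "\<And>x. G x > 0"
      using G by (auto simp: A1_majorant_def)
    define u where "u x = G x powr (r - r0) * v x" for x
    define A' where "A' = (c1 * A powr (1 / (r - 1))) powr (r0 - r) * A"
    have uA: "Ar_weight u r0 A'"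
      unfolding u_def A'_def using c1 A by (intro Ar_weight_mult_A1_down[OF v G _ rr]) auto
    have u_meas [measurable]: "u \<in> borel_measurable \<mu>" and u_pos: "\<And>x. u x > 0"
      using uA by (auto simp: Ar_weight_def)
    have int: "(\<integral>\<^sup>+x. ennreal (\<bar>f x\<bar> powr p0 * u x powr (p0 / q0)) \<partial>\<mu>) \<le> ennreal F"
    proof -
      have "(\<integral>\<^sup>+x. ennreal (\<bar>f x\<bar> powr p0 * u x powr (p0 / q0)) \<partial>\<mu>) \<le> (\<integral>\<^sup>+x. ennreal (\<bar>f x\<bar> powr p * v x powr (p / q)) \<partial>\<mu>)"
      proof (rule nn_integral_mono_AE, use hG in eventually_elim)
        case (elim x)
        have "\<bar>f x\<bar> powr p * v x powr (p / q) \<le> h x powr r * v x"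
          unfolding h_powr k_def using \<delta> v_pos[of x] by simp
        also have "\<dots> \<le> G x powr r * v x"
          using elim rr v_pos[of x] by (intro mult_right_mono powr_mono2) (auto simp: h_def)
        finally show ?case unfolding u_def
          using v_pos[of x] G_pos[of x] p p_less q r by (intro ennreal_leI down_pointwise[OF _ _ _ _ _ _ _ eq]) auto
      qed
      with F show ?thesis by simp
    qed
    define Y where "Y = D * A' powr \<alpha> * F powr (1 / p0) / t"
    have A': "A' > 0" using A c1 by (simp add: A'_def)
    have Y: "Y > 0" using D A' FF t by (simp add: Y_def)
    have uE: "(\<integral>\<^sup>+x. indicator {y. \<bar>g y\<bar> > t} x * ennreal (u x) \<partial>\<mu>) \<le> ennreal (Y powr q0)"
    proof -
      have "q0 > 0" using q by simp
      note W = in_Apq_of_Ar_weight[OF uA[unfolded r01] p(2) this]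
      show ?thesis unfolding Y_def
        by (rule wb[unfolded weak_bound_def, rule_format, OF u_meas u_pos W FF(2) int t])
    qed
    have "(\<integral>\<^sup>+x. indicator {y. \<bar>g y\<bar> > t} x * ennreal (v x) \<partial>\<mu>)
      = (\<integral>\<^sup>+x. ennreal ((indicator {y. \<bar>g y\<bar> > t} x * u x) powr (q / q0) * (G x powr r * v x) powr (1 - q / q0)) \<partial>\<mu>)"
    proof (rule nn_integral_cong)
      fix x
      \<comment> \<open>The powers of \<open>G\<close> cancel because r/r0 = q/q0, so
        \<open>v\<close> factors exactly into the two quantities to which Hoelder's inequality is
        applied.\<close>
      have "u x powr (q / q0) * (G x powr r * v x) powr (1 - q / q0)
        = G x powr ((r - r0) * (q / q0) + r * (1 - q / q0)) * v x powr (q / q0 + (1 - q / q0))"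
        by (simp only: u_def powr_mult powr_powr powr_add mult_ac)
      also have "(r - r0) * (q / q0) + r * (1 - q / q0) = 0"
        using q by (simp add: r field_simps)
      also have "q / q0 + (1 - q / q0) = 1" by simp
      finally have "u x powr (q / q0) * (G x powr r * v x) powr (1 - q / q0) = v x"
        using G_pos[of x] v_pos[of x] by simp
      then show "indicator {y. \<bar>g y\<bar> > t} x * ennreal (v x)
        = ennreal ((indicator {y. \<bar>g y\<bar> > t} x * u x) powr (q / q0) * (G x powr r * v x) powr (1 - q / q0))"
        by (simp add: indicator_def)
    qed
    also have "\<dots> \<le> ennreal ((Y powr q0) powr (q / q0) * (2 powr (r + 1) * F) powr (1 - q / q0))"
    proof (rule nn_integral_Holder_bound)
      have "(\<integral>\<^sup>+x. ennreal (indicator {y. \<bar>g y\<bar> > t} x * u x) \<partial>\<mu>) = (\<integral>\<^sup>+x. indicator {y. \<bar>g y\<bar> > t} x * ennreal (u x) \<partial>\<mu>)"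
        by (intro nn_integral_cong) (simp add: indicator_def)
      with uE show "(\<integral>\<^sup>+x. ennreal (indicator {y. \<bar>g y\<bar> > t} x * u x) \<partial>\<mu>) \<le> ennreal (Y powr q0)" by simp
    qed (use G_norm u_pos v_pos G_pos Y FF q in \<open>auto simp: less_imp_le\<close>)
    also have "(Y powr q0) powr (q / q0) * (2 powr (r + 1) * F) powr (1 - q / q0)
      = (Y * (2 powr (r + 1) * F) powr d) powr q"
    proof -
      have e: "d * q = 1 - q / q0" using q by (simp add: d_def field_simps)
      have "(Y * (2 powr (r + 1) * F) powr d) powr q = Y powr q * ((2 powr (r + 1) * F) powr d) powr q"
        by (rule powr_mult)
      also have "\<dots> = Y powr q * (2 powr (r + 1) * F) powr (1 - q / q0)" by (simp only: powr_powr e)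
      also have "Y powr q = (Y powr q0) powr (q / q0)" using q by (simp add: powr_powr)
      finally show ?thesis ..
    qed
    also have "Y * (2 powr (r + 1) * F) powr d = D * c * A powr (\<alpha> * ((r0 - 1) / (r - 1))) * F powr (1 / p) / t"
    proof -
      have e: "1 / (r - 1) * (r0 - r) + 1 = (r0 - 1) / (r - 1)" using rr by (simp add: field_simps)
      have e': "1 / p0 + d = 1 / p" using eq unfolding d_def by linarith
      have "A' = c1 powr (r0 - r) * (A powr (1 / (r - 1) * (r0 - r)) * A powr 1)"
        using c1 A by (simp add: A'_def powr_mult powr_powr)
      also have "\<dots> = c1 powr (r0 - r) * A powr ((r0 - 1) / (r - 1))"
        by (simp only: powr_add[symmetric] e)
      finally have eqA: "A' powr \<alpha> = c1 powr ((r0 - r) * \<alpha>) * A powr (\<alpha> * ((r0 - 1) / (r - 1)))"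
        by (simp only: powr_mult powr_powr mult.commute)
      have eqF: "F powr (1 / p) = F powr (1 / p0) * F powr d" by (simp only: powr_add[symmetric] e')
      show ?thesis
        by (simp only: Y_def c_def eqA eqF powr_mult times_divide_eq_left times_divide_eq_right mult_ac)
    qed
    finally show "(\<integral>\<^sup>+x. indicator {y. \<bar>g y\<bar> > t} x * ennreal (v x) \<partial>\<mu>)
        \<le> ennreal ((D * c * A powr (\<alpha> * ((r0 - 1) / (r - 1))) * F powr (1 / p) / t) powr q)" .
  qed
qed


text \<open>Duality without linearity: on the set \<open>E n\<close> the new weight exceeds
  \<open>v\<close>, so the hypothesis bounds e = v(\<open>E n\<close>) by Z e^d to the power q0, in
  which the majorant has brought back e itself. As q0 d < 1, this can be solved for e.\<close>

lemma extrapolate_up: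
  assumes p: "1 < p" "1 \<le> p0" and q: "0 < q0" "q0 < q" and eq: "1 / p - 1 / q = 1 / p0 - 1 / q0"
    and K: "K = 1 - 1 / p + 1 / q" and r: "r = q * K" "r0 = q0 * K" and \<alpha>: "\<alpha> > 0"
  obtains c where "c > 0"
    "\<And>D v A f g F t. Ar_weight v r A \<Longrightarrow> f \<in> borel_measurable \<mu> \<Longrightarrow> g \<in> borel_measurable \<mu> \<Longrightarrow> D > 0 \<Longrightarrow>
      (\<integral>\<^sup>+x. ennreal (\<bar>f x\<bar> powr p * v x powr (p / q)) \<partial>\<mu>) < ennreal F \<Longrightarrow> weak_bound p0 q0 \<alpha> D f g \<Longrightarrow> t > 0 \<Longrightarrow>
      (\<integral>\<^sup>+x. indicator {y. \<bar>g y\<bar> > t} x * ennreal (v x) \<partial>\<mu>)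
        \<le> ennreal ((D * c * A powr \<alpha> * F powr (1 / p) / t) powr q)"
proof -
  have p_less: "p0 < p"
  proof -
    have "1 / q < 1 / q0" using q by (simp add: field_simps)
    then have "1 / p < 1 / p0" using eq by linarith
    then show ?thesis using p by (simp add: field_simps)
  qed
  have r01: "r0 = 1 + q0 * (1 - 1 / p0)"
  proof -
    have "K = 1 - 1 / p0 + 1 / q0" using K eq by simp
    then show ?thesis using q by (simp add: r field_simps)
  qed
  have rr: "1 \<le> r0" "r0 < r"
  proof -
    show "1 \<le> r0" using p q by (simp add: r01)
    then have "K > 0" using q by (auto simp: r zero_less_mult_iff dest: less_le_trans[OF zero_less_one])
    then show "r0 < r" using q by (simp add: r)
  qed
  define \<theta> where "\<theta> = (r - r0) / (r - 1)"
  define s where "s = r / (r - 1)"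
  have s: "s > 1" "1 / (s - 1) = r - 1" using rr by (simp_all add: s_def field_simps)
  obtain c1 where c1: "c1 > 0" and maj: "\<And>v A h H. Ar_weight v s A \<Longrightarrow> h \<in> borel_measurable \<mu> \<Longrightarrow> (\<And>x. h x \<ge> 0) \<Longrightarrow>
      0 < (\<integral>\<^sup>+x. ennreal (h x powr s * v x) \<partial>\<mu>) \<Longrightarrow> (\<integral>\<^sup>+x. ennreal (h x powr s * v x) \<partial>\<mu>) \<le> ennreal H \<Longrightarrow>
      \<exists>G. A1_majorant G (c1 * A powr (1 / (s - 1))) \<and> (AE x in \<mu>. h x \<le> G x) \<and>
        (\<integral>\<^sup>+x. ennreal (G x powr s * v x) \<partial>\<mu>) \<le> ennreal (2 powr (s + 1) * H)"
    using A1_majorant_exists[OF s(1)] by blast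
  \<comment> \<open>Equal to 1/q0 - 1/q by the exponent relation, which is what makes the final
    cancellation leave e^(1/q).\<close>
  define d where "d = 1 / p0 - 1 / p"
  define c2 :: real where "c2 = 2 powr (s + 1)"
  define c where "c = c1 powr (\<theta> * \<alpha>) * c2 powr d"
  show thesis
  proof (rule that[of c])
    show "c > 0" using c1 by (simp add: c_def c2_def)
    fix D v A f g F t
    assume v: "Ar_weight v r A" and [measurable]: "f \<in> borel_measurable \<mu>" "g \<in> borel_measurable \<mu>" and D: "D > (0 :: real)"
      and F: "(\<integral>\<^sup>+x. ennreal (\<bar>f x\<bar> powr p * v x powr (p / q)) \<partial>\<mu>) < ennreal F"
      and wb: "weak_bound p0 q0 \<alpha> D f g" and t: "t > (0 :: real)"
    have [measurable]: "v \<in> borel_measurable \<mu>" and v_pos: "\<And>x. v x > 0"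
      using v by (auto simp: Ar_weight_def)
    have A: "A > 0" by (rule Ar_weight_const_pos[OF v])
    have F_pos: "F > 0" using F le_less_trans[OF zero_le F] by simp
    define Z where "Z = D * c * A powr \<alpha> * F powr (1 / p) / t"
    have Z: "Z > 0" using D A F_pos t \<open>c > 0\<close> by (simp add: Z_def)
    define \<sigma> where "\<sigma> x = v x powr (- 1 / (r - 1))" for x
    have \<sigma>A: "Ar_weight \<sigma> s (A powr (1 / (r - 1)))"
      unfolding \<sigma>_def s_def using rr by (intro Ar_weight_dual v) auto
    have [measurable]: "\<sigma> \<in> borel_measurable \<mu>" and \<sigma>_pos: "\<And>x. \<sigma> x > 0"
      using \<sigma>A by (auto simp: Ar_weight_def)
    define E where "E n = {y. \<bar>g y\<bar> > t} \<inter> qball \<rho> undefined (real n)" for n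
    have [measurable]: "E n \<in> sets \<mu>" for n
    proof -
      have "{y \<in> space \<mu>. \<bar>g y\<bar> > t} \<in> sets \<mu>" by measurable
      then show ?thesis unfolding E_def by (intro sets.Int) auto
    qed
    have En: "(\<integral>\<^sup>+x. indicator (E n) x * ennreal (v x) \<partial>\<mu>) \<le> ennreal (Z powr q)" for n
    proof -
      \<comment> \<open>The radius is increased by 1 so that it is positive for n = 0 too.\<close>
      have "(\<integral>\<^sup>+x. indicator (E n) x * ennreal (v x) \<partial>\<mu>) \<le> (\<integral>\<^sup>+x\<in>qball \<rho> undefined (real n + 1). ennreal (v x) \<partial>\<mu>)"
        by (intro nn_integral_mono) (auto simp: E_def indicator_def mem_qball)
      also have "\<dots> < \<infinity>" by (intro Ar_weight_integrable_ball[OF v]) simp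
      finally obtain e where e: "(\<integral>\<^sup>+x. indicator (E n) x * ennreal (v x) \<partial>\<mu>) = ennreal e" "e \<ge> 0"
        by (cases "\<integral>\<^sup>+x. indicator (E n) x * ennreal (v x) \<partial>\<mu>") auto
      show ?thesis
      proof (cases "e = 0")
        case True
        then show ?thesis using e by simp
      next
        case False
        then have e_pos: "e > 0" using e by simp
        \<comment> \<open>Since s = r', v^s times the dual weight is \<open>v\<close> again, so the
          s-th power of the norm of \<open>h\<close> is e.\<close>
        define h where "h x = v x * indicator (E n) x" for x
        have [measurable]: "h \<in> borel_measurable \<mu>" unfolding h_def by measurable
        have h\<sigma>: "(\<integral>\<^sup>+x. ennreal (h x powr s * \<sigma> x) \<partial>\<mu>) = ennreal e"
        proof -
          have "ennreal (h x powr s * \<sigma> x) = indicator (E n) x * ennreal (v x)" for x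
          proof -
            have "v x powr s * \<sigma> x = v x powr (s + - 1 / (r - 1))" unfolding \<sigma>_def by (rule powr_add[symmetric])
            also have "s + - 1 / (r - 1) = (r + - 1) / (r - 1)" unfolding s_def by (rule add_divide_distrib[symmetric])
            also have "\<dots> = 1" using rr by simp
            finally show ?thesis using v_pos[of x] by (cases "x \<in> E n") (simp_all add: h_def)
          qed
          then show ?thesis using e by simp
        qed
        have "\<exists>G. A1_majorant G (c1 * (A powr (1 / (r - 1))) powr (1 / (s - 1))) \<and> (AE x in \<mu>. h x \<le> G x) \<and>
          (\<integral>\<^sup>+x. ennreal (G x powr s * \<sigma> x) \<partial>\<mu>) \<le> ennreal (2 powr (s + 1) * e)"
          by (rule maj[OF \<sigma>A]) (use e_pos v_pos in \<open>simp_all add: h\<sigma>, simp add: h_def less_imp_le\<close>)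
        \<comment> \<open>As s - 1 = 1/(r - 1), the exponents from duality and from Buckley's bound
          undo each other: the A_1 constant of \<open>U\<close> is linear in
          \<open>A\<close>.\<close>
        moreover have "(A powr (1 / (r - 1))) powr (1 / (s - 1)) = A"
          using A rr unfolding s(2) by (simp add: powr_powr)
        ultimately obtain U where U: "A1_majorant U (c1 * A)" and hU: "AE x in \<mu>. h x \<le> U x"
          and U_norm: "(\<integral>\<^sup>+x. ennreal (U x powr s * \<sigma> x) \<partial>\<mu>) \<le> ennreal (c2 * e)"
          unfolding c2_def by auto
        have [measurable]: "U \<in> borel_measurable \<mu>" and U_pos: "\<And>x. U x > 0"
          using U by (auto simp: A1_majorant_def)
        have c1A: "c1 * A > 0" using c1 A by simp
        define u where "u x = U x powr \<theta> * v x powr (1 - \<theta>)" for x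
        have u_meas [measurable]: "u \<in> borel_measurable \<mu>" unfolding u_def by measurable
        have u_pos: "u x > 0" for x using U_pos[of x] v_pos[of x] by (simp add: u_def)
        have W: "in_Apq \<rho> \<mu> p0 q0 (\<lambda>x. u x powr (1 / q0))"
          "Apq_const \<rho> \<mu> p0 q0 (\<lambda>x. u x powr (1 / q0)) \<le> c1 powr \<theta> * A"
        proof -
          have const: "(c1 * A) powr \<theta> * A powr (1 - \<theta>) = c1 powr \<theta> * A"
          proof -
            have "A powr \<theta> * A powr (1 - \<theta>) = A" using A by (simp flip: powr_add)
            then show ?thesis by (simp add: powr_mult mult.assoc)
          qed
          have "in_Apq \<rho> \<mu> p0 q0 (\<lambda>x. u x powr (1 / q0)) \<and>
            Apq_const \<rho> \<mu> p0 q0 (\<lambda>x. u x powr (1 / q0)) \<le> c1 powr \<theta> * A"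
          proof (cases "p0 = 1")
            case True
            \<comment> \<open>At p0 = 1 also r0 = 1, so \<open>v\<close> drops out of
              \<open>u\<close> and the A_1 form of the condition applies to \<open>U\<close>
              directly.\<close>
            then have "\<theta> = 1" using rr r01 by (simp add: \<theta>_def)
            moreover from this have "u = U" using U_pos v_pos by (auto simp: u_def fun_eq_iff less_imp_le less_imp_neq[symmetric])
            ultimately show ?thesis
              using in_Apq_of_A1_majorant[OF U q(1) c1A] True c1 by simp
          next
            case False
            then have p1: "p0 > 1" and r1: "1 < r0" using p q by (auto simp: r01)
            have "Ar_weight u r0 ((c1 * A) powr \<theta> * A powr (1 - \<theta>))"
              unfolding u_def \<theta>_def by (rule Ar_weight_mult_A1_up[OF v U c1A r1 rr(2)])
            then have "Ar_weight u r0 (c1 powr \<theta> * A)" unfolding const .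
            moreover have "r0 = 1 + q0 / (p0 / (p0 - 1))" using p1 by (simp add: r01 field_simps)
            ultimately show ?thesis using in_Apq_of_Ar_weight[of u q0 p0] p1 q by simp
          qed
          then show "in_Apq \<rho> \<mu> p0 q0 (\<lambda>x. u x powr (1 / q0))"
            "Apq_const \<rho> \<mu> p0 q0 (\<lambda>x. u x powr (1 / q0)) \<le> c1 powr \<theta> * A" by auto
        qed
        \<comment> \<open>The Hoelder bound with exponents p0/p for the part containing
          \<open>f\<close> and 1 - p0/p for the majorant.\<close>
        define P where "P = F powr (p0 / p) * (c2 * e) powr (1 - p0 / p)"
        have c2e: "c2 * e > 0" using e_pos by (simp add: c2_def)
        have P: "P > 0"
        proof -
          have "F powr x > 0" "(c2 * e) powr x > 0" for x
            unfolding powr_gt_zero using F_pos less_imp_neq[OF c2e] by auto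
          then show ?thesis unfolding P_def by (intro mult_pos_pos)
        qed
        have int: "(\<integral>\<^sup>+x. ennreal (\<bar>f x\<bar> powr p0 * u x powr (p0 / q0)) \<partial>\<mu>) \<le> ennreal P"
        proof -
          have b1: "(q - q0) * (p0 / q0) = q * (1 - p0 / p)"
          proof -
            have "(q - q0) * (p0 / q0) - q * (1 - p0 / p) = p0 * q * ((1 / p - 1 / q) - (1 / p0 - 1 / q0))"
              using p p_less q by (simp add: divide_simps) (simp add: algebra_simps)
            then show ?thesis using eq by simp
          qed
          have b2: "K * p0 - p0 / q0 = K * p0 - p0 / q - (1 - p0 / p)"
          proof -
            have "p0 / q + (1 - p0 / p) - p0 / q0 = p0 * ((1 / p0 - 1 / q0) - (1 / p - 1 / q))"
              using p p_less q by (simp add: divide_simps) (simp add: algebra_simps)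
            then show ?thesis using eq by simp
          qed
          \<comment> \<open>\<open>e1\<close> and \<open>e2\<close> match the exponents of
            \<open>U\<close> and \<open>v\<close> on the two sides of the Hoelder splitting; they
            reduce to \<open>b1\<close> and \<open>b2\<close>, consequences of the exponent
            relation.\<close>
          have e1: "\<theta> * (p0 / q0) = s * (1 - p0 / p)"
          proof -
            have "(q * K - q0 * K) * b = K * ((q - q0) * b)" for b by (simp add: algebra_simps)
            then have "(r - r0) * (p0 / q0) = K * ((q - q0) * (p0 / q0))" unfolding r .
            also have "\<dots> = r * (1 - p0 / p)" unfolding b1 by (simp add: r)
            finally show ?thesis unfolding \<theta>_def s_def times_divide_eq_left by (rule arg_cong)
          qed
          have e2: "(1 - \<theta>) * (p0 / q0) = p / q * (p0 / p) + - 1 / (r - 1) * (1 - p0 / p)"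
          proof -
            have "(r0 - 1) * (p0 / q0) = K * p0 - p0 / q0" using q by (simp add: r field_simps)
            also have "\<dots> = (r - 1) * (p0 / q) - (1 - p0 / p)" unfolding b2 using q by (simp add: r field_simps)
            finally have "(r0 - 1) * (p0 / q0) / (r - 1) = ((r - 1) * (p0 / q) - (1 - p0 / p)) / (r - 1)" by simp
            also have "\<dots> = p0 / q - (1 - p0 / p) / (r - 1)" using rr by (simp add: diff_divide_distrib)
            finally have "(r0 - 1) / (r - 1) * (p0 / q0) = p0 / q - (1 - p0 / p) / (r - 1)"
              unfolding times_divide_eq_left .
            moreover have "1 - \<theta> = (r0 - 1) / (r - 1)" using rr by (simp add: \<theta>_def field_simps)
            ultimately show ?thesis using p by simp
          qed
          have "\<bar>f x\<bar> powr p0 * u x powr (p0 / q0) =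
            (\<bar>f x\<bar> powr p * v x powr (p / q)) powr (p0 / p) * (U x powr s * \<sigma> x) powr (1 - p0 / p)" for x
          proof -
            have "u x powr (p0 / q0) = U x powr (s * (1 - p0 / p)) * (v x powr (p / q * (p0 / p)) * v x powr (- 1 / (r - 1) * (1 - p0 / p)))"
              unfolding u_def powr_mult powr_powr e1 e2 powr_add ..
            moreover have "p * (p0 / p) = p0" using p by simp
            ultimately show ?thesis unfolding \<sigma>_def powr_mult powr_powr by (simp only: mult_ac)
          qed
          then have "(\<integral>\<^sup>+x. ennreal (\<bar>f x\<bar> powr p0 * u x powr (p0 / q0)) \<partial>\<mu>) =
            (\<integral>\<^sup>+x. ennreal ((\<bar>f x\<bar> powr p * v x powr (p / q)) powr (p0 / p) * (U x powr s * \<sigma> x) powr (1 - p0 / p)) \<partial>\<mu>)"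
            by simp
          also have "\<dots> \<le> ennreal P" unfolding P_def
            by (rule nn_integral_Holder_bound)
              (use F F_pos U_norm c2e p p_less \<sigma>_pos in \<open>auto simp: less_imp_le\<close>)
          finally show ?thesis .
        qed
        have Y: "D * (c1 powr \<theta> * A) powr \<alpha> * P powr (1 / p0) / t = Z * e powr d"
        proof -
          have "(1 - p0 / p) * (1 / p0) = d" "p0 / p * (1 / p0) = 1 / p" using p by (simp_all add: d_def field_simps)
          then have "P powr (1 / p0) = F powr (1 / p) * (c2 powr d * e powr d)"
            by (simp only: P_def powr_mult powr_powr)
          then show ?thesis
            by (simp only: Z_def c_def powr_mult powr_powr times_divide_eq_left times_divide_eq_right mult_ac)
        qed
        have "ennreal e \<le> (\<integral>\<^sup>+x. indicator {y. \<bar>g y\<bar> > t} x * ennreal (u x) \<partial>\<mu>)"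
          unfolding e(1)[symmetric]
        proof (rule nn_integral_mono_AE, use hU in eventually_elim)
          case (elim x)
          show ?case
          proof (cases "x \<in> E n")
            case True
            then have "v x \<le> U x" using elim by (simp add: h_def)
            \<comment> \<open>Since U \<ge> v on \<open>E n\<close>, replacing the factor v^theta by
              U^theta can only increase the weight there.\<close>
            have "v x = v x powr \<theta> * v x powr (1 - \<theta>)" using v_pos[of x] by (simp flip: powr_add)
            also have "\<dots> \<le> u x"
              unfolding u_def using \<open>v x \<le> U x\<close> v_pos[of x] rr
              by (intro mult_right_mono powr_mono2) (auto simp: \<theta>_def)
            finally show ?thesis using True by (auto simp: E_def intro: ennreal_leI)
          qed simp
        qed
        also have "\<dots> \<le> ennreal ((Z * e powr d) powr q0)"
          using wb[unfolded weak_bound_def, rule_format, OF u_meas u_pos W P int t] unfolding Y .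
        \<comment> \<open>After the q0-th root, 1/q0 = 1/q + d lets e^d be cancelled, which is
          legitimate because e is finite and positive.\<close>
        finally have "e \<le> (Z * e powr d) powr q0" by (simp add: ennreal_le_iff)
        then have "e powr (1 / q0) \<le> ((Z * e powr d) powr q0) powr (1 / q0)"
          using e_pos q by (intro powr_mono2) auto
        also have "\<dots> = Z * e powr d" using q Z by (simp add: powr_powr)
        also have "1 / q0 = 1 / q + d" using eq unfolding d_def by linarith
        finally have "e powr (1 / q) \<le> Z" using e_pos by (simp add: powr_add)
        then have "(e powr (1 / q)) powr q \<le> Z powr q" using q by (intro powr_mono2) auto
        then have "e \<le> Z powr q" using e_pos q by (simp add: powr_powr)
        then show ?thesis unfolding e(1) by (rule ennreal_leI)
      qed
    qed
    have "(\<integral>\<^sup>+x. indicator {y. \<bar>g y\<bar> > t} x * ennreal (v x) \<partial>\<mu>) = (\<integral>\<^sup>+x. (SUP n. indicator (E n) x * ennreal (v x)) \<partial>\<mu>)"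
    proof (rule nn_integral_cong)
      fix x
      obtain n where n: "x \<in> qball \<rho> undefined (real n)" using UN_qball by blast
      show "indicator {y. \<bar>g y\<bar> > t} x * ennreal (v x) = (SUP n. indicator (E n) x * ennreal (v x))"
      proof (rule antisym)
        show "indicator {y. \<bar>g y\<bar> > t} x * ennreal (v x) \<le> (SUP n. indicator (E n) x * ennreal (v x))"
          using n by (intro SUP_upper2[of n]) (auto simp: E_def indicator_def)
        show "(SUP n. indicator (E n) x * ennreal (v x)) \<le> indicator {y. \<bar>g y\<bar> > t} x * ennreal (v x)"
          by (intro SUP_least) (auto simp: E_def indicator_def)
      qed
    qed
    also have "\<dots> = (SUP n. \<integral>\<^sup>+x. indicator (E n) x * ennreal (v x) \<partial>\<mu>)"
    proof (rule nn_integral_monotone_convergence_SUP)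
      show "incseq (\<lambda>n x. indicator (E n) x * ennreal (v x))"
        by (auto simp: incseq_def le_fun_def E_def indicator_def mem_qball)
    qed measurable
    also have "\<dots> \<le> ennreal (Z powr q)" by (rule SUP_least) (rule En)
    finally show "(\<integral>\<^sup>+x. indicator {y. \<bar>g y\<bar> > t} x * ennreal (v x) \<partial>\<mu>)
        \<le> ennreal ((D * c * A powr \<alpha> * F powr (1 / p) / t) powr q)" unfolding Z_def .
  qed
qed


text \<open>The weight itself is admissible in the hypothesis. The factor 1 gives the bound the
  shape of the other two cases, with c = 1.\<close>

lemma extrapolate_same:
  assumes p: "1 < p" and q: "0 < q" and r: "r = 1 + q / (p / (p - 1))"
    and v: "Ar_weight v r A" and D: "D > 0"
    and F: "(\<integral>\<^sup>+x. ennreal (\<bar>f x\<bar> powr p * v x powr (p / q)) \<partial>\<mu>) < ennreal F"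
    and wb: "weak_bound p q \<alpha> D f g" and t: "t > 0"
  shows "(\<integral>\<^sup>+x. indicator {y. \<bar>g y\<bar> > t} x * ennreal (v x) \<partial>\<mu>)
    \<le> ennreal ((D * 1 * A powr \<alpha> * F powr (1 / p) / t) powr q)"
proof -
  have v_meas: "v \<in> borel_measurable \<mu>" and v_pos: "\<And>x. v x > 0"
    using v by (auto simp: Ar_weight_def)
  have "F > 0" using le_less_trans[OF zero_le F] by simp
  with wb[unfolded weak_bound_def, rule_format, OF v_meas v_pos in_Apq_of_Ar_weight[OF v[unfolded r] p q] _ less_imp_le[OF F] t]
  show ?thesis by simp
qed

text \<open>The maximum in the exponent is the case distinction: its second entry is (r0 - 1)/(r -
  1), which is at least 1 exactly when q \<le> q0.\<close>

lemma extrapolate: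
  assumes p0: "1 \<le> p0" "p0 \<le> q0" and p: "1 < p" "p \<le> q" and eq: "1 / p - 1 / q = 1 / p0 - 1 / q0" and \<alpha>: "\<alpha> > 0"
  defines "\<gamma> \<equiv> \<alpha> * max 1 (q0 * (1 - 1 / p0) * (p / ((p - 1) * q)))"
  obtains c where "c > 0"
    "\<And>D v A f g F t. Ar_weight v (1 + q / (p / (p - 1))) A \<Longrightarrow> f \<in> borel_measurable \<mu> \<Longrightarrow> g \<in> borel_measurable \<mu> \<Longrightarrow> D > 0 \<Longrightarrow>
      (\<integral>\<^sup>+x. ennreal (\<bar>f x\<bar> powr p * v x powr (p / q)) \<partial>\<mu>) < ennreal F \<Longrightarrow> weak_bound p0 q0 \<alpha> D f g \<Longrightarrow> t > 0 \<Longrightarrow>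
      (\<integral>\<^sup>+x. indicator {y. \<bar>g y\<bar> > t} x * ennreal (v x) \<partial>\<mu>)
        \<le> ennreal ((D * c * A powr \<gamma> * F powr (1 / p) / t) powr q)"
proof -
  have q: "q > 0" "q0 > 0" using p p0 by auto
  define K where "K = 1 - 1 / p + 1 / q"
  have K': "K = 1 - 1 / p0 + 1 / q0" using eq by (simp add: K_def)
  have K: "K > 0" using p q by (simp add: K_def add_pos_pos)
  have r: "1 + q / (p / (p - 1)) = q * K" using p q by (simp add: K_def field_simps)
  have r_gt: "q * K > 1" using p q by (simp flip: r)
  have "q0 * K - 1 = q0 * (1 - 1 / p0)" using q by (simp add: K' field_simps)
  moreover have "(p - 1) * q / p = q * K - 1" using p by (simp flip: r)
  \<comment> \<open>Uses r0 - 1 = q0/p0' and r - 1 = q/p', where r0 = q0 K and r = q K.\<close>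
  ultimately have ratio: "q0 * (1 - 1 / p0) * (p / ((p - 1) * q)) = (q0 * K - 1) / (q * K - 1)"
    by (metis divide_divide_eq_right times_divide_eq_right)
  consider "q < q0" | "q = q0" | "q0 < q" by linarith
  then show thesis
  proof cases
    case 1
    have "p < p0"
    proof -
      have "1 / q0 < 1 / q" using 1 q by (simp add: field_simps)
      then have "1 / p0 < 1 / p" using eq by linarith
      then show ?thesis using p p0 by (simp add: field_simps)
    qed
    then have "1 < p0" using p by simp
    have "q * K \<le> q0 * K" using 1 K by simp
    then have \<gamma>: "\<gamma> = \<alpha> * ((q0 * K - 1) / (q * K - 1))"
      using r_gt unfolding \<gamma>_def ratio by (simp add: max_def)
    show ?thesis
    proof (rule extrapolate_down[OF p(1) \<open>1 < p0\<close> q(1) 1 eq K_def refl refl \<alpha>], goal_cases)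
      case (1 c)
      show ?case by (rule that[unfolded \<gamma> r, OF 1])
    qed
  next
    case 2
    then have [simp]: "p0 = p" using eq by (simp add: field_simps)
    have \<gamma>: "\<gamma> = \<alpha>" unfolding \<gamma>_def ratio using 2 by simp
    show ?thesis
    proof (rule that[of 1], goal_cases)
      case (2 D v A f g F t)
      then have "weak_bound p q \<alpha> D f g" using \<open>q = q0\<close> by simp
      then show ?case unfolding \<gamma> by (rule extrapolate_same[OF p(1) q(1) refl 2(1,4,5) _ 2(7)])
    qed simp
  next
    case 3
    have "q0 * K \<le> q * K" using 3 K by simp
    then have \<gamma>: "\<gamma> = \<alpha>"
      using r_gt unfolding \<gamma>_def ratio by (simp add: max_def)
    show ?thesis
    proof (rule extrapolate_up[OF p(1) p0(1) q(2) 3 eq K_def refl refl \<alpha>], goal_cases)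
      case (1 c)
      show ?case by (rule that[unfolded \<gamma> r, OF 1])
    qed
  qed
qed

section \<open>Reduction to positive weights and proof of the theorem\<close>

text \<open>A weight may vanish on a null set; putting 1 there changes no average, and for p
  different from 1 the class and its constant are defined by averages alone.\<close>

lemma positive_weight_version:
  assumes w: "in_Apq \<rho> \<mu> p q w" and p: "p \<noteq> 1"
  obtains w' where "in_Apq \<rho> \<mu> p q w'" "Apq_const \<rho> \<mu> p q w' = Apq_const \<rho> \<mu> p q w"
    "\<And>x. w' x > 0" "AE x in \<mu>. w' x = w x"
proof -
  define w' where "w' x = (if w x > 0 then w x else 1)" for x
  have [measurable]: "w \<in> borel_measurable \<mu>" and AE: "AE x in \<mu>. w' x = w x"
    using w by (auto simp: in_Apq_def is_weight_def w'_def elim!: AE_mp)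
  have avg_eq: "avg \<mu> B (\<lambda>y. w' y powr t) = avg \<mu> B (\<lambda>y. w y powr t)" for B t
    unfolding avg_def
    by (rule arg_cong[of _ _ "\<lambda>i. i / emeasure \<mu> B"], rule nn_integral_cong_AE) (use AE in \<open>auto elim: AE_mp\<close>)
  have "is_weight \<mu> w'" unfolding is_weight_def w'_def by auto
  then have "in_Apq \<rho> \<mu> p q w'" "Apq_const \<rho> \<mu> p q w' = Apq_const \<rho> \<mu> p q w"
    using w p by (simp_all add: in_Apq_def Apq_const_def Apq_ball_def avg_eq)
  then show thesis using AE by (intro that[of w']) (auto simp: w'_def)
qed

end

text \<open>In the exponent, 1 - 1/p0 stands for 1/p0', which covers p0 = 1 as the value 0
  prescribed by the convention for the dual exponent; p/(p - 1) is p'.\<close>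

theorem theorem6p1:
  fixes \<rho> :: "'a \<Rightarrow> 'a \<Rightarrow> real" and \<mu> :: "'a measure"
    and A0 C\<mu> p0 q0 \<alpha> C p q :: real
  assumes "homogeneous_type \<rho> \<mu> A0 C\<mu>"
    and "1 \<le> p0" and "p0 \<le> q0" and "\<alpha> > 0"
    and "1 < p" and "p \<le> q"
    and "1 / p - 1 / q = 1 / p0 - 1 / q0"
  shows "\<exists>C'>0. \<forall>T :: ('a \<Rightarrow> real) \<Rightarrow> 'a \<Rightarrow> real.
     (\<forall>f. bdd_bdd_supp \<rho> \<mu> f \<longrightarrow> T f \<in> borel_measurable \<mu>) \<and>
     (\<forall>w f. in_Apq \<rho> \<mu> p0 q0 w \<and> bdd_bdd_supp \<rho> \<mu> f \<longrightarrow>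
        weak_norm \<mu> (\<lambda>x. w x powr q0) q0 (T f)
          \<le> ennreal (C * Apq_const \<rho> \<mu> p0 q0 w powr \<alpha>) * Lp_norm \<mu> (\<lambda>x. w x powr p0) p0 f)
     \<longrightarrow>
     (\<forall>w f. in_Apq \<rho> \<mu> p q w \<and> bdd_bdd_supp \<rho> \<mu> f \<longrightarrow>
        weak_norm \<mu> (\<lambda>x. w x powr q) q (T f)
          \<le> ennreal (C' * Apq_const \<rho> \<mu> p q w powr
                (\<alpha> * max 1 (q0 * (1 - 1 / p0) * (p / ((p - 1) * q)))))
            * Lp_norm \<mu> (\<lambda>x. w x powr p) p f)"
proof -
  interpret homogeneous_space \<rho> \<mu> A0 C\<mu> by standard fact
  have q: "q > 0" "q0 > 0" "p0 > 0" using assms by auto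
  define \<gamma> where "\<gamma> = \<alpha> * max 1 (q0 * (1 - 1 / p0) * (p / ((p - 1) * q)))"
  obtain c where c: "c > 0" and main: "\<And>D v A f g F t. Ar_weight v (1 + q / (p / (p - 1))) A \<Longrightarrow>
      f \<in> borel_measurable \<mu> \<Longrightarrow> g \<in> borel_measurable \<mu> \<Longrightarrow> D > 0 \<Longrightarrow>
      (\<integral>\<^sup>+x. ennreal (\<bar>f x\<bar> powr p * v x powr (p / q)) \<partial>\<mu>) < ennreal F \<Longrightarrow> weak_bound p0 q0 \<alpha> D f g \<Longrightarrow> t > 0 \<Longrightarrow>
      (\<integral>\<^sup>+x. indicator {y. \<bar>g y\<bar> > t} x * ennreal (v x) \<partial>\<mu>)
        \<le> ennreal ((D * c * A powr \<gamma> * F powr (1 / p) / t) powr q)"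
    using extrapolate[OF assms(2,3,5,6,7,4)] unfolding \<gamma>_def by blast
  define D where "D = \<bar>C\<bar> + 1"
  have D: "D > 0" by (simp add: D_def)
  show ?thesis
    unfolding \<gamma>_def[symmetric]
  proof (intro exI[of _ "D * c"] conjI allI impI; (elim conjE)?)
    show "D * c > 0" using D c by simp
    fix T :: "('a \<Rightarrow> real) \<Rightarrow> 'a \<Rightarrow> real" and w f
    assume T: "\<forall>f. bdd_bdd_supp \<rho> \<mu> f \<longrightarrow> T f \<in> borel_measurable \<mu>"
      and hyp: "\<forall>w f. in_Apq \<rho> \<mu> p0 q0 w \<and> bdd_bdd_supp \<rho> \<mu> f \<longrightarrow>
        weak_norm \<mu> (\<lambda>x. w x powr q0) q0 (T f)
          \<le> ennreal (C * Apq_const \<rho> \<mu> p0 q0 w powr \<alpha>) * Lp_norm \<mu> (\<lambda>x. w x powr p0) p0 f"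
      and w: "in_Apq \<rho> \<mu> p q w" and f: "bdd_bdd_supp \<rho> \<mu> f"
    have f_meas: "f \<in> borel_measurable \<mu>" and Tf: "T f \<in> borel_measurable \<mu>"
      using f T by (auto simp: bdd_bdd_supp_def)
    have wb: "weak_bound p0 q0 \<alpha> D f (T f)"
      unfolding D_def using hyp f assms q by (intro weak_boundI) auto
    have "p \<noteq> 1" using assms by simp
    then obtain w' where w': "in_Apq \<rho> \<mu> p q w'" "Apq_const \<rho> \<mu> p q w' = Apq_const \<rho> \<mu> p q w"
      and w'_pos: "\<And>x. w' x > 0" and w'_eq: "AE x in \<mu>. w' x = w x"
      using positive_weight_version[OF w] by blast
    define v where "v x = w' x powr q" for x
    define A where "A = Apq_const \<rho> \<mu> p q w"
    have v: "Ar_weight v (1 + q / (p / (p - 1))) A"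
      unfolding v_def A_def w'(2)[symmetric] using assms q w'_pos by (intro Ar_weight_of_in_Apq w') auto
    have A: "A > 0" by (rule Ar_weight_const_pos[OF v])
    define I where "I = (\<integral>\<^sup>+x. ennreal (\<bar>f x\<bar> powr p * w x powr p) \<partial>\<mu>)"
    have I_eq: "(\<integral>\<^sup>+x. ennreal (\<bar>f x\<bar> powr p * v x powr (p / q)) \<partial>\<mu>) = I"
      unfolding I_def using w'_eq
      by (intro nn_integral_cong_AE) (auto simp: v_def powr_powr q less_imp_neq[OF q(1), symmetric] elim!: AE_mp)
    text \<open>The construction needs a bound exceeding the norm of \<open>f\<close> strictly, which also covers \<open>f = 0\<close>;
      the bound is then lowered to the norm by continuity.\<close>
    have weak: "weak_norm \<mu> (\<lambda>x. w x powr q) q (T f) \<le> ennreal (D * c * A powr \<gamma> * F powr (1 / p))" if F: "I < ennreal F" for F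
    proof -
      have "(\<integral>\<^sup>+x. indicator {y. \<bar>T f y\<bar> > t} x * ennreal (w x powr q) \<partial>\<mu>)
        \<le> ennreal ((D * c * A powr \<gamma> * F powr (1 / p) / t) powr q)" if t: "t > 0" for t
      proof -
        have "(\<integral>\<^sup>+x. indicator {y. \<bar>T f y\<bar> > t} x * ennreal (w x powr q) \<partial>\<mu>)
          = (\<integral>\<^sup>+x. indicator {y. \<bar>T f y\<bar> > t} x * ennreal (v x) \<partial>\<mu>)"
          using w'_eq by (intro nn_integral_cong_AE) (auto simp: v_def elim!: AE_mp)
        also have "\<dots> \<le> ennreal ((D * c * A powr \<gamma> * F powr (1 / p) / t) powr q)"
          by (rule main[OF v f_meas Tf D _ wb t]) (simp add: I_eq F)
        finally show ?thesis .
      qed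
      then show ?thesis using D c by (subst weak_norm_le_iff) (auto simp: q)
    qed
    have Lp: "Lp_norm \<mu> (\<lambda>x. w x powr p) p f = enn_powr I (1 / p)" by (simp add: Lp_norm_def I_def)
    show "weak_norm \<mu> (\<lambda>x. w x powr q) q (T f) \<le> ennreal (D * c * Apq_const \<rho> \<mu> p q w powr \<gamma>) * Lp_norm \<mu> (\<lambda>x. w x powr p) p f"
    proof (cases I)
      case top
      define X where "X = D * c * A powr \<gamma>"
      \<comment> \<open>With infinite norm of \<open>f\<close> the right-hand side is infinite only
        if the constant is nonzero, since 0 times infinity is 0 in \<open>ennreal\<close>.\<close>
      have "X > 0" using D c A by (simp add: X_def)
      then show ?thesis unfolding Lp top A_def[symmetric] X_def[symmetric] by (simp add: ennreal_mult_top)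
    next
      case (real F0)
      \<comment> \<open>Lets \<open>F\<close> decrease to the actual norm integral; p > 0 makes
        F^(1/p) continuous from the right even at F0 = 0.\<close>
      have "((\<lambda>F. ennreal (D * c * A powr \<gamma> * F powr (1 / p))) \<longlongrightarrow> ennreal (D * c * A powr \<gamma> * F0 powr (1 / p))) (at_right F0)"
        using real assms
        by (intro tendsto_ennrealI tendsto_mult tendsto_const tendsto_powr' tendsto_ident_at)
          (auto simp: eventually_at_filter intro!: always_eventually)
      moreover have "eventually (\<lambda>F. weak_norm \<mu> (\<lambda>x. w x powr q) q (T f) \<le> ennreal (D * c * A powr \<gamma> * F powr (1 / p))) (at_right F0)"
        unfolding eventually_at_filter using weak real by (auto simp: ennreal_less_iff intro!: always_eventually)
      ultimately have "weak_norm \<mu> (\<lambda>x. w x powr q) q (T f) \<le> ennreal (D * c * A powr \<gamma> * F0 powr (1 / p))"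
        by (rule tendsto_lowerbound) simp
      also have "\<dots> = ennreal (D * c * A powr \<gamma>) * enn_powr I (1 / p)"
        using real D c by (simp add: ennreal_mult)
      finally show ?thesis unfolding Lp A_def .
    qed
  qed
qed

end
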